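(* Let $K\ge 2$ be a fixed integer and let $\{A_n\}_{n\ge 0}$ be the annihilation-creation process on $\mathbf{Z}$ with parameter $K$ started from $A_0=\{0\}$ (defined in the context). Let $h(n)=\log n/\log\log n$. Then with probability $1$: 1) $\limsup_{n\to\infty} L(A_n)/h(n) = (K-1)/K$; 2) $\liminf_{n\to\infty} L(A_n) = K-2$.
   Context: Annihilation-creation process with integer parameter $K\ge 2$: a Markov chain $\{A_n\}_{n\ge0}$ of finite nonempty subsets of $\mathbf{Z}$ (occupied sites). Given $A_n$, the set $A_{n+1}$ is constructed by first adding $K$ sites one by one and then deleting $K-1$ sites one by one. In each addition step, the new site is chosen uniformly from the boundary of the current set of occupied sites, where the boundary of $a\subset\mathbf{Z}$ is $\partial a=\{y\in\mathbf{Z}\setminus a:\ \exists x\in a,\ |x-y|=1\}$. In each deletion step, the site to be removed is chosen uniformly from the current set of occupied sites. Thus $|A_{n+1}|=|A_n|+1$. A gap of $a\subset\mathbf{Z}$ is a nonempty subset $g$ of $\mathbf{Z}\setminus a$ such that there exist $x_1,x_2\in a$ with $g=\{y\in\mathbf{Z}: x_1<y<x_2\}$. For finite $a$, $L(a)$ is the number of unoccupied sites between the endpoints $\min a$ and $\max a$ of $a$, i.e. the sum of the sizes of all gaps of $a$. *)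

theory Defs
  imports "HOL-Probability.Probability"
begin

definition boundary :: "int set \<Rightarrow> int set" where
  "boundary a = {y. y \<notin> a \<and> (\<exists>x\<in>a. \<bar>x - y\<bar> = 1)}"

(* The choices below are uniform only on finite nonempty sets; pmf_of_set is unspecified otherwise.
   Starting from a finite nonempty set, no other case is ever reached. *)

definition add_site :: "int set \<Rightarrow> int set pmf" where
  "add_site a = map_pmf (\<lambda>y. insert y a) (pmf_of_set (boundary a))"

definition delete_site :: "int set \<Rightarrow> int set pmf" where
  "delete_site a = map_pmf (\<lambda>x. a - {x}) (pmf_of_set a)"

definition ac_step :: "nat \<Rightarrow> int set \<Rightarrow> int set pmf" where
  "ac_step K a =
     ((\<lambda>p. bind_pmf p delete_site) ^^ (K - 1))
       (((\<lambda>p. bind_pmf p add_site) ^^ K) (return_pmf a))"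

(* Any realisation, on any probability space, of the time-homogeneous Markov chain with
   transition probabilities ac_step K; the initial distribution is left open. *)

locale annihilation_creation_process = prob_space M
  for M :: "'w measure" and K :: nat and A :: "nat \<Rightarrow> 'w \<Rightarrow> int set" +
  assumes measurable_A: "\<And>n. A n \<in> M \<rightarrow>\<^sub>M count_space {a. finite a \<and> a \<noteq> {}}"
    and markov: "\<And>n a b. \<P>(\<omega> in M. \<forall>i\<le>n. A i \<omega> = a i) > 0 \<Longrightarrow>
      \<P>(\<omega> in M. A (Suc n) \<omega> = b \<bar> \<forall>i\<le>n. A i \<omega> = a i) = pmf (ac_step K (a n)) b"

definition L :: "int set \<Rightarrow> nat" where
  "L a = card ({Min a..Max a} - a)"

(* The values at n \<le> 2, where ln (ln n) is not positive, are irrelevant for limits. *)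

definition h :: "nat \<Rightarrow> real" where
  "h n = ln (real n) / ln (ln (real n))"

end

theory Submission
  imports Defs "HOL-Real_Asymp.Real_Asymp"
begin

text \<open>
  Call an unoccupied site between the endpoints a fringe site if it has an occupied neighbour and
  a core site otherwise. A gap of size \<open>g\<close> has \<open>g - 2\<close> core sites if \<open>g \<ge> 2\<close> and none otherwise, so \<open>L\<close> is the sum of the
  numbers \<open>f\<close> of fringe sites and \<open>c\<close> of core sites, and the boundary consists of the fringe and
  of two outer sites. An addition therefore lowers \<open>L\<close> by one with probability
  \<open>f / (f + 2)\<close> and otherwise keeps it; a deletion raises \<open>L\<close> by one unless it hits an endpoint,
  which has probability of order \<open>1 / n\<close>. In a typical step \<open>L\<close> thus changes by \<open>-1\<close> plus the number
  of the \<open>K\<close> additions that fall outside.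

  The constant of the limit superior comes from the cheapest way up. If \<open>c\<close> stays bounded, an
  addition falls outside with probability about \<open>2 / L\<close>, so raising \<open>L\<close> by the maximal amount \<open>K - 1\<close>
  costs about \<open>L powr (- K)\<close> and reaching a level \<open>l\<close> costs about \<open>l powr (- l * K / (K - 1))\<close>. This
  equals \<open>1 / n\<close> when \<open>l\<close> is asymptotic to \<open>(K - 1) / K * h n\<close>.

  The upper bound is a sequence of Lyapunov estimates. The obstacle is a long gap: it makes \<open>L\<close>
  large while offering only two boundary sites to the additions. Its core sites are filled
  eventually, but new ones appear only when a deletion hits a neighbour of the fringe, which has
  probability of order \<open>f / n\<close>. A potential that is \<open>L + c\<close> as long as \<open>f\<close> is bounded has
  negative drift, so \<open>L\<close> has bounded exponential moments (\<open>exp_moment_bounded\<close>). A potential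
  that pays a small power of \<open>n\<close> for each core site then shows that \<open>48\<close> or more core sites have
  probability at most \<open>4 / n ^ 4\<close> for large \<open>n\<close> (\<open>core_tail\<close>). With \<open>c\<close> under control, the expectation of a potential
  that is at least \<open>fact L powr \<kappa>\<close> up to the level in question stays bounded for every \<open>\<kappa> < K / (K - 1)\<close>
  (\<open>expectation_growth_bounded\<close>), and Markov's inequality and the Borel--Cantelli lemma finish
  (\<open>L_upper_tail\<close>, \<open>AE_L_upper\<close>).

  For the lower bound, every state below a level just under \<open>(K - 1) / K * h N\<close> climbs to it within a block
  whose length is of the order of \<open>h N\<close> with probability at least \<open>N powr (- 1 + \<epsilon>)\<close> for some \<open>\<epsilon> > 0\<close>. The interval
  from \<open>N\<close> to \<open>2 * N\<close> contains so many blocks that missing the level in all of them has vanishing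
  probability (\<open>AE_frequently_L_ge\<close>).

  For the limit inferior, \<open>L < K - 2\<close> forces two of the extreme sites to be deleted in the same
  step, which has probability of order \<open>1 / n\<^sup>2\<close> (\<open>ac_step_prob_L_small\<close>). On the other hand \<open>L = K - 2\<close>
  only needs one endpoint to be deleted after the gaps were closed. As the laws of \<open>L\<close> are tight, a
  bounded number of steps achieves this with probability at least a constant times \<open>1 / n\<close>, and the
  harmonic series diverges (\<open>AE_frequently_L_minimal\<close>).
\<close>

section \<open>Gaps, fringe and core\<close>

definition fringe :: "int set \<Rightarrow> int set" where
  "fringe a = {y \<in> {Min a..Max a}. y \<notin> a \<and> (y - 1 \<in> a \<or> y + 1 \<in> a)}"

definition core :: "int set \<Rightarrow> int set" where
  "core a = {y \<in> {Min a..Max a}. y \<notin> a \<and> y - 1 \<notin> a \<and> y + 1 \<notin> a}"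

lemma finite_fringe [simp]: "finite (fringe a)"
  by (rule finite_subset[of _ "{Min a..Max a}"]) (auto simp: fringe_def)

lemma finite_core [simp]: "finite (core a)"
  by (rule finite_subset[of _ "{Min a..Max a}"]) (auto simp: core_def)

lemma holes_fringe_core: "{Min a..Max a} - a = fringe a \<union> core a" "fringe a \<inter> core a = {}"
  by (auto simp: fringe_def core_def)

lemma L_eq_fringe_core: "L a = card (fringe a) + card (core a)"
  unfolding L_def holes_fringe_core(1)
  by (rule card_Un_disjoint) (auto simp: holes_fringe_core(2))

lemma boundary_eq_fringe:
  assumes "finite a" "a \<noteq> {}"
  shows "boundary a = insert (Min a - 1) (insert (Max a + 1) (fringe a))" (is "_ = ?R")
proof (rule set_eqI, rule iffI)
  fix y assume "y \<in> boundary a"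
  then obtain x where y: "y \<notin> a" and x: "x \<in> a" "\<bar>x - y\<bar> = 1"
    by (auto simp: boundary_def)
  have b: "Min a \<le> x" "x \<le> Max a" using assms x(1) by auto
  from x(2) have c: "x = y - 1 \<or> x = y + 1" by linarith
  show "y \<in> ?R"
  proof (cases "y < Min a \<or> Max a < y")
    case True
    then show ?thesis using b x(2) by auto
  next
    case False
    then show ?thesis using c x(1) y by (auto simp: fringe_def)
  qed
next
  fix y assume "y \<in> ?R"
  moreover have "Min a \<in> a" "Max a \<in> a" using assms by auto
  moreover have "Min a - 1 \<notin> a" "Max a + 1 \<notin> a"
    using assms Min_le[of a "Min a - 1"] Max_ge[of a "Max a + 1"] by auto
  ultimately show "y \<in> boundary a" unfolding boundary_def fringe_def
    by (smt (verit) insert_iff mem_Collect_eq)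
qed

text \<open>The two extra sites are the outer neighbours of the endpoints; they are what makes additions miss
  the gaps.\<close>

lemma card_boundary:
  assumes "finite a" "a \<noteq> {}"
  shows "card (boundary a) = card (fringe a) + 2"
proof -
  have "Min a \<le> Max a" using assms by simp
  then have "Min a - 1 \<notin> insert (Max a + 1) (fringe a)" "Max a + 1 \<notin> fringe a"
    by (auto simp: fringe_def)
  then show ?thesis unfolding boundary_eq_fringe[OF assms] by simp
qed

lemma finite_boundary:
  assumes "finite a" "a \<noteq> {}"
  shows "finite (boundary a)" "boundary a \<noteq> {}"
  using boundary_eq_fringe[OF assms] by auto

lemma insert_fringe_hull:
  assumes "finite a" "a \<noteq> {}" "y \<in> fringe a"
  shows "Min (insert y a) = Min a" "Max (insert y a) = Max a"
  using assms by (auto simp: fringe_def)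

lemma L_insert_fringe:
  assumes "finite a" "a \<noteq> {}" "y \<in> fringe a"
  shows "L a = Suc (L (insert y a))"
proof -
  have "{Min a..Max a} - a = insert y ({Min a..Max a} - insert y a)"
    using assms(3) by (auto simp: fringe_def)
  then show ?thesis unfolding L_def insert_fringe_hull[OF assms]
    by (metis Diff_iff card_insert_disjoint finite_Diff finite_atLeastAtMost_int insertCI)
qed

lemma core_insert_fringe:
  assumes "finite a" "a \<noteq> {}" "y \<in> fringe a"
  shows "core (insert y a) = core a - {y - 1, y + 1}"
  using assms(3) unfolding core_def insert_fringe_hull[OF assms] by (auto simp: fringe_def)

text \<open>An added fringe site has an occupied neighbour, so at most one of its two neighbours is in the
  core.\<close>

lemma card_core_insert_fringe:
  assumes "finite a" "a \<noteq> {}" "y \<in> fringe a"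
  shows "card (core (insert y a)) \<le> card (core a)"
        "card (core a) \<le> Suc (card (core (insert y a)))"
        "y - 1 \<in> core a \<or> y + 1 \<in> core a \<Longrightarrow> card (core a) = Suc (card (core (insert y a)))"
proof -
  note c = core_insert_fringe[OF assms]
  show le: "card (core (insert y a)) \<le> card (core a)"
    unfolding c by (rule card_mono) auto
  have "y - 1 \<notin> core a \<or> y + 1 \<notin> core a"
    using assms(3) by (auto simp: fringe_def core_def)
  then have "core a - {y - 1, y + 1} = core a - {y - 1} \<or> core a - {y - 1, y + 1} = core a - {y + 1}"
    by auto
  then obtain z where "core (insert y a) = core a - {z}" unfolding c by blast
  then show ge: "card (core a) \<le> Suc (card (core (insert y a)))"
    by (simp add: card_Diff_singleton_if) arith
  assume "y - 1 \<in> core a \<or> y + 1 \<in> core a"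
  then have "core (insert y a) \<subset> core a" unfolding c by auto
  then have "card (core (insert y a)) < card (core a)" by (simp add: psubset_card_mono)
  with ge show "card (core a) = Suc (card (core (insert y a)))" by simp
qed

lemma fringe_insert_fringe:
  assumes "finite a" "a \<noteq> {}" "y \<in> fringe a"
  shows "card (fringe (insert y a)) \<le> card (fringe a)"
        "card (fringe a) \<le> Suc (card (fringe (insert y a)))"
  using L_insert_fringe[OF assms] card_core_insert_fringe[OF assms]
    L_eq_fringe_core[of a] L_eq_fringe_core[of "insert y a"] by linarith+

lemma insert_outer:
  assumes "finite a" "a \<noteq> {}" "y = Min a - 1 \<or> y = Max a + 1"
  shows "L (insert y a) = L a" "core (insert y a) = core a" "fringe (insert y a) = fringe a"
proof -
  have m: "Min a \<in> a" "Max a \<in> a" "Min a \<le> Max a" using assms by auto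
  have h: "Min (insert y a) = min y (Min a)" "Max (insert y a) = max y (Max a)"
    using assms by auto
  have ng: "\<And>x. x \<in> a \<Longrightarrow> Min a \<le> x \<and> x \<le> Max a" using assms by auto
  have 1: "z \<in> core (insert y a) \<longleftrightarrow> z \<in> core a" for z
  proof (cases "z \<le> Min a \<or> Max a \<le> z")
    case True
    then consider "z = Min a \<or> z = Max a" | "z < Min a" | "Max a < z" by linarith
    then show ?thesis
    proof cases
      case 1
      then have "z \<in> a" using m by auto
      then show ?thesis by (simp add: core_def)
    next
      case 2
      then have "z \<notin> core a" by (simp add: core_def)
      moreover have "Min (insert y a) \<le> z \<Longrightarrow> z = y" using 2 assms(3) m(3) unfolding h(1) by linarith
      ultimately show ?thesis by (auto simp: core_def)
    next
      case 3
      then have "z \<notin> core a" by (simp add: core_def)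
      moreover have "z \<le> Max (insert y a) \<Longrightarrow> z = y" using 3 assms(3) m(3) unfolding h(2) by linarith
      ultimately show ?thesis by (auto simp: core_def)
    qed
  next
    case False
    then have "z \<noteq> y" "z - 1 \<noteq> y" "z + 1 \<noteq> y" using assms(3) m(3) by auto
    then show ?thesis using False by (auto simp: core_def h)
  qed
  then show "core (insert y a) = core a" by blast
  show "fringe (insert y a) = fringe a" unfolding fringe_def h
    using assms(3) m(3) m
    by (auto simp: min_def max_def split: if_splits)
  have "{Min (insert y a)..Max (insert y a)} - insert y a = {Min a..Max a} - a"
    unfolding h using assms(3) m(3) ng by (auto simp: min_def max_def split: if_splits)
  then show "L (insert y a) = L a" by (simp add: L_def)
qed

lemma boundary_cases:
  assumes "finite a" "a \<noteq> {}" "y \<in> boundary a"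
  shows "y \<in> fringe a \<or> y = Min a - 1 \<or> y = Max a + 1"
  using assms boundary_eq_fringe by auto

lemma fringe_nonempty:
  assumes "finite a" "a \<noteq> {}" "L a > 0"
  shows "card (fringe a) > 0"
proof -
  define X where "X = {Min a..Max a} - a"
  have X: "finite X" "X \<noteq> {}" using assms(3) by (auto simp: X_def L_def card_gt_0_iff)
  define y where "y = Min X"
  have "y \<in> X" using X by (simp add: y_def)
  have "Min a \<in> a" using assms by auto
  then have "y \<noteq> Min a" using \<open>y \<in> X\<close> by (auto simp: X_def)
  then have "y - 1 \<in> {Min a..Max a}" using \<open>y \<in> X\<close> by (auto simp: X_def)
  moreover have "y - 1 \<notin> X" using X Min_le[of X "y - 1"] by (auto simp: y_def)
  ultimately have "y - 1 \<in> a" by (auto simp: X_def)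
  then have "y \<in> fringe a" using \<open>y \<in> X\<close> by (auto simp: X_def fringe_def)
  then show ?thesis by (auto simp: card_gt_0_iff)
qed

text \<open>The sites just below the smallest and just above the largest core site are fringe sites. They
  guarantee that a nonempty core shrinks with probability at least \<open>2 / (f + 2)\<close> in each addition.\<close>

lemma two_fringe_sites_at_core:
  assumes "finite a" "a \<noteq> {}" "core a \<noteq> {}"
  shows "2 \<le> card {y \<in> fringe a. y - 1 \<in> core a \<or> y + 1 \<in> core a}"
proof -
  define d e where "d = Min (core a)" and "e = Max (core a)"
  have de: "d \<in> core a" "e \<in> core a" "d \<le> e" using assms(3) by (auto simp: d_def e_def)
  have "d - 1 \<notin> core a" using Min_le[of "core a" "d - 1"] assms(3) by (auto simp: d_def)
  have "e + 1 \<notin> core a" using Max_ge[of "core a" "e + 1"] assms(3) by (auto simp: e_def)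
  have m: "Min a \<in> a" "Max a \<in> a" using assms by auto
  have "Min a \<le> d - 1" "e + 1 \<le> Max a" using de m
    by (auto simp: core_def) (metis order_le_less zle_diff1_eq, metis order_le_less zless_imp_add1_zle)
  then have "d - 1 \<in> fringe a" "e + 1 \<in> fringe a"
    using de \<open>d - 1 \<notin> core a\<close> \<open>e + 1 \<notin> core a\<close> by (auto simp: core_def fringe_def)
  then have "{d - 1, e + 1} \<subseteq> {y \<in> fringe a. y - 1 \<in> core a \<or> y + 1 \<in> core a}"
    using de by auto
  then have "card {d - 1, e + 1} \<le> card {y \<in> fringe a. y - 1 \<in> core a \<or> y + 1 \<in> core a}"
    by (intro card_mono) auto
  then show ?thesis using de(3) by simp
qed

lemma hull_delete:
  assumes "finite a" "x \<in> a" "a - {x} \<noteq> {}"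
  shows "Min a \<le> Min (a - {x})" "Max (a - {x}) \<le> Max a"
        "Min a < x \<Longrightarrow> Min (a - {x}) = Min a" "x < Max a \<Longrightarrow> Max (a - {x}) = Max a"
proof -
  have f: "finite (a - {x})" "a \<noteq> {}" using assms by auto
  have g: "\<And>z. z \<in> a \<Longrightarrow> Min a \<le> z \<and> z \<le> Max a" using assms by auto
  have i: "Min (a - {x}) \<in> a - {x}" "Max (a - {x}) \<in> a - {x}"
    using Min_in[OF f(1) assms(3)] Max_in[OF f(1) assms(3)] by blast+
  show *: "Min a \<le> Min (a - {x})" "Max (a - {x}) \<le> Max a" using g i by blast+
  have ia: "Min a \<in> a" "Max a \<in> a" using assms(1) f(2) by auto
  show "Min (a - {x}) = Min a" if "Min a < x"
  proof -
    have "Min a \<in> a - {x}" using ia that by auto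
    then show ?thesis using * Min_le[OF f(1)] by force
  qed
  show "Max (a - {x}) = Max a" if "x < Max a"
  proof -
    have "Max a \<in> a - {x}" using ia that by auto
    then show ?thesis using * Max_ge[OF f(1)] by force
  qed
qed

lemma L_delete_le:
  assumes "finite a" "x \<in> a" "a - {x} \<noteq> {}"
  shows "L (a - {x}) \<le> Suc (L a)"
proof -
  have "{Min (a - {x})..Max (a - {x})} - (a - {x}) \<subseteq> insert x ({Min a..Max a} - a)"
    using hull_delete[OF assms] by auto
  then have "L (a - {x}) \<le> card (insert x ({Min a..Max a} - a))"
    unfolding L_def by (intro card_mono) auto
  also have "\<dots> = Suc (L a)" using assms by (simp add: L_def)
  finally show ?thesis .
qed

lemma L_delete_interior:
  assumes "finite a" "x \<in> a" "Min a < x" "x < Max a"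
  shows "L (a - {x}) = Suc (L a)"
proof -
  have "a \<noteq> {}" using assms(2) by blast
  then have "Min a \<in> a - {x}" using Min_in[OF assms(1)] assms(3) by auto
  then have ne: "a - {x} \<noteq> {}" by auto
  note h = hull_delete[OF assms(1,2) ne]
  have "{Min (a - {x})..Max (a - {x})} - (a - {x}) = insert x ({Min a..Max a} - a)"
    using h assms by auto
  then show ?thesis unfolding L_def using assms by simp
qed

lemma L_delete_end:
  assumes "finite a" "x = Min a \<or> x = Max a" "a - {x} \<noteq> {}"
  shows "L (a - {x}) \<le> L a"
proof -
  have "a \<noteq> {}" using assms(3) by blast
  then have x: "x \<in> a" using assms(1,2) Min_in Max_in by blast
  have "x \<notin> {Min (a - {x})..Max (a - {x})}"
  proof -
    have "Min (a - {x}) \<in> a - {x}" "Max (a - {x}) \<in> a - {x}"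
      using assms by (auto intro!: Min_in Max_in simp del: Diff_iff)
    then have "Min (a - {x}) \<noteq> x" "Max (a - {x}) \<noteq> x" by blast+
    then show ?thesis using assms(2) hull_delete[OF assms(1) x assms(3)] by auto
  qed
  then have "{Min (a - {x})..Max (a - {x})} - (a - {x}) \<subseteq> {Min a..Max a} - a"
    using hull_delete[OF assms(1) x assms(3)] by auto
  then show ?thesis unfolding L_def by (intro card_mono) auto
qed

lemma fringe_delete:
  assumes "finite a" "x \<in> a" "a - {x} \<noteq> {}"
  shows "card (fringe (a - {x})) \<le> Suc (card (fringe a))"
proof -
  have "fringe (a - {x}) \<subseteq> insert x (fringe a)"
    using hull_delete[OF assms] by (auto simp: fringe_def)
  then have "card (fringe (a - {x})) \<le> card (insert x (fringe a))" by (intro card_mono) auto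
  also have "\<dots> \<le> Suc (card (fringe a))" by (simp add: card_insert_le_m1 card_insert_if)
  finally show ?thesis .
qed

text \<open>Deleting \<open>x\<close> can only turn \<open>x\<close> and its neighbours into core sites, and only if \<open>x\<close> touches a
  gap: the neighbouring unoccupied site is then in the fringe because of \<open>x\<close>.\<close>

lemma core_delete:
  assumes "finite a" "x \<in> a" "a - {x} \<noteq> {}"
  shows "core (a - {x}) \<subseteq> core a \<union> {x - 1, x, x + 1}"
    and "\<not> core (a - {x}) \<subseteq> core a \<Longrightarrow> x - 1 \<in> fringe a \<or> x + 1 \<in> fringe a"
proof -
  show "core (a - {x}) \<subseteq> core a \<union> {x - 1, x, x + 1}"
    using hull_delete[OF assms] by (auto simp: core_def)
  assume "\<not> core (a - {x}) \<subseteq> core a"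
  then obtain y where y: "y \<in> core (a - {x})" "y \<notin> core a" by auto
  have ends: "Min (a - {x}) \<in> a - {x}" "Max (a - {x}) \<in> a - {x}"
    using assms by (auto intro!: Min_in Max_in simp del: Diff_iff)
  have "Min (a - {x}) \<noteq> y" "Max (a - {x}) \<noteq> y" using ends y(1) by (auto simp: core_def)
  then have i: "Min a < y" "y < Max a"
    using y(1) hull_delete[OF assms] by (auto simp: core_def)
  have "y - 1 = x \<or> y = x \<or> y + 1 = x" using y i by (auto simp: core_def)
  then show "x - 1 \<in> fringe a \<or> x + 1 \<in> fringe a"
    using i y assms(2) by (auto simp: core_def fringe_def)
qed

lemma card_core_delete_le:
  assumes "finite a" "x \<in> a" "a - {x} \<noteq> {}"
  shows "card (core (a - {x})) \<le> card (core a) + 3"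
proof -
  have "card (core (a - {x})) \<le> card (core a \<union> {x - 1, x, x + 1})"
    using core_delete(1)[OF assms] by (intro card_mono) auto
  also have "\<dots> \<le> card (core a) + card {x - 1, x, x + 1}" by (rule card_Un_le)
  finally show ?thesis by simp
qed

text \<open>Each fringe site has at most two occupied neighbours. This bound by the fringe, rather than by
  the number of all occupied sites, is what makes core sites rare.\<close>

lemma card_core_increasing_sites:
  assumes "finite a" "card a \<ge> 2"
  shows "card {x \<in> a. card (core (a - {x})) > card (core a)} \<le> 2 * card (fringe a)"
proof -
  let ?X = "{x \<in> a. card (core (a - {x})) > card (core a)}"
  have "?X \<subseteq> (\<lambda>z. z + 1) ` fringe a \<union> (\<lambda>z. z - 1) ` fringe a"
  proof
    fix x assume x: "x \<in> ?X"
    then have "a - {x} \<noteq> {}" using assms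
      by (metis (no_types, lifting) Diff_eq_empty_iff card_mono card.empty card_insert_disjoint finite.emptyI finite.insertI insert_absorb insert_not_empty not_less_eq_eq numeral_2_eq_2)
    moreover from x have "\<not> core (a - {x}) \<subseteq> core a"
      using card_mono[OF finite_core, of "core (a - {x})" a] by auto
    ultimately have "x - 1 \<in> fringe a \<or> x + 1 \<in> fringe a"
      using core_delete(2)[OF assms(1)] x by blast
    then show "x \<in> (\<lambda>z. z + 1) ` fringe a \<union> (\<lambda>z. z - 1) ` fringe a"
      by (auto simp: image_iff) (metis add.commute diff_add_cancel, metis add_diff_cancel)
  qed
  then have "card ?X \<le> card ((\<lambda>z. z + 1) ` fringe a \<union> (\<lambda>z. z - 1) ` fringe a)"
    by (intro card_mono) auto
  also have "\<dots> \<le> card ((\<lambda>z. z + 1) ` fringe a) + card ((\<lambda>z. z - 1) ` fringe a)"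
    by (rule card_Un_le)
  also have "\<dots> \<le> card (fringe a) + card (fringe a)"
    by (intro add_mono card_image_le) auto
  finally show ?thesis by simp
qed

section \<open>Expectations over additions and deletions\<close>

abbreviation expect :: "'a pmf \<Rightarrow> ('a \<Rightarrow> real) \<Rightarrow> real" where
  "expect p f \<equiv> measure_pmf.expectation p f"

abbreviation prob_of :: "'a pmf \<Rightarrow> 'a set \<Rightarrow> real" where
  "prob_of p B \<equiv> measure_pmf.prob p B"

lemma expectation_mono_finite:
  fixes f g :: "'a \<Rightarrow> real"
  assumes "finite (set_pmf p)" "\<And>x. x \<in> set_pmf p \<Longrightarrow> f x \<le> g x"
  shows "expect p f \<le> expect p g"
  using assms by (intro integral_mono_AE integrable_measure_pmf_finite) (auto simp: AE_measure_pmf_iff)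

lemma expectation_bind_finite:
  fixes f :: "'a \<Rightarrow> real"
  assumes "finite (set_pmf p)" "\<And>x. x \<in> set_pmf p \<Longrightarrow> finite (set_pmf (k x))"
  shows "expect (bind_pmf p k) f =
    expect p (\<lambda>x. expect (k x) f)"
  using assms by (subst pmf_expectation_bind[of "set_pmf p"])
    (auto simp: integral_measure_pmf[of "set_pmf p" p])

lemma prob_eq_expectation:
  "prob_of p B = expect p (\<lambda>x. if x \<in> B then 1 else 0 :: real)"
proof -
  have "prob_of p B = expect p (indicat_real B)" by simp
  also have "indicat_real B = (\<lambda>x. if x \<in> B then 1 else 0)" by (auto simp: indicator_def)
  finally show ?thesis .
qed

lemma expectation_const_pmf [simp]: "expect p (\<lambda>_. c) = (c :: real)"
  by simp

text \<open>Unfolding from the left makes a first-step analysis an induction over the number of steps.\<close>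

primrec kernel_power :: "('a \<Rightarrow> 'a pmf) \<Rightarrow> nat \<Rightarrow> 'a \<Rightarrow> 'a pmf" where
  "kernel_power f 0 a = return_pmf a"
| "kernel_power f (Suc k) a = bind_pmf (f a) (kernel_power f k)"

abbreviation adds :: "nat \<Rightarrow> int set \<Rightarrow> int set pmf" where
  "adds \<equiv> kernel_power add_site"

abbreviation dels :: "nat \<Rightarrow> int set \<Rightarrow> int set pmf" where
  "dels \<equiv> kernel_power delete_site"

lemma funpow_bind_pmf: "((\<lambda>p. bind_pmf p f) ^^ k) p = bind_pmf p (kernel_power f k)"
proof (induction k arbitrary: p)
  case 0
  then show ?case by (simp add: bind_return_pmf')
next
  case (Suc k)
  show ?case by (simp only: funpow_Suc_right o_def Suc bind_assoc_pmf kernel_power.simps)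
qed

lemma ac_step_eq: "ac_step K a = bind_pmf (adds K a) (dels (K - 1))"
  by (simp add: ac_step_def funpow_bind_pmf bind_return_pmf)

lemma kernel_power_Suc_right: "kernel_power f (Suc k) a = bind_pmf (kernel_power f k a) f"
  using funpow_bind_pmf[of "Suc k" f "return_pmf a"] funpow_bind_pmf[of k f "return_pmf a"]
  by (simp add: bind_return_pmf)

definition sized :: "nat \<Rightarrow> int set set" where
  "sized m = {a. finite a \<and> card a = m}"

lemma sizedD: "a \<in> sized m \<Longrightarrow> finite a" "a \<in> sized m \<Longrightarrow> card a = m"
  by (auto simp: sized_def)

lemma sized_nonempty: "a \<in> sized m \<Longrightarrow> m \<ge> 1 \<Longrightarrow> a \<noteq> {}"
  by (auto simp: sized_def)

lemma set_add_site:
  assumes "a \<in> sized m" "m \<ge> 1"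
  shows "set_pmf (add_site a) = (\<lambda>y. insert y a) ` boundary a" "finite (set_pmf (add_site a))"
  using finite_boundary[OF sizedD(1)[OF assms(1)] sized_nonempty[OF assms]] by (auto simp: add_site_def)

lemma set_delete_site:
  assumes "a \<in> sized m" "m \<ge> 1"
  shows "set_pmf (delete_site a) = (\<lambda>x. a - {x}) ` a" "finite (set_pmf (delete_site a))"
  using sizedD(1)[OF assms(1)] sized_nonempty[OF assms] by (auto simp: delete_site_def)

lemma add_site_sized:
  assumes "a \<in> sized m" "y \<in> boundary a"
  shows "insert y a \<in> sized (Suc m)"
  using assms by (auto simp: sized_def boundary_def)

lemma delete_site_sized:
  assumes "a \<in> sized (Suc m)" "x \<in> a"
  shows "a - {x} \<in> sized m"
  using assms by (auto simp: sized_def)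

lemma expectation_add_site:
  fixes f :: "int set \<Rightarrow> real"
  assumes "a \<in> sized m" "m \<ge> 1"
  shows "expect (add_site a) f =
    ((\<Sum>y\<in>fringe a. f (insert y a)) + f (insert (Min a - 1) a) + f (insert (Max a + 1) a))
      / (real (card (fringe a)) + 2)"
proof -
  note a = sizedD(1)[OF assms(1)] sized_nonempty[OF assms]
  have le: "Min a \<le> Max a" using a by simp
  have ni: "Min a - 1 \<notin> insert (Max a + 1) (fringe a)" "Max a + 1 \<notin> fringe a"
    using le by (auto simp: fringe_def)
  have "expect (add_site a) f = (\<Sum>y\<in>boundary a. f (insert y a)) / card (boundary a)"
    unfolding add_site_def using finite_boundary[OF a] by (simp add: integral_pmf_of_set)
  also have "(\<Sum>y\<in>boundary a. f (insert y a)) =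
      (\<Sum>y\<in>fringe a. f (insert y a)) + f (insert (Min a - 1) a) + f (insert (Max a + 1) a)"
    unfolding boundary_eq_fringe[OF a] using ni by simp
  finally show ?thesis by (simp add: card_boundary[OF a])
qed

lemma expectation_delete_site:
  fixes f :: "int set \<Rightarrow> real"
  assumes "a \<in> sized m" "m \<ge> 1"
  shows "expect (delete_site a) f = (\<Sum>x\<in>a. f (a - {x})) / real m"
  unfolding delete_site_def using sizedD[OF assms(1)] sized_nonempty[OF assms]
  by (simp add: integral_pmf_of_set)

lemma expectation_add_site_le:
  fixes f :: "int set \<Rightarrow> real"
  assumes "a \<in> sized m" "m \<ge> 1"
    and "\<And>y. y \<in> fringe a \<Longrightarrow> f (insert y a) \<le> u"
    and "\<And>y. y = Min a - 1 \<or> y = Max a + 1 \<Longrightarrow> f (insert y a) \<le> v"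
  shows "expect (add_site a) f \<le> (real (card (fringe a)) * u + 2 * v) / (real (card (fringe a)) + 2)"
proof -
  have "(\<Sum>y\<in>fringe a. f (insert y a)) \<le> (\<Sum>y\<in>fringe a. u)" by (intro sum_mono assms(3))
  then have "(\<Sum>y\<in>fringe a. f (insert y a)) \<le> real (card (fringe a)) * u" by simp
  moreover have "f (insert (Min a - 1) a) \<le> v" "f (insert (Max a + 1) a) \<le> v" by (auto intro: assms(4))
  ultimately show ?thesis unfolding expectation_add_site[OF assms(1,2)]
    by (intro divide_right_mono) auto
qed

lemma expectation_add_site_ge:
  fixes f :: "int set \<Rightarrow> real"
  assumes "a \<in> sized m" "m \<ge> 1"
    and "\<And>y. y \<in> fringe a \<Longrightarrow> f (insert y a) \<ge> u"
    and "\<And>y. y = Min a - 1 \<or> y = Max a + 1 \<Longrightarrow> f (insert y a) \<ge> v"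
  shows "expect (add_site a) f \<ge> (real (card (fringe a)) * u + 2 * v) / (real (card (fringe a)) + 2)"
  using expectation_add_site_le[OF assms(1,2), of "\<lambda>a. - f a" "-u" "-v"] assms(3,4)
  by (simp add: add_divide_distrib diff_divide_distrib)

text \<open>As \<open>expectation_add_site_le\<close>, with the better value \<open>u'\<close> at the two fringe sites next to the
  core.\<close>

lemma expectation_add_site_core_le:
  fixes f :: "int set \<Rightarrow> real"
  assumes "a \<in> sized m" "m \<ge> 1" "core a \<noteq> {}" "u' \<le> u"
    and "\<And>y. y \<in> fringe a \<Longrightarrow> y - 1 \<in> core a \<or> y + 1 \<in> core a \<Longrightarrow> f (insert y a) \<le> u'"
    and "\<And>y. y \<in> fringe a \<Longrightarrow> f (insert y a) \<le> u"
    and "\<And>y. y = Min a - 1 \<or> y = Max a + 1 \<Longrightarrow> f (insert y a) \<le> v"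
  shows "card (fringe a) \<ge> 2"
    and "expect (add_site a) f \<le>
      (2 * u' + (real (card (fringe a)) - 2) * u + 2 * v) / (real (card (fringe a)) + 2)"
proof -
  define X where "X = {y \<in> fringe a. y - 1 \<in> core a \<or> y + 1 \<in> core a}"
  have X: "finite X" "X \<subseteq> fringe a" "2 \<le> card X"
    using two_fringe_sites_at_core[OF sizedD(1)[OF assms(1)] sized_nonempty[OF assms(1,2)] assms(3)]
    by (auto simp: X_def)
  have cX: "card X \<le> card (fringe a)" using X by (intro card_mono) auto
  then show "card (fringe a) \<ge> 2" using X by simp
  have "(\<Sum>y\<in>fringe a. f (insert y a)) = (\<Sum>y\<in>X. f (insert y a)) + (\<Sum>y\<in>fringe a - X. f (insert y a))"
    using X by (subst sum.subset_diff[OF X(2)]) auto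
  also have "\<dots> \<le> (\<Sum>y\<in>X. u') + (\<Sum>y\<in>fringe a - X. u)"
    using assms(5,6) by (intro add_mono sum_mono) (auto simp: X_def)
  also have "\<dots> = real (card X) * u' + (real (card (fringe a)) - real (card X)) * u"
    using X cX by (simp add: card_Diff_subset of_nat_diff)
  also have "\<dots> = real (card (fringe a)) * u - real (card X) * (u - u')" by (simp add: algebra_simps)
  also have "\<dots> \<le> real (card (fringe a)) * u - 2 * (u - u')"
    using X(3) assms(4) by (intro diff_left_mono mult_right_mono) auto
  finally have 1: "(\<Sum>y\<in>fringe a. f (insert y a)) \<le> 2 * u' + (real (card (fringe a)) - 2) * u"
    by (simp add: algebra_simps)
  moreover have "f (insert (Min a - 1) a) \<le> v" "f (insert (Max a + 1) a) \<le> v" by (auto intro: assms(7))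
  ultimately show "expect (add_site a) f \<le>
      (2 * u' + (real (card (fringe a)) - 2) * u + 2 * v) / (real (card (fringe a)) + 2)"
    unfolding expectation_add_site[OF assms(1,2)] by (intro divide_right_mono) auto
qed

lemma expectation_delete_site_le:
  fixes f :: "int set \<Rightarrow> real"
  assumes "a \<in> sized m" "m \<ge> 1" "X \<subseteq> a" "real (card X) \<le> q * real m" "0 \<le> u" "0 \<le> v"
    and "\<And>x. x \<in> a - X \<Longrightarrow> f (a - {x}) \<le> u"
    and "\<And>x. x \<in> X \<Longrightarrow> f (a - {x}) \<le> v"
  shows "expect (delete_site a) f \<le> u + q * v"
proof -
  note a = sizedD[OF assms(1)]
  have fX: "finite X" using a assms(3) by (auto intro: finite_subset)
  have "(\<Sum>x\<in>a. f (a - {x})) = (\<Sum>x\<in>X. f (a - {x})) + (\<Sum>x\<in>a - X. f (a - {x}))"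
    using a assms(3) fX by (subst sum.subset_diff[OF assms(3)]) auto
  also have "\<dots> \<le> (\<Sum>x\<in>X. v) + (\<Sum>x\<in>a - X. u)"
    using assms(7,8) by (intro add_mono sum_mono) auto
  also have "\<dots> = real (card X) * v + real (card (a - X)) * u" by simp
  also have "\<dots> \<le> (q * real m) * v + real m * u"
    using assms a card_mono[of a "a - X"] by (intro add_mono mult_right_mono) auto
  also have "\<dots> = (u + q * v) * real m" by (simp add: algebra_simps)
  finally show ?thesis unfolding expectation_delete_site[OF assms(1,2)]
    using assms(2) by (simp add: pos_divide_le_eq)
qed

lemma expectation_delete_site_interior_ge:
  fixes f :: "int set \<Rightarrow> real"
  assumes "a \<in> sized m" "m \<ge> 3" "0 \<le> u" "\<And>x. 0 \<le> f x"
    and "\<And>x. x \<in> a \<Longrightarrow> Min a < x \<Longrightarrow> x < Max a \<Longrightarrow> f (a - {x}) \<ge> u"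
  shows "expect (delete_site a) f \<ge> u / 3"
proof -
  note a = sizedD[OF assms(1)]
  have m1: "m \<ge> 1" using assms by simp
  let ?I = "a - {Min a, Max a}"
  have "card a - card {Min a, Max a} \<le> card ?I" by (rule diff_card_le_card_Diff) simp
  moreover have "card {Min a, Max a} \<le> 2" by (simp add: card_insert_if)
  ultimately have "card a \<le> card ?I + 2" by linarith
  then have c: "real m \<le> real (card ?I) + 2" using a by linarith
  have "real (card ?I) * u = (\<Sum>x\<in>?I. u)" by simp
  also have "\<dots> \<le> (\<Sum>x\<in>?I. f (a - {x}))"
  proof (intro sum_mono assms(5))
    fix x assume x: "x \<in> ?I"
    then have "Min a \<le> x" "x \<le> Max a" using a by auto
    with x show "x \<in> a" "Min a < x" "x < Max a" by auto
  qed
  also have "\<dots> \<le> (\<Sum>x\<in>a. f (a - {x}))" using a assms(4) by (intro sum_mono2) auto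
  finally have 1: "real (card ?I) * u \<le> (\<Sum>x\<in>a. f (a - {x}))" .
  have "(real m / 3) * u \<le> (real m - 2) * u" using assms(2,3) by (intro mult_right_mono) auto
  then have "real m * (u / 3) \<le> (real m - 2) * u" by simp
  also have "\<dots> \<le> real (card ?I) * u" using c assms(3) by (intro mult_right_mono) auto
  finally show ?thesis unfolding expectation_delete_site[OF assms(1) m1]
    using 1 m1 by (simp add: pos_le_divide_eq mult.commute)
qed

lemma kernel_power_support:
  assumes "\<And>i b. i < k \<Longrightarrow> I i b \<Longrightarrow> finite (set_pmf (f b)) \<and> (\<forall>c\<in>set_pmf (f b). I (Suc i) c)" "I 0 a"
  shows "finite (set_pmf (kernel_power f k a))" "a' \<in> set_pmf (kernel_power f k a) \<Longrightarrow> I k a'"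
proof -
  have "finite (set_pmf (kernel_power f k a)) \<and> (\<forall>a'\<in>set_pmf (kernel_power f k a). I k a')"
    using assms
  proof (induction k)
    case (Suc k)
    have IH: "finite (set_pmf (kernel_power f k a)) \<and> (\<forall>a'\<in>set_pmf (kernel_power f k a). I k a')"
      by (rule Suc.IH[OF Suc.prems(1)[OF less_SucI] Suc.prems(2)])
    then have "finite (set_pmf (f b)) \<and> (\<forall>c\<in>set_pmf (f b). I (Suc k) c)"
      if "b \<in> set_pmf (kernel_power f k a)" for b
      using Suc.prems(1)[of k b] that by blast
    with IH show ?case unfolding kernel_power_Suc_right set_bind_pmf by blast
  qed simp
  then show "finite (set_pmf (kernel_power f k a))" "a' \<in> set_pmf (kernel_power f k a) \<Longrightarrow> I k a'" by auto
qed

lemma adds_support: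
  assumes "a \<in> sized m" "m \<ge> 1"
  shows "finite (set_pmf (adds k a))"
    and "a' \<in> set_pmf (adds k a) \<Longrightarrow>
      a' \<in> sized (m + k) \<and> card (core a') \<le> card (core a) \<and> card (fringe a') \<le> card (fringe a) \<and>
      L a' \<le> L a \<and> L a \<le> L a' + k"
proof -
  let ?I = "\<lambda>i b. b \<in> sized (m + i) \<and> card (core b) \<le> card (core a) \<and> card (fringe b) \<le> card (fringe a) \<and>
      L b \<le> L a \<and> L a \<le> L b + i"
  have step: "finite (set_pmf (add_site b)) \<and> (\<forall>c\<in>set_pmf (add_site b). ?I (Suc i) c)" if b: "?I i b" for i b
  proof (intro conjI[OF set_add_site(2)] ballI)
    show bs: "b \<in> sized (m + i)" "1 \<le> m + i" using b assms(2) by auto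
    note fb = sizedD(1)[OF bs(1)] sized_nonempty[OF bs]
    fix c assume "c \<in> set_pmf (add_site b)"
    then obtain y where y: "y \<in> boundary b" "c = insert y b" using set_add_site(1)[OF bs] by auto
    have c: "c \<in> sized (m + Suc i)" using add_site_sized[OF bs(1) y(1)] y(2) by simp
    from boundary_cases[OF fb y(1)] show "?I (Suc i) c"
    proof
      assume f: "y \<in> fringe b"
      show ?thesis using b c y(2) card_core_insert_fringe(1)[OF fb f]
        fringe_insert_fringe(1)[OF fb f] L_insert_fringe[OF fb f] by simp
    next
      assume f: "y = Min b - 1 \<or> y = Max b + 1"
      show ?thesis using b c y(2) insert_outer[OF fb f] by simp
    qed
  qed
  have "?I 0 a" using assms(1) by simp
  note * = kernel_power_support[of k ?I add_site a, OF step this]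
  show "finite (set_pmf (adds k a))" by (rule *(1))
  show "a' \<in> set_pmf (adds k a) \<Longrightarrow> ?I k a'" by (rule *(2))
qed

lemma dels_support:
  assumes "a \<in> sized m" "k < m"
  shows "finite (set_pmf (dels k a))"
    and "a' \<in> set_pmf (dels k a) \<Longrightarrow>
      a' \<in> sized (m - k) \<and> a' \<subseteq> a \<and> card (core a') \<le> card (core a) + 3 * k \<and>
      card (fringe a') \<le> card (fringe a) + k \<and> L a' \<le> L a + k"
proof -
  let ?I = "\<lambda>i b. b \<in> sized (m - i) \<and> b \<subseteq> a \<and> card (core b) \<le> card (core a) + 3 * i \<and>
      card (fringe b) \<le> card (fringe a) + i \<and> L b \<le> L a + i"
  have step: "finite (set_pmf (delete_site b)) \<and> (\<forall>c\<in>set_pmf (delete_site b). ?I (Suc i) c)"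
    if i: "i < k" and b: "?I i b" for i b
  proof (intro conjI[OF set_delete_site(2)] ballI)
    show bs: "b \<in> sized (m - i)" "1 \<le> m - i" using b i assms(2) by auto
    fix c assume "c \<in> set_pmf (delete_site b)"
    then obtain x where x: "x \<in> b" "c = b - {x}" using set_delete_site(1)[OF bs] by auto
    have "m - i = Suc (m - Suc i)" using i assms(2) by simp
    then have s: "b - {x} \<in> sized (m - Suc i)" using delete_site_sized[of b "m - Suc i" x] bs x(1) by simp
    have "b - {x} \<noteq> {}" using sized_nonempty[OF s] i assms(2) by simp
    note c = sizedD(1)[OF bs(1)] x(1) this
    show "?I (Suc i) c"
      using b s x(2) card_core_delete_le[OF c] fringe_delete[OF c] L_delete_le[OF c] by auto
  qed
  have "?I 0 a" using assms(1) by simp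
  note * = kernel_power_support[of k ?I delete_site a, OF step this]
  show "finite (set_pmf (dels k a))" by (rule *(1))
  show "a' \<in> set_pmf (dels k a) \<Longrightarrow> ?I k a'" by (rule *(2))
qed

lemma expectation_adds_Suc:
  fixes f :: "int set \<Rightarrow> real"
  assumes "a \<in> sized m" "m \<ge> 1"
  shows "expect (adds (Suc k) a) f =
    expect (add_site a) (\<lambda>b. expect (adds k b) f)"
  unfolding kernel_power.simps
proof (rule expectation_bind_finite)
  fix b assume "b \<in> set_pmf (add_site a)"
  then have "b \<in> sized (Suc m)" using set_add_site[OF assms] add_site_sized[OF assms(1)] by auto
  then show "finite (set_pmf (adds k b))" using adds_support(1) by auto
qed (rule set_add_site(2)[OF assms])

lemma expectation_dels_Suc:
  fixes f :: "int set \<Rightarrow> real"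
  assumes "a \<in> sized m" "Suc k < m"
  shows "expect (dels (Suc k) a) f =
    expect (delete_site a) (\<lambda>b. expect (dels k b) f)"
  unfolding kernel_power.simps
proof (rule expectation_bind_finite)
  from assms obtain m' where m': "m = Suc m'" "k < m'" by (cases m) auto
  fix b assume "b \<in> set_pmf (delete_site a)"
  then have "b \<in> sized m'" using set_delete_site[OF assms(1)] m' delete_site_sized assms(1) by auto
  then show "finite (set_pmf (dels k b))" using dels_support(1) m' by auto
qed (use set_delete_site(2)[OF assms(1)] assms(2) in auto)

lemma expectation_ac_step:
  fixes f :: "int set \<Rightarrow> real"
  assumes "a \<in> sized m" "m \<ge> 1"
  shows "expect (ac_step K a) f =
    expect (adds K a)
      (\<lambda>b. expect (dels (K - 1) b) f)"
  unfolding ac_step_eq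
proof (rule expectation_bind_finite)
  fix b assume "b \<in> set_pmf (adds K a)"
  then have "b \<in> sized (m + K)" using adds_support(2)[OF assms] by blast
  then show "finite (set_pmf (dels (K - 1) b))"
    using dels_support(1)[of b "m + K" "K - 1"] assms(2) by auto
qed (rule adds_support(1)[OF assms])

lemma ac_step_support:
  assumes "a \<in> sized m" "m \<ge> 1" "K \<ge> 1"
  shows "finite (set_pmf (ac_step K a))"
    and "a' \<in> set_pmf (ac_step K a) \<Longrightarrow>
      a' \<in> sized (Suc m) \<and> L a' \<le> L a + K \<and> card (core a') \<le> card (core a) + 3 * K"
proof -
  have s: "b \<in> sized (m + K) \<and> L b \<le> L a \<and> card (core b) \<le> card (core a)"
    if "b \<in> set_pmf (adds K a)" for b
    using adds_support(2)[OF assms(1,2) that] by blast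
  have t: "K - 1 < m + K" using assms by simp
  show "finite (set_pmf (ac_step K a))"
    unfolding ac_step_eq using dels_support(1)[OF _ t] s adds_support(1)[OF assms(1,2)] by auto
  assume "a' \<in> set_pmf (ac_step K a)"
  then obtain b where b: "b \<in> set_pmf (adds K a)"
    "a' \<in> set_pmf (dels (K - 1) b)" unfolding ac_step_eq by auto
  have "m + K - (K - 1) = Suc m" using assms by simp
  then show "a' \<in> sized (Suc m) \<and> L a' \<le> L a + K \<and> card (core a') \<le> card (core a) + 3 * K"
    using dels_support(2)[OF _ t b(2)] s[OF b(1)] by fastforce
qed

text \<open>The number of additions that fall outside is dominated by a binomial variable: as long as
  fewer than \<open>k\<close> sites have been filled, each addition falls outside with probability at most \<open>\<eta>\<close>. If every
  outside addition costs a factor \<open>W\<close>, the binomial theorem gives \<open>(1 + \<eta> * W) ^ k\<close>. The summand \<open>R\<close>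
  belongs to the path on which all additions fall inside; separating it allows \<open>c * W\<close> to be the
  right scale for one outside addition when \<open>W\<close> is large.\<close>

lemma adds_expectation_le:
  fixes G :: "nat \<Rightarrow> real"
  assumes "a \<in> sized m" "m \<ge> 1" "k \<le> card (fringe a)" "\<eta> \<ge> 0" "2 \<le> \<eta> * (real (card (fringe a)) + 3 - real k)"
    "W \<ge> 0" "c \<ge> 0" "R \<ge> 0"
    "\<And>i. i \<le> k \<Longrightarrow> G (L a - k + i) \<le> c * W ^ i + (if i = 0 then R else 0)"
  shows "expect (adds k a) (\<lambda>a'. G (L a')) \<le> c * (1 + \<eta> * W) ^ k + R"
  using assms
proof (induction k arbitrary: a m c R)
  case 0
  then show ?case using "0.prems"(9)[of 0] by simp
next
  case (Suc k)
  note a = sizedD(1)[OF Suc.prems(1)] sized_nonempty[OF Suc.prems(1,2)]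
  let ?b = "real (card (fringe a))"
  let ?f = "\<lambda>b. expect (adds k b) (\<lambda>a'. G (L a'))"
  have kL: "Suc k \<le> L a" using Suc.prems(3) L_eq_fringe_core[of a] by linarith
  have fr: "\<And>y. y \<in> fringe a \<Longrightarrow> y \<in> boundary a" using boundary_eq_fringe[OF a] by auto
  have ou: "\<And>y. y = Min a - 1 \<or> y = Max a + 1 \<Longrightarrow> y \<in> boundary a" using boundary_eq_fringe[OF a] by auto
  have in_le: "?f (insert y a) \<le> c * (1 + \<eta> * W) ^ k + R" if y: "y \<in> fringe a" for y
  proof (rule Suc.IH[OF add_site_sized[OF Suc.prems(1) fr[OF y]]])
    show "k \<le> card (fringe (insert y a))" using fringe_insert_fringe(2)[OF a y] Suc.prems(3) by linarith
    have "\<eta> * (?b + 3 - real (Suc k)) \<le> \<eta> * (real (card (fringe (insert y a))) + 3 - real k)"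
      using fringe_insert_fringe(2)[OF a y] Suc.prems(4) by (intro mult_left_mono) auto
    then show "2 \<le> \<eta> * (real (card (fringe (insert y a))) + 3 - real k)" using Suc.prems(5) by linarith
    show "G (L (insert y a) - k + i) \<le> c * W ^ i + (if i = 0 then R else 0)" if "i \<le> k" for i
      using Suc.prems(9)[of i] that L_insert_fringe[OF a y] by simp
  qed (use Suc.prems in auto)
  have out_le: "?f (insert y a) \<le> (c * W) * (1 + \<eta> * W) ^ k + 0" if y: "y = Min a - 1 \<or> y = Max a + 1" for y
  proof (rule Suc.IH[OF add_site_sized[OF Suc.prems(1) ou[OF y]]])
    note o = insert_outer[OF a y]
    show "k \<le> card (fringe (insert y a))" using o Suc.prems(3) by simp
    have "\<eta> * (?b + 3 - real (Suc k)) \<le> \<eta> * (?b + 3 - real k)"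
      using Suc.prems(4) by (intro mult_left_mono) auto
    then show "2 \<le> \<eta> * (real (card (fringe (insert y a))) + 3 - real k)" using Suc.prems(5) o by simp
    show "G (L (insert y a) - k + i) \<le> c * W * W ^ i + (if i = 0 then 0 else 0)" if "i \<le> k" for i
    proof -
      have e: "L (insert y a) - k + i = L a - Suc k + Suc i" using kL o by simp
      have "G (L (insert y a) - k + i) \<le> c * W ^ Suc i" unfolding e using Suc.prems(9)[of "Suc i"] that by simp
      then show ?thesis by (simp add: mult.assoc)
    qed
  qed (use Suc.prems in auto)
  let ?P = "(1 + \<eta> * W) ^ k"
  have P: "?P \<ge> 0" using Suc.prems by simp
  have e2: "2 / (?b + 2) \<le> \<eta>"
  proof -
    have "\<eta> * (?b + 3 - real (Suc k)) \<le> \<eta> * (?b + 2)" using Suc.prems(4) by (intro mult_left_mono) auto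
    then show ?thesis using Suc.prems(5) by (simp add: pos_divide_le_eq)
  qed
  have "expect (adds (Suc k) a) (\<lambda>a'. G (L a')) =
      expect (add_site a) ?f" by (rule expectation_adds_Suc[OF Suc.prems(1,2)])
  also have "\<dots> \<le> (?b * (c * ?P + R) + 2 * (c * W * ?P)) / (?b + 2)"
    using expectation_add_site_le[OF Suc.prems(1,2), of ?f] in_le out_le by simp
  also have "\<dots> = (c * ?P + R) * (?b / (?b + 2)) + (2 / (?b + 2)) * (c * W * ?P)"
    by (simp add: add_divide_distrib)
  also have "\<dots> \<le> (c * ?P + R) * 1 + \<eta> * (c * W * ?P)"
    using P Suc.prems e2 by (intro add_mono mult_left_mono mult_right_mono) auto
  also have "\<dots> = c * (1 + \<eta> * W) ^ Suc k + R" by (simp add: algebra_simps)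
  finally show ?case .
qed

text \<open>A deletion raises the first argument by at most one and, with probability at most \<open>q\<close>, the
  second by at most three.\<close>

lemma dels_expectation_le:
  fixes \<Phi> :: "nat \<Rightarrow> nat \<Rightarrow> real"
  assumes "a \<in> sized m" "k < m" "\<And>l s. 0 \<le> \<Phi> l s"
    and mono: "\<And>l l' s s'. l \<le> l' \<Longrightarrow> s \<le> s' \<Longrightarrow> \<Phi> l s \<le> \<Phi> l' s'"
    and Q: "\<And>l s. \<Phi> l (s + 3) \<le> Q * \<Phi> l s" "Q \<ge> 0"
    and q: "q \<ge> 0" "2 * (real (card (fringe a)) + real k) \<le> q * (real m - real k)"
  shows "expect (dels k a) (\<lambda>a'. \<Phi> (L a') (card (core a'))) \<le>
    (1 + q * Q) ^ k * \<Phi> (L a + k) (card (core a))"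
  using assms(1,2) q(2)
proof (induction k arbitrary: a m)
  case (Suc k)
  from Suc.prems obtain m' where m': "m = Suc m'" "k < m'" by (cases m) auto
  have m1: "m \<ge> 1" "m' \<ge> 1" using m' by auto
  let ?b = "real (card (fringe a))"
  let ?f = "\<lambda>b. expect (dels k b) (\<lambda>a'. \<Phi> (L a') (card (core a')))"
  let ?P = "(1 + q * Q) ^ k"
  let ?u = "?P * \<Phi> (L a + Suc k) (card (core a))"
  let ?X = "{x \<in> a. card (core (a - {x})) > card (core a)}"
  have P: "?P \<ge> 0" using Q q by simp
  have IH: "?f (a - {x}) \<le> ?P * \<Phi> (L a + Suc k) (card (core (a - {x})))" if x: "x \<in> a" for x
  proof -
    have s: "a - {x} \<in> sized m'" using delete_site_sized x Suc.prems(1) m' by auto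
    note c = sizedD(1)[OF Suc.prems(1)] x sized_nonempty[OF s m1(2)]
    have "?f (a - {x}) \<le> ?P * \<Phi> (L (a - {x}) + k) (card (core (a - {x})))"
    proof (rule Suc.IH[OF s m'(2)])
      show "2 * (real (card (fringe (a - {x}))) + real k) \<le> q * (real m' - real k)"
        using Suc.prems(3) m' fringe_delete[OF c] by simp
    qed
    also have "\<dots> \<le> ?P * \<Phi> (L a + Suc k) (card (core (a - {x})))"
      using L_delete_le[OF c] P by (intro mult_left_mono mono) auto
    finally show ?thesis .
  qed
  have "expect (dels (Suc k) a) (\<lambda>a'. \<Phi> (L a') (card (core a'))) =
      expect (delete_site a) ?f" by (rule expectation_dels_Suc[OF Suc.prems(1,2)])
  also have "\<dots> \<le> ?u + q * (Q * ?u)"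
  proof (rule expectation_delete_site_le[OF Suc.prems(1) m1(1), of ?X])
    have "card ?X \<le> 2 * card (fringe a)"
      using card_core_increasing_sites[of a] sizedD[OF Suc.prems(1)] m' by simp
    then have "real (card ?X) \<le> 2 * (?b + real (Suc k))" by simp
    also have "\<dots> \<le> q * (real m - real (Suc k))" by (rule Suc.prems(3))
    also have "\<dots> \<le> q * real m" using q by (intro mult_left_mono) auto
    finally show "real (card ?X) \<le> q * real m" .
    show "0 \<le> ?u" "0 \<le> Q * ?u" using P Q assms(3) by auto
    show "?f (a - {x}) \<le> ?u" if "x \<in> a - ?X" for x
      by (rule order_trans[OF IH]) (use that P in \<open>auto intro!: mult_left_mono mono\<close>)
    show "?f (a - {x}) \<le> Q * ?u" if "x \<in> ?X" for x
    proof -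
      have x: "x \<in> a" using that by auto
      have s: "a - {x} \<in> sized m'" using delete_site_sized x Suc.prems(1) m' by auto
      note c = sizedD(1)[OF Suc.prems(1)] x sized_nonempty[OF s m1(2)]
      have "?f (a - {x}) \<le> ?P * \<Phi> (L a + Suc k) (card (core (a - {x})))" by (rule IH[OF x])
      also have "\<dots> \<le> ?P * (Q * \<Phi> (L a + Suc k) (card (core a)))"
        using card_core_delete_le[OF c] P
        by (intro mult_left_mono order_trans[OF _ Q(1)] mono) auto
      finally show ?thesis by (simp add: mult.left_commute)
    qed
  qed auto
  also have "\<dots> = (1 + q * Q) ^ Suc k * \<Phi> (L a + Suc k) (card (core a))" by (simp add: algebra_simps)
  finally show ?case .
qed simp

section \<open>Exponential moments of the number of unoccupied sites\<close>

text \<open>While the core is nonempty, \<open>L + c\<close> drops on average by at least one per addition: of the \<open>f + 2\<close>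
  boundary sites, \<open>f\<close> lower \<open>L\<close> and at least two of these also lower \<open>c\<close>. The worst case is \<open>f = 2\<close>, where
  the drop is zero or two with equal probability.\<close>

lemma expectation_add_site_exp_le:
  assumes "a \<in> sized m" "m \<ge> 1" "core a \<noteq> {}" "\<theta> \<ge> 0"
  shows "expect (add_site a) (\<lambda>a'. exp (\<theta> * (real (L a') + real (card (core a')))))
    \<le> (1 + exp (- 2 * \<theta>)) / 2 * exp (\<theta> * (real (L a) + real (card (core a))))"
proof -
  note a = sizedD(1)[OF assms(1)] sized_nonempty[OF assms(1,2)]
  define F where "F = exp (\<theta> * (real (L a) + real (card (core a))))"
  define r where "r = (1 + exp (- 2 * \<theta>)) / 2"
  let ?f = "\<lambda>a'. exp (\<theta> * (real (L a') + real (card (core a'))))"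
  let ?b = "real (card (fringe a))"
  have "(1 - exp (-\<theta>))\<^sup>2 = 1 + exp (- 2 * \<theta>) - 2 * exp (-\<theta>)"
    by (simp add: power2_eq_square algebra_simps mult_exp_exp)
  then have r: "exp (-\<theta>) \<le> r" using zero_le_power2[of "1 - exp (-\<theta>)"] by (simp add: r_def)
  have F: "F > 0" by (simp add: F_def)
  have f1: "?f (insert y a) \<le> exp (- 2 * \<theta>) * F"
    if "y \<in> fringe a" "y - 1 \<in> core a \<or> y + 1 \<in> core a" for y
  proof -
    have "real (L (insert y a)) + real (card (core (insert y a))) = real (L a) + real (card (core a)) - 2"
      using L_insert_fringe[OF a that(1)] card_core_insert_fringe(3)[OF a that] by simp
    then have "?f (insert y a) = exp (\<theta> * (real (L a) + real (card (core a)) - 2))" by simp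
    also have "\<dots> = exp (- 2 * \<theta>) * F" by (simp add: F_def mult_exp_exp algebra_simps)
    finally show ?thesis by simp
  qed
  have f2: "?f (insert y a) \<le> exp (-\<theta>) * F" if "y \<in> fringe a" for y
  proof -
    have "real (L (insert y a)) + real (card (core (insert y a))) \<le> real (L a) + real (card (core a)) - 1"
      using L_insert_fringe[OF a that(1)] card_core_insert_fringe(1)[OF a that] by simp
    then have "?f (insert y a) \<le> exp (\<theta> * (real (L a) + real (card (core a)) - 1))"
      using assms(4) by (auto intro: mult_left_mono)
    also have "\<dots> = exp (- \<theta>) * F" by (simp add: F_def mult_exp_exp algebra_simps)
    finally show ?thesis by simp
  qed
  have f3: "?f (insert y a) \<le> F" if "y = Min a - 1 \<or> y = Max a + 1" for y
    using insert_outer[OF a that] by (simp add: F_def)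
  have le: "exp (- 2 * \<theta>) * F \<le> exp (-\<theta>) * F" using F assms(4) by simp
  note A = expectation_add_site_core_le[OF assms(1-3) le, of ?f F, OF f1 f2 f3]
  have b2: "?b \<ge> 2" using A(1) by linarith
  have "2 * (exp (- 2 * \<theta>) * F) + (?b - 2) * (exp (-\<theta>) * F) + 2 * F
      = (4 * r + (?b - 2) * exp (-\<theta>)) * F" by (simp add: r_def algebra_simps)
  also have "\<dots> \<le> (4 * r + (?b - 2) * r) * F"
    using b2 r F by (intro mult_right_mono add_left_mono mult_left_mono) auto
  also have "\<dots> = r * F * (?b + 2)" by (simp add: algebra_simps)
  finally have "(2 * (exp (- 2 * \<theta>) * F) + (?b - 2) * (exp (-\<theta>) * F) + 2 * F) / (?b + 2) \<le> r * F"
    by (simp add: pos_divide_le_eq)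
  then show ?thesis using A(2) unfolding r_def F_def by linarith
qed

text \<open>If the core is empty then \<open>L + c\<close> is the fringe size, which explains the additive error.\<close>

lemma expectation_adds_exp_le:
  assumes "a \<in> sized m" "m \<ge> 1" "real (card (fringe a)) \<le> T" "\<theta> \<ge> 0"
  defines "r \<equiv> (1 + exp (- 2 * \<theta>)) / 2"
  shows "expect (adds k a) (\<lambda>a'. exp (\<theta> * (real (L a') + real (card (core a')))))
    \<le> r ^ k * exp (\<theta> * (real (L a) + real (card (core a)))) + real k * exp (\<theta> * T)"
  using assms(1-3)
proof (induction k arbitrary: a m)
  case (Suc k)
  note a = sizedD(1)[OF Suc.prems(1)] sized_nonempty[OF Suc.prems(1,2)]
  let ?f = "\<lambda>a'. exp (\<theta> * (real (L a') + real (card (core a'))))"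
  have r: "r \<ge> 0" by (simp add: r_def add_nonneg_nonneg)
  show ?case
  proof (cases "core a = {}")
    case True
    have "expect (adds (Suc k) a) ?f \<le>
      expect (adds (Suc k) a) (\<lambda>_. exp (\<theta> * T))"
    proof (rule expectation_mono_finite[OF adds_support(1)[OF Suc.prems(1,2)]])
      fix a' assume "a' \<in> set_pmf (adds (Suc k) a)"
      from adds_support(2)[OF Suc.prems(1,2) this]
      have "real (L a') + real (card (core a')) \<le> T"
        using True Suc.prems(3) L_eq_fringe_core[of a] by auto
      then show "?f a' \<le> exp (\<theta> * T)" using assms(4) by (auto intro: mult_left_mono)
    qed
    also have "\<dots> = exp (\<theta> * T)" by simp
    also have "\<dots> \<le> real (Suc k) * exp (\<theta> * T)" by (simp add: distrib_right)
    also have "\<dots> \<le> r ^ Suc k * ?f a + real (Suc k) * exp (\<theta> * T)" using r by simp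
    finally show ?thesis .
  next
    case False
    have "expect (adds (Suc k) a) ?f =
      expect (add_site a) (\<lambda>b. expect (adds k b) ?f)"
      by (rule expectation_adds_Suc[OF Suc.prems(1,2)])
    also have "\<dots> \<le> expect (add_site a) (\<lambda>b. r ^ k * ?f b + real k * exp (\<theta> * T))"
    proof (rule expectation_mono_finite[OF set_add_site(2)[OF Suc.prems(1,2)]])
      fix b assume "b \<in> set_pmf (add_site a)"
      then have "b \<in> set_pmf (adds 1 a)" by simp
      from adds_support(2)[OF Suc.prems(1,2) this]
      show "expect (adds k b) ?f \<le> r ^ k * ?f b + real k * exp (\<theta> * T)"
        using Suc.prems(3) by (intro Suc.IH[of b "Suc m"]) auto
    qed
    also have "\<dots> = r ^ k * expect (add_site a) ?f + real k * exp (\<theta> * T)"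
      using set_add_site(2)[OF Suc.prems(1,2)]
      by (subst Bochner_Integration.integral_add) (auto intro!: integrable_measure_pmf_finite)
    also have "\<dots> \<le> r ^ k * (r * ?f a) + real k * exp (\<theta> * T)"
      using expectation_add_site_exp_le[OF Suc.prems(1,2) False assms(4)] r
      by (intro add_right_mono mult_left_mono) (auto simp: r_def)
    also have "\<dots> \<le> r ^ Suc k * ?f a + real (Suc k) * exp (\<theta> * T)" by (simp add: algebra_simps)
    finally show ?thesis .
  qed
qed (simp add: r_def)

text \<open>The term \<open>L + c = 2 * L - f\<close> is decisive for \<open>f \<le> T\<close>, where the compensation by the core is
  needed. For larger fringes most additions fall inside and \<open>L\<close> alone decreases; there the potential is
  \<open>2 * L - T\<close>, which does not see the core, because a fringe comparable with the number of
  occupied sites would make the growth of the core too likely.\<close>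

definition drift :: "real \<Rightarrow> nat \<Rightarrow> nat \<Rightarrow> real" where
  "drift T l s = max (real l + real s) (2 * real l - T)"

lemma drift_mono: "l \<le> l' \<Longrightarrow> s \<le> s' \<Longrightarrow> drift T l s \<le> drift T l' s'"
  unfolding drift_def by (intro max.mono) auto

lemma drift_shift:
  "drift T l (s + 3) \<le> drift T l s + 3"
  "drift T (l + i) s \<le> drift T l s + 2 * real i"
  "drift T l s \<le> drift T (Suc l) s - 1"
  "real l \<le> drift T l s"
  unfolding drift_def by (auto simp: max_def)

text \<open>The fringe stays below \<open>T\<close> during the whole step, so the potential is \<open>L + c\<close> throughout: \<open>K\<close> additions lower
  it by one each on average, \<open>K - 1\<close> deletions raise it by at most one each up to rare events.\<close>

lemma ac_step_drift_small_fringe: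
  assumes a: "a \<in> sized m" "m \<ge> 1" and K: "K \<ge> 1" and "\<theta> \<ge> 0"
    and T0: "real (card (fringe a)) \<le> T0" "T0 + real K \<le> T"
    and q: "q \<ge> 0" "2 * (T0 + real K) \<le> q * (real m + 1)"
  shows "expect (ac_step K a) (\<lambda>a'. exp (\<theta> * drift T (L a') (card (core a')))) \<le>
    (1 + q * exp (3 * \<theta>)) ^ (K - 1) * exp (\<theta> * real (K - 1)) *
      (((1 + exp (- 2 * \<theta>)) / 2) ^ K * exp (\<theta> * drift T (L a) (card (core a))) + real K * exp (\<theta> * T0))"
proof -
  define c where "c = (1 + q * exp (3 * \<theta>)) ^ (K - 1) * exp (\<theta> * real (K - 1))"
  have c: "c \<ge> 0" using q by (simp add: c_def)
  let ?F = "\<lambda>a. exp (\<theta> * (real (L a) + real (card (core a))))"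
  let ?V = "\<lambda>a. exp (\<theta> * drift T (L a) (card (core a)))"
  have "expect (ac_step K a) ?V = expect (adds K a)
      (\<lambda>b. expect (dels (K - 1) b) ?V)"
    by (rule expectation_ac_step[OF a])
  also have "\<dots> \<le> expect (adds K a) (\<lambda>b. c * ?F b)"
  proof (rule expectation_mono_finite[OF adds_support(1)[OF a]])
    fix b assume "b \<in> set_pmf (adds K a)"
    note b = adds_support(2)[OF a this]
    have bs: "b \<in> sized (m + K)" "K - 1 < m + K" using b a by auto
    have "expect (dels (K - 1) b) ?V =
        expect (dels (K - 1) b) ?F"
    proof (intro integral_cong_AE, simp, simp, subst AE_measure_pmf_iff, intro ballI)
      fix a' assume "a' \<in> set_pmf (dels (K - 1) b)"
      from dels_support(2)[OF bs this] have "card (fringe a') \<le> card (fringe a) + K" using b by linarith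
      then have "real (card (fringe a')) \<le> T" using T0 by linarith
      then have "2 * real (L a') - T \<le> real (L a') + real (card (core a'))"
        using L_eq_fringe_core[of a'] by simp
      then show "?V a' = ?F a'" by (simp add: drift_def)
    qed
    also have "\<dots> \<le> (1 + q * exp (3 * \<theta>)) ^ (K - 1) * exp (\<theta> * (real (L b + (K - 1)) + real (card (core b))))"
    proof (rule dels_expectation_le[OF bs, where \<Phi> = "\<lambda>l s. exp (\<theta> * (real l + real s))"])
      have "real (card (fringe b)) \<le> T0" "real (K - 1) \<le> real K" using b T0 by linarith+
      moreover have "real (m + K) - real (K - 1) = real m + 1" using K by (simp add: of_nat_diff)
      ultimately show "2 * (real (card (fringe b)) + real (K - 1)) \<le> q * (real (m + K) - real (K - 1))"
        using q by simp
      show "exp (\<theta> * (real l + real s)) \<le> exp (\<theta> * (real l' + real s'))" if "l \<le> l'" "s \<le> s'" for l l' s s'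
        using that assms(4) by (auto intro!: mult_left_mono)
    qed (use q in \<open>auto simp: mult_exp_exp algebra_simps\<close>)
    also have "\<dots> = c * ?F b" by (simp add: c_def mult_exp_exp algebra_simps)
    finally show "expect (dels (K - 1) b) ?V \<le> c * ?F b" .
  qed
  also have "\<dots> = c * expect (adds K a) ?F" by simp
  also have "\<dots> \<le> c * (((1 + exp (- 2 * \<theta>)) / 2) ^ K * ?F a + real K * exp (\<theta> * T0))"
    by (intro mult_left_mono expectation_adds_exp_le[OF a T0(1) assms(4)] c)
  also have "\<dots> \<le> c * (((1 + exp (- 2 * \<theta>)) / 2) ^ K * ?V a + real K * exp (\<theta> * T0))"
    using c assms(4) by (intro mult_left_mono add_right_mono)
      (auto intro!: zero_le_power mult_left_mono simp: drift_def add_nonneg_nonneg)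
  finally show ?thesis by (simp add: c_def)
qed

text \<open>Nearly all additions fall inside, so \<open>L\<close> decreases by one, and the potential by at least one. For fringes
  up to \<open>T + 4 * K\<close> the deletions rarely enlarge the core; beyond that even the largest possible
  growth of the core leaves the term \<open>2 * L - T\<close> dominant.\<close>

lemma ac_step_drift_large_fringe:
  assumes a: "a \<in> sized m" "m \<ge> 1" and K: "K \<ge> 1" and "\<theta> \<ge> 0"
    and b: "K \<le> card (fringe a)" "2 \<le> \<eta> * (real (card (fringe a)) + 3 - real K)" "\<eta> \<ge> 0"
    and q: "q \<ge> 0" "2 * (T + 5 * real K) \<le> q * (real m + 1)"
  shows "expect (ac_step K a) (\<lambda>a'. exp (\<theta> * drift T (L a') (card (core a')))) \<le>
    (1 + q * exp (3 * \<theta>)) ^ (K - 1) * (1 + \<eta> * exp (2 * \<theta>)) ^ K * exp (- \<theta>) *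
      exp (\<theta> * drift T (L a) (card (core a)))"
proof -
  define c where "c = (1 + q * exp (3 * \<theta>)) ^ (K - 1)"
  have c: "c \<ge> 1" using q by (simp add: c_def)
  let ?V = "\<lambda>a. exp (\<theta> * drift T (L a) (card (core a)))"
  let ?G = "\<lambda>l. c * exp (\<theta> * drift T (l + (K - 1)) (card (core a)))"
  have KL: "K \<le> L a" using b L_eq_fringe_core[of a] by simp
  have "expect (ac_step K a) ?V = expect (adds K a)
      (\<lambda>b. expect (dels (K - 1) b) ?V)"
    by (rule expectation_ac_step[OF a])
  also have "\<dots> \<le> expect (adds K a) (\<lambda>b. ?G (L b))"
  proof (rule expectation_mono_finite[OF adds_support(1)[OF a]])
    fix b assume "b \<in> set_pmf (adds K a)"
    note b = adds_support(2)[OF a this]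
    have bs: "b \<in> sized (m + K)" "K - 1 < m + K" using b a by auto
    show "expect (dels (K - 1) b) ?V \<le> ?G (L b)"
    proof (cases "real (card (fringe a)) \<le> T + 4 * real K")
      case True
      have "expect (dels (K - 1) b) ?V \<le>
        c * exp (\<theta> * drift T (L b + (K - 1)) (card (core b)))"
        unfolding c_def
      proof (rule dels_expectation_le[OF bs, where \<Phi> = "\<lambda>l s. exp (\<theta> * drift T l s)"])
        have "real (card (fringe b)) \<le> T + 4 * real K" "real (K - 1) \<le> real K" using b True by linarith+
        moreover have "real (m + K) - real (K - 1) = real m + 1" using K by (simp add: of_nat_diff)
        ultimately show "2 * (real (card (fringe b)) + real (K - 1)) \<le> q * (real (m + K) - real (K - 1))"
          using q by simp
        show "exp (\<theta> * drift T l s) \<le> exp (\<theta> * drift T l' s')"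
          if "l \<le> l'" "s \<le> s'" for l l' s s'
          using drift_mono[OF that, of T] assms(4) by (auto intro!: mult_left_mono)
        show "exp (\<theta> * drift T l (s + 3)) \<le> exp (3 * \<theta>) * exp (\<theta> * drift T l s)" for l s
          using mult_left_mono[OF drift_shift(1)[of T l s] assms(4)]
          by (simp add: mult_exp_exp algebra_simps)
      qed (use q in auto)
      also have "\<dots> \<le> ?G (L b)"
        using c b assms(4) drift_mono[of "L b + (K - 1)" "L b + (K - 1)" "card (core b)" "card (core a)" T]
        by (auto intro!: mult_left_mono)
      finally show ?thesis .
    next
      case False
      have "expect (dels (K - 1) b) ?V \<le>
        expect (dels (K - 1) b) (\<lambda>_. ?G (L b))"
      proof (rule expectation_mono_finite[OF dels_support(1)[OF bs]])
        fix a' assume "a' \<in> set_pmf (dels (K - 1) b)"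
        from dels_support(2)[OF bs this]
        have d: "card (core a') \<le> card (core a) + 3 * (K - 1)" "L a' \<le> L b + (K - 1)" using b by linarith+
        have "real (L a') + real (card (core a')) \<le> real (L b) + real (K - 1) + (real (card (core a)) + 3 * real (K - 1))"
          using d by linarith
        also have "\<dots> \<le> 2 * (real (L b) + real (K - 1)) - T"
          using False b L_eq_fringe_core[of a] K by (auto simp: of_nat_diff)
        finally have "drift T (L a') (card (core a')) \<le> drift T (L b + (K - 1)) (card (core a))"
          using d(2) unfolding drift_def by auto
        then have "?V a' \<le> exp (\<theta> * drift T (L b + (K - 1)) (card (core a)))"
          using assms(4) by (auto intro: mult_left_mono)
        also have "\<dots> = 1 * exp (\<theta> * drift T (L b + (K - 1)) (card (core a)))" by simp
        also have "\<dots> \<le> ?G (L b)" by (rule mult_right_mono[OF c]) simp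
        finally show "?V a' \<le> ?G (L b)" .
      qed
      then show ?thesis by simp
    qed
  qed
  also have "\<dots> \<le> (c * exp (-\<theta>) * ?V a) * (1 + \<eta> * exp (2 * \<theta>)) ^ K + 0"
  proof (rule adds_expectation_le[OF a b(1,3,2)])
    fix i assume i: "i \<le> K"
    have "L a - K + i + (K - 1) = (L a - 1) + i" using KL K i by simp
    moreover have "drift T (L a - 1 + i) (card (core a)) \<le> drift T (L a) (card (core a)) - 1 + 2 * real i"
      using drift_shift(2)[of T "L a - 1" i "card (core a)"] drift_shift(3)[of T "L a - 1" "card (core a)"] KL K
      by simp
    ultimately have "\<theta> * drift T (L a - K + i + (K - 1)) (card (core a)) \<le>
        \<theta> * (drift T (L a) (card (core a)) - 1 + 2 * real i)"
      using assms(4) by (simp only: mult_left_mono)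
    then have "exp (\<theta> * drift T (L a - K + i + (K - 1)) (card (core a))) \<le>
        exp (-\<theta>) * ?V a * exp (2 * \<theta>) ^ i"
      by (simp add: mult_exp_exp algebra_simps flip: exp_of_nat_mult)
    then have "?G (L a - K + i) \<le> c * (exp (-\<theta>) * ?V a * exp (2 * \<theta>) ^ i)"
      using c by (intro mult_left_mono) auto
    then show "?G (L a - K + i) \<le> c * exp (-\<theta>) * ?V a * exp (2 * \<theta>) ^ i + (if i = 0 then 0 else 0)"
      by (simp add: mult.assoc)
  qed (use c in auto)
  finally show ?thesis by (simp add: c_def mult.commute mult.left_commute)
qed

lemma cosh_le_exp_square:
  fixes \<theta> :: real
  assumes "0 \<le> \<theta>" "\<theta> \<le> 1"
  shows "(1 + exp (- 2 * \<theta>)) / 2 \<le> exp (- \<theta> + \<theta>\<^sup>2)"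
proof -
  have "exp \<theta> \<le> 1 + \<theta> + \<theta>\<^sup>2" by (rule exp_bound[OF assms])
  moreover have "exp (-\<theta>) \<le> 1 - \<theta> + \<theta>\<^sup>2"
  proof -
    have "1 \<le> (1 - \<theta> + \<theta>\<^sup>2) * (1 + \<theta>)" using assms(1) by (simp add: power2_eq_square algebra_simps)
    also have "\<dots> \<le> (1 - \<theta> + \<theta>\<^sup>2) * exp \<theta>"
      using assms by (intro mult_left_mono exp_ge_add_one_self) auto
    finally show ?thesis by (simp add: exp_minus field_simps)
  qed
  ultimately have "(exp \<theta> + exp (-\<theta>)) / 2 \<le> 1 + \<theta>\<^sup>2" by simp
  also have "\<dots> \<le> exp (\<theta>\<^sup>2)" by (rule exp_ge_add_one_self)
  finally have "exp (-\<theta>) * ((exp \<theta> + exp (-\<theta>)) / 2) \<le> exp (-\<theta>) * exp (\<theta>\<^sup>2)"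
    by (intro mult_left_mono) auto
  then show ?thesis by (simp add: mult_exp_exp algebra_simps)
qed

lemma power_one_plus_le_exp:
  fixes x :: real
  assumes "x \<ge> 0" "n \<le> k"
  shows "(1 + x) ^ n \<le> exp (real k * x)"
proof -
  have "(1 + x) ^ n \<le> (1 + x) ^ k" using assms by (intro power_increasing) auto
  also have "\<dots> \<le> exp x ^ k" using assms by (intro power_mono exp_ge_add_one_self) auto
  finally show ?thesis by (simp add: exp_of_nat_mult)
qed

text \<open>The exponent \<open>\<theta> = 1 / (2 * K)\<close> is small enough for the quadratic error \<open>K * \<theta>\<^sup>2\<close> of \<open>K\<close> additions
  to use up only half of the net drift \<open>\<theta>\<close>; the errors from outside additions and from core growth are
  each made at most \<open>\<theta> / 8\<close>.\<close>

lemma ac_step_drift: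
  assumes K: "K \<ge> 1"
  shows "\<exists>\<theta> T C \<rho> m0. \<theta> > 0 \<and> C \<ge> 0 \<and> 0 \<le> \<rho> \<and> \<rho> < 1 \<and> (\<forall>m \<ge> m0. \<forall>a \<in> sized m.
    expect (ac_step K a) (\<lambda>a'. exp (\<theta> * drift T (L a') (card (core a')))) \<le>
      \<rho> * exp (\<theta> * drift T (L a) (card (core a))) + C)"
proof -
  define \<theta> where "\<theta> = 1 / (2 * real K)"
  have th: "0 < \<theta>" "\<theta> \<le> 1" "real K * \<theta>\<^sup>2 = \<theta> / 2"
    using K by (auto simp: \<theta>_def field_simps power2_eq_square)
  define q where "q = \<theta> / (8 * real K * exp (3 * \<theta>))"
  define \<eta> where "\<eta> = \<theta> / (8 * real K * exp (2 * \<theta>))"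
  have q: "q > 0" "(1 + q * exp (3 * \<theta>)) ^ (K - 1) \<le> exp (\<theta> / 8)"
    using th K power_one_plus_le_exp[of "q * exp (3 * \<theta>)" "K - 1" K] by (auto simp: q_def)
  have eta: "\<eta> > 0" "(1 + \<eta> * exp (2 * \<theta>)) ^ K \<le> exp (\<theta> / 8)"
    using th K power_one_plus_le_exp[of "\<eta> * exp (2 * \<theta>)" K K] by (auto simp: \<eta>_def)
  \<comment> \<open>Beyond \<open>T0\<close>, an addition falls outside with probability at most \<open>\<eta>\<close> even after \<open>K - 1\<close> sites have been filled.\<close>
  define T0 where "T0 = real K + 2 / \<eta>"
  define T where "T = T0 + real K"
  define m0 where "m0 = nat \<lceil>2 * (T + 5 * real K) / q\<rceil> + 1"
  define C where "C = exp (\<theta> / 8) * exp (\<theta> * real (K - 1)) * (real K * exp (\<theta> * T0))"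
  let ?V = "\<lambda>a. exp (\<theta> * drift T (L a) (card (core a)))"
  have r: "((1 + exp (- 2 * \<theta>)) / 2) ^ K \<le> exp (real K * (- \<theta> + \<theta>\<^sup>2))"
    unfolding exp_of_nat_mult using cosh_le_exp_square[of \<theta>] th by (intro power_mono) (auto simp: add_nonneg_nonneg)
  have "expect (ac_step K a) ?V \<le> exp (-\<theta> / 4) * ?V a + C" if m: "m \<ge> m0" and a: "a \<in> sized m" for m a
  proof -
    have m1: "m \<ge> 1" using m by (simp add: m0_def)
    have T0': "T0 \<ge> 0" using eta by (simp add: T0_def)
    have "2 * (T + 5 * real K) / q \<le> real m" using m unfolding m0_def by linarith
    then have qm: "2 * (T + 5 * real K) \<le> q * (real m + 1)"
      using q(1) by (simp add: pos_divide_le_eq algebra_simps)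
    have C: "C \<ge> 0" by (simp add: C_def)
    show ?thesis
    proof (cases "real (card (fringe a)) \<le> T0")
      case True
      have "2 * (T0 + real K) \<le> q * (real m + 1)" using qm by (simp add: T_def)
      then have "expect (ac_step K a) ?V \<le>
        (1 + q * exp (3 * \<theta>)) ^ (K - 1) * exp (\<theta> * real (K - 1)) *
          (((1 + exp (- 2 * \<theta>)) / 2) ^ K * ?V a + real K * exp (\<theta> * T0))"
        using True th q(1) by (intro ac_step_drift_small_fringe[OF a m1 K]) (auto simp: T_def)
      also have "\<dots> \<le> exp (\<theta> / 8) * exp (\<theta> * real (K - 1)) *
          (exp (real K * (- \<theta> + \<theta>\<^sup>2)) * ?V a + real K * exp (\<theta> * T0))"
        using q r by (intro mult_mono add_mono mult_right_mono) (auto intro!: add_nonneg_nonneg mult_nonneg_nonneg zero_le_power)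
      also have "\<dots> = exp (\<theta> / 8 + \<theta> * real (K - 1) + real K * (- \<theta> + \<theta>\<^sup>2)) * ?V a + C"
        by (simp only: C_def exp_add distrib_left mult.assoc)
      also have "\<theta> / 8 + \<theta> * real (K - 1) + real K * (- \<theta> + \<theta>\<^sup>2) = - 3 * \<theta> / 8"
        using K th(3) by (simp add: of_nat_diff algebra_simps)
      also have "exp (- 3 * \<theta> / 8) * ?V a + C \<le> exp (-\<theta> / 4) * ?V a + C"
        using th by (intro add_right_mono mult_right_mono) auto
      finally show ?thesis .
    next
      case False
      have "\<eta> * (2 / \<eta>) \<le> \<eta> * (real (card (fringe a)) + 3 - real K)"
        using False eta by (intro mult_left_mono) (auto simp: T0_def)
      then have e2: "2 \<le> \<eta> * (real (card (fringe a)) + 3 - real K)" using eta by simp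
      have "real K \<le> T0" using eta by (simp add: T0_def)
      then have Kb: "K \<le> card (fringe a)" using False by linarith
      have "expect (ac_step K a) ?V \<le>
        (1 + q * exp (3 * \<theta>)) ^ (K - 1) * (1 + \<eta> * exp (2 * \<theta>)) ^ K * exp (- \<theta>) * ?V a"
        using th q(1) eta(1) by (intro ac_step_drift_large_fringe[OF a m1 K _ Kb e2 _ _ qm]) auto
      also have "\<dots> \<le> exp (\<theta> / 8) * exp (\<theta> / 8) * exp (- \<theta>) * ?V a"
        using q eta by (intro mult_mono mult_right_mono) auto
      also have "\<dots> = exp (- 3 * \<theta> / 4) * ?V a" by (simp add: mult_exp_exp)
      also have "\<dots> \<le> exp (-\<theta> / 4) * ?V a + C" using th C by (intro add_increasing2) auto
      finally show ?thesis .
    qed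
  qed
  moreover have "C \<ge> 0" "exp (-\<theta> / 4) < 1" using th by (auto simp: C_def)
  ultimately show ?thesis using th
    by (intro exI[of _ \<theta>] exI[of _ T] exI[of _ C] exI[of _ "exp (-\<theta> / 4)"] exI[of _ m0]) auto
qed

lemma affine_recursion_bounded:
  fixes x :: "nat \<Rightarrow> real"
  assumes "\<And>n. n \<ge> n0 \<Longrightarrow> x (Suc n) \<le> \<rho> * x n + C" "0 \<le> \<rho>" "\<rho> < 1"
  shows "\<exists>B. \<forall>n. x n \<le> B"
proof -
  define B where "B = max (Max (x ` {..n0})) (C / (1 - \<rho>))"
  have "C / (1 - \<rho>) \<le> B" by (simp add: B_def)
  then have "C \<le> B * (1 - \<rho>)" using assms(3) by (simp add: pos_divide_le_eq)
  then have C: "\<rho> * B + C \<le> B" by (simp add: algebra_simps)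
  have "x n \<le> B" for n
  proof (induction n)
    case 0
    have "x 0 \<le> Max (x ` {..n0})" by (intro Max_ge) auto
    then show ?case unfolding B_def by (rule max.coboundedI1)
  next
    case (Suc n)
    show ?case
    proof (cases "n \<ge> n0")
      case True
      have "x (Suc n) \<le> \<rho> * B + C"
        using assms(1)[OF True] mult_left_mono[OF Suc assms(2)] by linarith
      then show ?thesis using C by linarith
    next
      case False
      then have "x (Suc n) \<le> Max (x ` {..n0})" by (intro Max_ge) auto
      then show ?thesis unfolding B_def by (rule max.coboundedI1)
    qed
  qed
  then show ?thesis by blast
qed

definition ac_law :: "nat \<Rightarrow> nat \<Rightarrow> int set pmf" where
  "ac_law K n = kernel_power (ac_step K) n {0}"

lemma ac_law_0 [simp]: "ac_law K 0 = return_pmf {0}" by (simp add: ac_law_def)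

lemma ac_law_Suc: "ac_law K (Suc n) = bind_pmf (ac_law K n) (ac_step K)"
  by (simp add: ac_law_def kernel_power_Suc_right del: kernel_power.simps(2))

lemma ac_law_support:
  assumes "K \<ge> 1"
  shows "finite (set_pmf (ac_law K n))" "a \<in> set_pmf (ac_law K n) \<Longrightarrow> a \<in> sized (Suc n)"
proof -
  have "finite (set_pmf (ac_step K b)) \<and> (\<forall>c\<in>set_pmf (ac_step K b). c \<in> sized (Suc (Suc i)))" if "b \<in> sized (Suc i)" for i b
    using ac_step_support[OF that _ assms] by simp
  moreover have "{0} \<in> sized (Suc 0)" by (simp add: sized_def)
  ultimately show "finite (set_pmf (ac_law K n))" "a \<in> set_pmf (ac_law K n) \<Longrightarrow> a \<in> sized (Suc n)"
    unfolding ac_law_def using kernel_power_support[of n "\<lambda>i b. b \<in> sized (Suc i)" "ac_step K" "{0}"] by blast+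
qed

lemma expectation_ac_law_Suc:
  fixes f :: "int set \<Rightarrow> real"
  assumes "K \<ge> 1"
  shows "expect (ac_law K (Suc n)) f =
    expect (ac_law K n) (\<lambda>a. expect (ac_step K a) f)"
  unfolding ac_law_Suc
  using ac_law_support[OF assms] ac_step_support(1)[OF _ _ assms, of _ "Suc n"]
  by (intro expectation_bind_finite) auto

lemma exp_moment_bounded:
  assumes K: "K \<ge> 1"
  shows "\<exists>\<theta> B. \<theta> > 0 \<and> B > 0 \<and> (\<forall>n. expect (ac_law K n) (\<lambda>a. exp (\<theta> * real (L a))) \<le> B)"
proof -
  obtain \<theta> T C \<rho> m0 where th: "\<theta> > 0" "0 \<le> \<rho>" "\<rho> < 1" and
    d: "\<forall>m \<ge> m0. \<forall>a \<in> sized m. expect (ac_step K a) (\<lambda>a'. exp (\<theta> * drift T (L a') (card (core a')))) \<le>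
      \<rho> * exp (\<theta> * drift T (L a) (card (core a))) + C"
    using ac_step_drift[OF K] by blast
  let ?V = "\<lambda>a. exp (\<theta> * drift T (L a) (card (core a)))"
  let ?x = "\<lambda>n. expect (ac_law K n) ?V"
  note fin = ac_law_support(1)[OF K]
  have "?x (Suc n) \<le> \<rho> * ?x n + C" if "n \<ge> m0" for n
  proof -
    have "?x (Suc n) \<le> expect (ac_law K n) (\<lambda>a. \<rho> * ?V a + C)"
      unfolding expectation_ac_law_Suc[OF K]
      using that ac_law_support(2)[OF K] by (intro expectation_mono_finite[OF fin] d[rule_format, of "Suc n"]) auto
    also have "\<dots> = \<rho> * ?x n + C"
      by (subst Bochner_Integration.integral_add) (auto intro!: integrable_measure_pmf_finite fin)
    finally show ?thesis .
  qed
  then obtain B where B: "\<And>n. ?x n \<le> B"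
    using affine_recursion_bounded[of m0 ?x \<rho> C] th by auto
  have "expect (ac_law K n) (\<lambda>a. exp (\<theta> * real (L a))) \<le> B" for n
  proof -
    have "expect (ac_law K n) (\<lambda>a. exp (\<theta> * real (L a))) \<le> ?x n"
      using th drift_shift(4) by (intro expectation_mono_finite[OF fin]) auto
    then show ?thesis using B[of n] by linarith
  qed
  moreover have "exp (\<theta> * real (L {0})) \<le> B" using calculation[of 0] by simp
  then have "B > 0" by (smt (verit) exp_gt_zero)
  ultimately show ?thesis using th by blast
qed

section \<open>Core sites are rare\<close>

lemma expectation_add_finite:
  fixes f g :: "'a \<Rightarrow> real"
  assumes "finite (set_pmf p)"
  shows "expect p (\<lambda>x. f x + g x) = expect p f + expect p g"
  using assms by (intro Bochner_Integration.integral_add integrable_measure_pmf_finite)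

text \<open>The first addition already shrinks the core with probability at least \<open>2 / (f + 2)\<close>, and the other
  additions do not enlarge it.\<close>

lemma ac_step_core_potential:
  fixes g :: "nat \<Rightarrow> real"
  assumes a: "a \<in> sized m" "m \<ge> 1" and K: "K \<ge> 1" and "D \<ge> 1"
    and g: "mono g" "\<And>s. g s \<ge> 0" "\<And>s. D * g s \<le> g (Suc s)" "\<And>s. g (s + 3) \<le> Q * g s" and Q: "Q \<ge> 0"
    and q: "q \<ge> 0" "2 * (real (card (fringe a)) + real K) \<le> q * (real m + 1)"
  shows "expect (ac_step K a) (\<lambda>a'. g (card (core a'))) \<le>
    (1 + q * Q) ^ (K - 1) *
      (if core a = {} then g 0 else (1 - 2 * (1 - 1 / D) / (real (card (fringe a)) + 2)) * g (card (core a)))"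
    (is "_ \<le> ?c * ?r")
proof -
  let ?g = "\<lambda>a. g (card (core a))"
  obtain k where k: "K = Suc k" using K by (cases K) auto
  have mono: "\<And>s s'. s \<le> s' \<Longrightarrow> g s \<le> g s'" using g(1) by (auto simp: mono_def)
  have c: "?c \<ge> 0" using Q q by simp
  have "expect (ac_step K a) ?g = expect (adds K a)
    (\<lambda>b. expect (dels (K - 1) b) ?g)"
    by (rule expectation_ac_step[OF a])
  also have "\<dots> \<le> expect (adds K a) (\<lambda>b. ?c * ?g b)"
  proof (rule expectation_mono_finite[OF adds_support(1)[OF a]])
    fix b assume "b \<in> set_pmf (adds K a)"
    note b = adds_support(2)[OF a this]
    have bs: "b \<in> sized (m + K)" "K - 1 < m + K" using b a by auto
    have "real (card (fringe b)) \<le> real (card (fringe a))" "real (K - 1) \<le> real K" using b by auto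
    moreover have "real (m + K) - real (K - 1) = real m + 1" using K by (simp add: of_nat_diff)
    ultimately have "2 * (real (card (fringe b)) + real (K - 1)) \<le> q * (real (m + K) - real (K - 1))"
      using q by simp
    then show "expect (dels (K - 1) b) ?g \<le> ?c * ?g b"
      using dels_expectation_le[OF bs, where \<Phi> = "\<lambda>l s. g s" and q = q and Q = Q] g(2,4) mono Q q by auto
  qed
  also have "\<dots> = ?c * expect (adds K a) ?g" by simp
  also have "expect (adds K a) ?g =
     expect (add_site a) (\<lambda>b. expect (adds k b) ?g)"
    unfolding k by (rule expectation_adds_Suc[OF a])
  also have "\<dots> \<le> expect (add_site a) ?g"
  proof (rule expectation_mono_finite[OF set_add_site(2)[OF a]])
    fix b assume b: "b \<in> set_pmf (add_site a)"
    then have b: "b \<in> sized (Suc m)" using set_add_site[OF a] add_site_sized[OF a(1)] by auto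
    have "expect (adds k b) ?g \<le>
      expect (adds k b) (\<lambda>_. ?g b)"
      using adds_support[OF b] mono by (intro expectation_mono_finite) auto
    then show "expect (adds k b) ?g \<le> ?g b" by simp
  qed
  also have "\<dots> \<le> ?r"
  proof (cases "core a = {}")
    case True
    have "expect (add_site a) ?g \<le> expect (add_site a) (\<lambda>_. g 0)"
    proof (rule expectation_mono_finite[OF set_add_site(2)[OF a]])
      fix b assume "b \<in> set_pmf (add_site a)"
      then have "b \<in> set_pmf (adds 1 a)" by simp
      from adds_support(2)[OF a this] show "?g b \<le> g 0" using True by simp
    qed
    then show ?thesis using True by simp
  next
    case False
    note fa = sizedD(1)[OF a(1)] sized_nonempty[OF a]
    let ?b = "real (card (fringe a))"
    let ?G = "g (card (core a))"
    have le: "?G / D \<le> ?G" using g(2)[of "card (core a)"] assms(4) by (simp add: pos_divide_le_eq mult_le_cancel_left1)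
    have f1: "?g (insert y a) \<le> ?G / D" if "y \<in> fringe a" "y - 1 \<in> core a \<or> y + 1 \<in> core a" for y
      using g(3)[of "card (core (insert y a))"] card_core_insert_fringe(3)[OF fa that] assms(4)
      by (simp add: pos_le_divide_eq mult.commute)
    have f2: "?g (insert y a) \<le> ?G" if "y \<in> fringe a" for y
      by (rule mono) (rule card_core_insert_fringe(1)[OF fa that])
    have f3: "?g (insert y a) \<le> ?G" if "y = Min a - 1 \<or> y = Max a + 1" for y
      using insert_outer[OF fa that] by simp
    have "expect (add_site a) ?g \<le> (2 * (?G / D) + (?b - 2) * ?G + 2 * ?G) / (?b + 2)"
      by (rule expectation_add_site_core_le(2)[OF a False le, of ?g ?G, OF f1 f2 f3])
    also have "\<dots> = (1 - 2 * (1 - 1 / D) / (?b + 2)) * ?G"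
    proof -
      have "2 * (?G / D) + (?b - 2) * ?G + 2 * ?G = ((?b + 2) - 2 * (1 - 1 / D)) * ?G"
        by (simp add: algebra_simps)
      moreover have "((?b + 2) - 2 * (1 - 1 / D)) / (?b + 2) = 1 - 2 * (1 - 1 / D) / (?b + 2)"
        by (subst diff_divide_distrib) simp
      ultimately show ?thesis by (metis times_divide_eq_left)
    qed
    finally show ?thesis using False by simp
  qed
  finally show ?thesis using c by (simp add: mult_left_mono)
qed

text \<open>The contraction acts during the second half of the time only, where bounds that improve with
  the time index hold uniformly.\<close>

lemma affine_recursion_decay:
  fixes x :: "nat \<Rightarrow> real"
  assumes "\<And>k. N - N div 2 \<le> k \<Longrightarrow> k < N \<Longrightarrow> x (Suc k) \<le> (1 - p) * x k + e"
    and p: "0 < p" "p \<le> 1" and "0 \<le> e" "\<And>k. x k \<le> Y" "0 \<le> Y"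
  shows "x N \<le> exp (- (p * (real N / 2 - 1))) * Y + e / p"
proof -
  define k0 where "k0 = N - N div 2"
  have "k0 + j \<le> N \<Longrightarrow> x (k0 + j) \<le> (1 - p) ^ j * Y + e / p" for j
  proof (induction j)
    case 0
    then show ?case using assms(4) assms(5)[of k0] p by (simp add: add_increasing2)
  next
    case (Suc j)
    have "x (k0 + Suc j) \<le> (1 - p) * x (k0 + j) + e" using assms(1)[of "k0 + j"] Suc by (simp add: k0_def)
    also have "\<dots> \<le> (1 - p) * ((1 - p) ^ j * Y + e / p) + e"
      using Suc p by (intro add_right_mono mult_left_mono) auto
    also have "\<dots> = (1 - p) ^ Suc j * Y + e / p" using p by (simp add: field_simps)
    finally show ?case .
  qed
  from this[of "N div 2"] have "x N \<le> (1 - p) ^ (N div 2) * Y + e / p" by (simp add: k0_def)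
  also have "(1 - p) ^ (N div 2) \<le> exp (- p) ^ (N div 2)"
    using p exp_ge_add_one_self[of "- p"] by (intro power_mono) auto
  also have "\<dots> = exp (real (N div 2) * (- p))" by (simp only: exp_of_nat_mult)
  also have "\<dots> \<le> exp (- (p * (real N / 2 - 1)))"
  proof -
    have "real N / 2 - 1 \<le> real (N div 2)" by linarith
    then have "p * (real N / 2 - 1) \<le> p * real (N div 2)" using p by (intro mult_left_mono) auto
    then show ?thesis by (simp add: mult.commute)
  qed
  finally show ?thesis using assms(6) by (simp add: mult_right_mono)
qed

text \<open>The potential charges \<open>X = N powr (1 / 12)\<close> for each of the first \<open>48\<close> core sites, hence \<open>N ^ 4\<close> in
  total, and only a constant factor for further ones, so that it is controlled by exponential moments. If
  the fringe is at most \<open>N powr (1 / 4)\<close>, a deletion enlarges the core with probability of order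
  \<open>N powr (- 3 / 4)\<close> and then costs a factor \<open>X ^ 3 = N powr (1 / 4)\<close>. This error of order
  \<open>N powr (- 1 / 2)\<close> is negligible against the contraction by \<open>p\<close>, of order \<open>N powr (- 1 / 4)\<close>, that the additions
  provide. Larger fringes have stretched-exponentially small probability.\<close>

lemma core_tail:
  assumes K: "K \<ge> 1"
  shows "\<forall>\<^sub>F N in sequentially. prob_of (ac_law K N) {a. 48 \<le> card (core a)} \<le> 4 / real N ^ 4"
proof -
  obtain \<theta> B where th: "\<theta> > 0" and B: "B > 0" and
    B0: "\<And>n. expect (ac_law K n) (\<lambda>a. exp (\<theta> * real (L a))) \<le> B"
    using exp_moment_bounded[OF K] by blast
  define D where "D = exp (\<theta> / 2)"
  have D: "D > 1" using th by (simp add: D_def)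
  define c where "c = 1 - 1 / D"
  have c: "c > 0" "c \<le> 1" using D by (auto simp: c_def)
  have fin: "finite (set_pmf (ac_law K n))" for n by (rule ac_law_support(1)[OF K])
  define X where "X = (\<lambda>N. real N powr (1 / 12))"
  define p where "p = (\<lambda>N. c / (2 * real N powr (1 / 4)))"
  define q where "q = (\<lambda>N. 4 * (real N powr (1 / 4) + real K) / real N)"
  define \<epsilon> where "\<epsilon> = (\<lambda>N. real N powr (real K / 4 + 4) * exp (- (\<theta> / 2) * real N powr (1 / 4)))"
  have "\<forall>\<^sub>F N in sequentially. D \<le> X N" unfolding X_def by real_asymp
  moreover have "\<forall>\<^sub>F N in sequentially. 2 \<le> real N powr (1 / 4)" by real_asymp
  moreover have "\<forall>\<^sub>F N in sequentially. exp (real K * (q N * real N powr (1 / 4))) - 1 \<le> p N"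
    unfolding q_def p_def using c by real_asymp
  moreover have "\<forall>\<^sub>F N in sequentially. \<epsilon> N * B \<le> p N"
    unfolding \<epsilon>_def p_def using c th B by real_asymp
  moreover have "\<forall>\<^sub>F N in sequentially. exp (- (p N * (real N / 2 - 1))) * (real N ^ 4 * B) \<le> 1"
    unfolding p_def using c B by real_asymp
  moreover have "\<forall>\<^sub>F N in sequentially. N > (0::nat)" by (rule eventually_gt_at_top)
  ultimately show ?thesis
  proof eventually_elim
    case (elim N)
    note e1 = elim(1) and e2 = elim(2) and e3 = elim(3) and e4 = elim(4) and e5 = elim(5) and N = elim(6)
    let ?X = "X N" and ?n4 = "real N powr (1 / 4)"
    have X1: "?X \<ge> 1" using e1 D by simp
    have X3: "?X ^ 3 = ?n4" "?X ^ 48 = real N ^ 4"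
      using N by (auto simp: X_def powr_power)
    have XK: "?X ^ (3 * K) = real N powr (real K / 4)"
      using N by (auto simp: X_def powr_power)
    define g where "g = (\<lambda>s. ?X ^ min s 48 * D ^ (s - 48))"
    have g0: "g 0 = 1" by (simp add: g_def)
    have gS: "g (Suc s) = (if s < 48 then ?X else D) * g s" for s
    proof (cases "s < 48")
      case True
      then have "min (Suc s) 48 = Suc s" "min s 48 = s" "Suc s - 48 = 0" "s - 48 = 0" by arith+
      then show ?thesis using True by (simp only: g_def) simp
    next
      case False
      then have "min (Suc s) 48 = 48" "min s 48 = 48" "Suc s - 48 = Suc (s - 48)" by arith+
      then show ?thesis using False by (simp only: g_def) simp
    qed
    have gpos: "g s > 0" for s using X1 D by (simp add: g_def)
    have gup: "g (Suc s) \<le> ?X * g s" for s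
      unfolding gS using e1 gpos[of s] by (intro mult_right_mono) auto
    have glo: "D * g s \<le> g (Suc s)" for s
      unfolding gS using e1 gpos[of s] by (intro mult_right_mono) auto
    have gmono: "mono g"
    proof (rule incseq_SucI)
      fix s
      have "1 * g s \<le> D * g s" using D gpos[of s] by (intro mult_right_mono) auto
      then show "g s \<le> g (Suc s)" using glo[of s] by linarith
    qed
    have gadd: "g (s + i) \<le> ?X ^ i * g s" for s i
    proof (induction i)
      case (Suc i)
      have "g (s + Suc i) \<le> ?X * g (s + i)" using gup[of "s + i"] by simp
      also have "\<dots> \<le> ?X * (?X ^ i * g s)" using Suc X1 by (intro mult_left_mono) auto
      finally show ?case by (simp add: mult.assoc)
    qed simp
    have gub: "g s \<le> real N ^ 4 * D ^ s" for s
    proof -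
      have "?X ^ min s 48 \<le> ?X ^ 48" using X1 by (intro power_increasing) auto
      moreover have "D ^ (s - 48) \<le> D ^ s" using D by (intro power_increasing) auto
      ultimately show ?thesis unfolding g_def X3(2)[symmetric] using X1 D by (intro mult_mono) auto
    qed
    have DL: "D ^ card (core a) \<le> exp (\<theta> / 2 * real (L a))" for a
    proof -
      have "D ^ card (core a) \<le> D ^ L a" using D L_eq_fringe_core[of a] by (intro power_increasing) auto
      also have "\<dots> = exp (\<theta> / 2 * real (L a))" by (simp add: D_def mult.commute flip: exp_of_nat_mult)
      finally show ?thesis .
    qed
    have n4: "?n4 > 0" using e2 by linarith
    then have "0 < c / (2 * ?n4)" using c by (intro divide_pos_pos) auto
    moreover have "c / (2 * ?n4) \<le> 1" using c e2 n4 by (subst pos_divide_le_eq) linarith+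
    ultimately have p: "p N > 0" "p N \<le> 1" by (simp_all only: p_def)
    have q: "q N \<ge> 0" by (simp add: q_def)
    let ?x = "\<lambda>k. expect (ac_law K k) (\<lambda>a. g (card (core a)))"
    have sigma: "(1 + q N * ?X ^ 3) ^ (K - 1) \<le> 1 + p N"
      using power_one_plus_le_exp[of "q N * ?X ^ 3" "K - 1" K] e3 q X1 unfolding X3 by simp
    have step: "expect (ac_step K a) (\<lambda>a'. g (card (core a'))) \<le>
        (1 - p N) * g (card (core a)) + 2 * p N + \<epsilon> N * exp (\<theta> * real (L a))"
      if k: "N - N div 2 \<le> k" "k < N" and a: "a \<in> sized (Suc k)" for k a
    proof -
      have a1: "Suc k \<ge> 1" by simp
      let ?g = "g (card (core a))"
      have eps: "\<epsilon> N * exp (\<theta> * real (L a)) \<ge> 0" by (simp add: \<epsilon>_def)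
      have g1: "?g \<ge> 1" using gmono g0 by (metis monoD le0)
      show ?thesis
      proof (cases "real (card (fringe a)) \<le> ?n4")
        case True
        have "real N / 2 \<le> real k" using k by linarith
        then have "q N * (real N / 2) \<le> q N * (real (Suc k) + 1)" using q by (intro mult_left_mono) auto
        moreover have "q N * (real N / 2) = 2 * (?n4 + real K)" using N by (simp add: q_def)
        ultimately have q2: "2 * (real (card (fringe a)) + real K) \<le> q N * (real (Suc k) + 1)" using True by simp
        have "expect (ac_step K a) (\<lambda>a'. g (card (core a'))) \<le> (1 + q N * ?X ^ 3) ^ (K - 1) *
          (if core a = {} then g 0 else (1 - 2 * (1 - 1 / D) / (real (card (fringe a)) + 2)) * ?g)"
          using D gmono gpos glo gadd q q2 X1 by (intro ac_step_core_potential[OF a a1 K]) (auto intro: less_imp_le)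
        also have "\<dots> \<le> (1 + p N) * (if core a = {} then g 0 else (1 - 2 * p N) * ?g)"
        proof (intro mult_mono sigma)
          have "2 * p N = 2 * c / (2 * ?n4)" by (simp add: p_def)
          also have "\<dots> \<le> 2 * c / (real (card (fringe a)) + 2)"
            using True e2 c n4 by (intro divide_left_mono mult_pos_pos) auto
          finally have "1 - 2 * (1 - 1 / D) / (real (card (fringe a)) + 2) \<le> 1 - 2 * p N" by (simp add: c_def)
          then show "(if core a = {} then g 0 else (1 - 2 * (1 - 1 / D) / (real (card (fringe a)) + 2)) * ?g)
            \<le> (if core a = {} then g 0 else (1 - 2 * p N) * ?g)"
            using gpos by (auto intro!: mult_right_mono less_imp_le)
          have "2 * (1 - 1 / D) / (real (card (fringe a)) + 2) \<le> 2 * 1 / 2"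
            using c D by (intro frac_le) (auto simp: c_def)
          then have "0 \<le> (1 - 2 * (1 - 1 / D) / (real (card (fringe a)) + 2)) * ?g"
            using gpos[of "card (core a)"] by (intro mult_nonneg_nonneg) auto
          then show "0 \<le> (if core a = {} then g 0 else (1 - 2 * (1 - 1 / D) / (real (card (fringe a)) + 2)) * ?g)"
            using gpos by (auto intro: less_imp_le)
        qed (use p in auto)
        also have "\<dots> \<le> (1 - p N) * ?g + 2 * p N"
        proof (cases "core a = {}")
          case False
          have "(1 + p N) * (1 - 2 * p N) \<le> 1 - p N" using p by (simp add: algebra_simps)
          then have "(1 + p N) * (1 - 2 * p N) * ?g \<le> (1 - p N) * ?g" using gpos[of "card (core a)"] by (intro mult_right_mono) auto
          then show ?thesis using False p by (simp add: mult.assoc)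
        qed (simp add: g0)
        finally show ?thesis using eps by linarith
      next
        case False
        have "expect (ac_step K a) (\<lambda>a'. g (card (core a'))) \<le>
          expect (ac_step K a) (\<lambda>_. g (card (core a) + 3 * K))"
          using ac_step_support[OF a a1 K] gmono by (intro expectation_mono_finite) (auto dest: monoD)
        also have "\<dots> = g (card (core a) + 3 * K)" by simp
        also have "\<dots> \<le> ?X ^ (3 * K) * ?g" by (rule gadd)
        also have "\<dots> \<le> ?X ^ (3 * K) * (real N ^ 4 * D ^ card (core a))" using X1 gub by (intro mult_left_mono) auto
        also have "\<dots> \<le> ?X ^ (3 * K) * (real N ^ 4 * exp (\<theta> / 2 * real (L a)))"
          using X1 DL by (intro mult_left_mono) auto
        also have "\<dots> = real N powr (real K / 4 + 4) * exp (\<theta> / 2 * real (L a))"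
          by (simp add: XK powr_add)
        also have "exp (\<theta> / 2 * real (L a)) \<le> exp (- (\<theta> / 2) * ?n4) * exp (\<theta> * real (L a))"
        proof -
          have "?n4 \<le> real (L a)" using False L_eq_fringe_core[of a] by linarith
          then have "\<theta> / 2 * ?n4 \<le> \<theta> / 2 * real (L a)" using th by (intro mult_left_mono) auto
          then show ?thesis by (simp add: mult_exp_exp)
        qed
        finally have "expect (ac_step K a) (\<lambda>a'. g (card (core a'))) \<le> \<epsilon> N * exp (\<theta> * real (L a))"
          by (simp add: \<epsilon>_def mult_left_mono mult.assoc)
        then show ?thesis using p g1 by (smt (verit) mult_nonneg_nonneg)
      qed
    qed
    have rec: "?x (Suc k) \<le> (1 - p N) * ?x k + 3 * p N" if k: "N - N div 2 \<le> k" "k < N" for k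
    proof -
      have "?x (Suc k) \<le> expect (ac_law K k)
        (\<lambda>a. ((1 - p N) * g (card (core a)) + 2 * p N) + \<epsilon> N * exp (\<theta> * real (L a)))"
        unfolding expectation_ac_law_Suc[OF K]
        using step[OF k] ac_law_support(2)[OF K] by (intro expectation_mono_finite[OF fin]) auto
      also have "\<dots> = (1 - p N) * ?x k + 2 * p N +
          \<epsilon> N * expect (ac_law K k) (\<lambda>a. exp (\<theta> * real (L a)))"
        by (simp add: expectation_add_finite[OF fin])
      also have "\<dots> \<le> (1 - p N) * ?x k + 2 * p N + \<epsilon> N * B"
        using B0 by (intro add_left_mono mult_left_mono) (auto simp: \<epsilon>_def)
      finally show ?thesis using e4 by linarith
    qed
    have x0: "?x k \<le> real N ^ 4 * B" for k
    proof -
      have "?x k \<le> expect (ac_law K k) (\<lambda>a. real N ^ 4 * exp (\<theta> * real (L a)))"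
      proof (rule expectation_mono_finite[OF fin])
        fix a
        have "exp (\<theta> / 2 * real (L a)) \<le> exp (\<theta> * real (L a))" using th by simp
        then have "D ^ card (core a) \<le> exp (\<theta> * real (L a))" using DL[of a] by linarith
        then have "real N ^ 4 * D ^ card (core a) \<le> real N ^ 4 * exp (\<theta> * real (L a))" by (intro mult_left_mono) auto
        then show "g (card (core a)) \<le> real N ^ 4 * exp (\<theta> * real (L a))" using gub[of "card (core a)"] by linarith
      qed
      also have "\<dots> \<le> real N ^ 4 * B" using B0 by (auto intro!: mult_left_mono)
      finally show ?thesis .
    qed
    have "?x N \<le> exp (- (p N * (real N / 2 - 1))) * (real N ^ 4 * B) + 3 * p N / p N"
      using p rec x0 B by (intro affine_recursion_decay) auto
    also have "\<dots> \<le> 4" using e5 p by simp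
    finally have x4: "?x N \<le> 4" .
    have "real N ^ 4 * prob_of (ac_law K N) {a. 48 \<le> card (core a)} =
      expect (ac_law K N) (\<lambda>a. real N ^ 4 * (if a \<in> {a. 48 \<le> card (core a)} then 1 else 0))"
      unfolding prob_eq_expectation by simp
    also have "\<dots> \<le> ?x N"
    proof (rule expectation_mono_finite[OF fin])
      fix a
      have "real N ^ 4 \<le> g (card (core a))" if "48 \<le> card (core a)"
      proof -
        have "g 48 \<le> g (card (core a))" using gmono that by (rule monoD)
        then show ?thesis by (simp add: g_def X3)
      qed
      then show "real N ^ 4 * (if a \<in> {a. 48 \<le> card (core a)} then 1 else 0) \<le> g (card (core a))"
        using gpos[of "card (core a)"] by auto
    qed
    finally have "real N ^ 4 * prob_of (ac_law K N) {a. 48 \<le> card (core a)} \<le> 4" using x4 by linarith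
    then show ?case using N by (simp add: pos_le_divide_eq mult.commute)
  qed
qed

section \<open>A potential growing like a power of the factorial\<close>

text \<open>Above level \<open>n\<close> the factors are constant, which keeps the potential below a multiple of \<open>D ^ l\<close>;
  exponential moments then control it on the exceptional event that the core is large.\<close>

definition growth :: "real \<Rightarrow> real \<Rightarrow> nat \<Rightarrow> nat \<Rightarrow> real" where
  "growth D \<kappa> n l = (\<Prod>j\<in>{1..l}. if j \<le> n then max D (real j powr \<kappa>) else D)"

context
  fixes D \<kappa> :: real and n :: nat
  assumes D: "D > 1" and kappa: "\<kappa> > 0"
begin

lemma growth_0 [simp]: "growth D \<kappa> n 0 = 1"
  by (simp add: growth_def)

lemma growth_Suc:
  "growth D \<kappa> n (Suc l) = growth D \<kappa> n l * (if Suc l \<le> n then max D (real (Suc l) powr \<kappa>) else D)"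
  by (simp add: growth_def mult.commute)

lemma growth_pos: "growth D \<kappa> n l > 0"
  unfolding growth_def using D by (intro prod_pos) (auto simp: less_max_iff_disj)

lemma growth_Suc_ge: "D * growth D \<kappa> n l \<le> growth D \<kappa> n (Suc l)"
  unfolding growth_Suc using growth_pos[of l] by (simp add: mult.commute)

lemma growth_mono: "l \<le> l' \<Longrightarrow> growth D \<kappa> n l \<le> growth D \<kappa> n l'"
proof (rule lift_Suc_mono_le[of "growth D \<kappa> n"])
  fix l
  have "1 * growth D \<kappa> n l \<le> D * growth D \<kappa> n l"
    using D growth_pos[of l] by (intro mult_right_mono) auto
  then show "growth D \<kappa> n l \<le> growth D \<kappa> n (Suc l)" using growth_Suc_ge[of l] by linarith
qed

lemma growth_add_le:
  assumes "D \<le> W" "real (l + i) powr \<kappa> \<le> W"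
  shows "growth D \<kappa> n (l + i) \<le> W ^ i * growth D \<kappa> n l"
  using assms(2)
proof (induction i)
  case (Suc i)
  have "real (l + i) powr \<kappa> \<le> real (l + Suc i) powr \<kappa>" using kappa by (intro powr_mono2) auto
  then have IH: "growth D \<kappa> n (l + i) \<le> W ^ i * growth D \<kappa> n l" using Suc by linarith
  have "growth D \<kappa> n (l + Suc i) \<le> growth D \<kappa> n (l + i) * W"
    using growth_Suc[of "l + i"] growth_pos[of "l + i"] assms(1) Suc.prems
    by (auto intro!: mult_left_mono)
  also have "\<dots> \<le> (W ^ i * growth D \<kappa> n l) * W" using IH assms D by (intro mult_right_mono) auto
  finally show ?case by (simp add: mult_ac)
qed simp

lemma growth_le: "growth D \<kappa> n l \<le> growth D \<kappa> n n * D ^ l"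
proof (induction l)
  case 0
  then show ?case using growth_mono[of 0 n] by simp
next
  case (Suc l)
  show ?case
  proof (cases "Suc l \<le> n")
    case True
    have "growth D \<kappa> n (Suc l) * 1 \<le> growth D \<kappa> n n * D ^ Suc l"
      using D True growth_pos[of n] by (intro mult_mono growth_mono one_le_power) auto
    then show ?thesis by simp
  next
    case False
    then have "growth D \<kappa> n (Suc l) = growth D \<kappa> n l * D" by (simp add: growth_Suc)
    also have "\<dots> \<le> (growth D \<kappa> n n * D ^ l) * D" using Suc D by (intro mult_right_mono) auto
    finally show ?thesis by (simp add: mult_ac)
  qed
qed

lemma growth_le_independent:
  "growth D \<kappa> n l \<le> (\<Prod>j\<in>{1..l}. max D (real j powr \<kappa>))"
  unfolding growth_def using D by (intro prod_mono) auto

lemma growth_cap_ge: "fact n powr \<kappa> \<le> growth D \<kappa> n n"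
proof -
  have "fact k powr \<kappa> \<le> (\<Prod>j\<in>{1..k}. max D (real j powr \<kappa>))" for k
  proof (induction k)
    case (Suc k)
    have "fact (Suc k) powr \<kappa> = fact k powr \<kappa> * real (Suc k) powr \<kappa>"
      by (simp add: powr_mult mult.commute del: of_nat_Suc)
    also have "\<dots> \<le> (\<Prod>j\<in>{1..k}. max D (real j powr \<kappa>)) * max D (real (Suc k) powr \<kappa>)"
      using D by (intro mult_mono Suc prod_nonneg) auto
    finally show ?case by (simp add: mult.commute)
  qed simp
  also have "(\<Prod>j\<in>{1..n}. max D (real j powr \<kappa>)) = growth D \<kappa> n n"
    unfolding growth_def by (intro prod.cong) auto
  finally show ?thesis .
qed

lemma growth_cap_le: "growth D \<kappa> n n \<le> (D * real n powr \<kappa>) ^ n"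
proof -
  have "growth D \<kappa> n n \<le> (\<Prod>j\<in>{1..n}. D * real n powr \<kappa>)"
    unfolding growth_def
  proof (rule prod_mono, intro conjI)
    fix j assume j: "j \<in> {1..n}"
    show "0 \<le> (if j \<le> n then max D (real j powr \<kappa>) else D)" using D by auto
    define w where "w = real n powr \<kappa>"
    have "real j powr \<kappa> \<le> w" unfolding w_def using kappa j by (intro powr_mono2) auto
    moreover have w: "1 \<le> w" unfolding w_def using kappa j by (intro ge_one_powr_ge_zero) auto
    moreover have "1 * w \<le> D * w" using D w by (intro mult_right_mono) auto
    moreover have "D * 1 \<le> D * w" using D w by (intro mult_left_mono) auto
    ultimately have "D \<le> D * w" "real j powr \<kappa> \<le> D * w" by linarith+
    then have "(if j \<le> n then max D (real j powr \<kappa>) else D) \<le> D * w" by simp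
    then show "(if j \<le> n then max D (real j powr \<kappa>) else D) \<le> D * real n powr \<kappa>" by (simp only: w_def)
  qed
  then show ?thesis by simp
qed

text \<open>A step multiplies the potential by \<open>1 / D\<close> if all additions fall inside. If \<open>i \<ge> 1\<close> additions fall
  outside, then \<open>L\<close> grows by \<open>i - 1\<close>, at the price of a factor of at most \<open>W ^ (i - 1)\<close> with \<open>W = (L + K) powr \<kappa>\<close>.\<close>

lemma ac_step_growth:
  assumes a: "a \<in> sized m" "m \<ge> 1" and K: "K \<ge> 1"
    and S: "card (core a) \<le> s" and l: "L a \<ge> 1" "L a \<ge> s + K"
    and W: "D \<le> (real (L a + K)) powr \<kappa>"
  shows "expect (ac_step K a) (\<lambda>a'. growth D \<kappa> n (L a')) \<le>
    (1 / D + (1 + 2 / (real (L a) + 3 - real s - real K) * (real (L a + K) powr \<kappa>)) ^ K / (real (L a + K) powr \<kappa>))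
      * growth D \<kappa> n (L a)"
proof -
  let ?F = "growth D \<kappa> n"
  let ?W = "real (L a + K) powr \<kappa>"
  let ?\<eta> = "2 / (real (L a) + 3 - real s - real K)"
  have W0: "?W > 0" using W D by linarith
  have "expect (ac_step K a) (\<lambda>a'. ?F (L a')) = expect (adds K a)
      (\<lambda>b. expect (dels (K - 1) b) (\<lambda>a'. ?F (L a')))"
    by (rule expectation_ac_step[OF a])
  also have "\<dots> \<le> expect (adds K a) (\<lambda>b. ?F (L b + (K - 1)))"
  proof (rule expectation_mono_finite[OF adds_support(1)[OF a]])
    fix b assume "b \<in> set_pmf (adds K a)"
    note b = adds_support(2)[OF a this]
    have bs: "b \<in> sized (m + K)" "K - 1 < m + K" using b a by auto
    have "expect (dels (K - 1) b) (\<lambda>a'. ?F (L a')) \<le>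
      expect (dels (K - 1) b) (\<lambda>_. ?F (L b + (K - 1)))"
      using dels_support[OF bs] by (intro expectation_mono_finite growth_mono) auto
    then show "expect (dels (K - 1) b) (\<lambda>a'. ?F (L a')) \<le> ?F (L b + (K - 1))" by simp
  qed
  also have "\<dots> \<le> (?F (L a) / ?W) * (1 + ?\<eta> * ?W) ^ K + ?F (L a) / D"
  proof (rule adds_expectation_le[OF a])
    have fr: "L a \<le> card (fringe a) + s" using L_eq_fringe_core[of a] S by simp
    then show "K \<le> card (fringe a)" using l by simp
    have d: "real (L a) + 3 - real s - real K > 0" using l by linarith
    then show eta: "0 \<le> ?\<eta>" by simp
    have cancel: "2 / x * x = 2" if "x > 0" for x :: real using that by simp
    have "2 = ?\<eta> * (real (L a) + 3 - real s - real K)" by (rule cancel[OF d, symmetric])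
    also have "\<dots> \<le> ?\<eta> * (real (card (fringe a)) + 3 - real K)" using eta fr by (intro mult_left_mono) auto
    finally show "2 \<le> ?\<eta> * (real (card (fringe a)) + 3 - real K)" .
    show "0 \<le> ?F (L a) / ?W" "0 \<le> ?F (L a) / D" "0 \<le> ?W" using growth_pos[of "L a"] W0 D by auto
    fix i assume i: "i \<le> K"
    have e: "L a - K + i + (K - 1) = L a - 1 + i" using l K by simp
    show "?F (L a - K + i + (K - 1)) \<le> ?F (L a) / ?W * ?W ^ i + (if i = 0 then ?F (L a) / D else 0)"
    proof (cases i)
      case 0
      have "D * ?F (L a - 1) \<le> ?F (L a)" using growth_Suc_ge[of "L a - 1"] l by simp
      then have "?F (L a - 1) \<le> ?F (L a) / D" using D by (simp add: pos_le_divide_eq mult.commute)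
      moreover have "0 \<le> ?F (L a) / ?W" using growth_pos[of "L a"] W0 by simp
      ultimately show ?thesis unfolding e using 0 by simp
    next
      case (Suc i')
      have "real (L a + i') powr \<kappa> \<le> ?W" using kappa i Suc by (intro powr_mono2) auto
      then have "?F (L a + i') \<le> ?W ^ i' * ?F (L a)" by (intro growth_add_le W)
      also have "\<dots> = ?F (L a) / ?W * ?W ^ i" using W0 Suc by simp
      finally show ?thesis unfolding e using Suc l by simp
    qed
  qed
  also have "\<dots> = (1 / D + (1 + ?\<eta> * ?W) ^ K / ?W) * ?F (L a)" by (simp add: algebra_simps)
  finally show ?thesis .
qed

end

text \<open>Up to constants the factor is \<open>1 / W + \<eta> ^ K * W ^ (K - 1)\<close> with \<open>\<eta>\<close> of order \<open>1 / l\<close> and \<open>W\<close> of order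
  \<open>l powr \<kappa>\<close>. The second term is where \<open>\<kappa> < K / (K - 1)\<close> enters.\<close>

lemma outside_factor_tendsto_0:
  fixes \<kappa> :: real
  assumes "\<kappa> > 0" "\<kappa> * (real K - 1) < real K" "K \<ge> 1"
  shows "((\<lambda>l. (1 + 2 / (real l + 3 - real s - real K) * (real (l + K) powr \<kappa>)) ^ K / (real (l + K) powr \<kappa>)) \<longlongrightarrow> 0) sequentially"
proof -
  have bound: "\<forall>\<^sub>F l in sequentially. (1 + 2 / (real l + 3 - real s - real K) * (real (l + K) powr \<kappa>)) ^ K / (real (l + K) powr \<kappa>)
     \<le> 8 ^ K * (real l powr (- \<kappa>) + real (l + K) powr (\<kappa> * (real K - 1) - real K))"
  proof (rule eventually_sequentiallyI[of "2 * s + 4 * K + 1"])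
    fix l assume l: "2 * s + 4 * K + 1 \<le> l"
    define x where "x = real (l + K)"
    define W where "W = x powr \<kappa>"
    have x: "x > 0" and W: "W > 0" using l by (auto simp: x_def W_def)
    have d: "real l + 3 - real s - real K \<ge> x / 2" using l by (simp add: x_def)
    have "2 / (real l + 3 - real s - real K) \<le> 2 / (x / 2)"
      using d x by (intro divide_left_mono mult_pos_pos) auto
    then have e: "2 / (real l + 3 - real s - real K) * W \<le> 4 / x * W" using W by (intro mult_right_mono) auto
    have e0: "0 \<le> 2 / (real l + 3 - real s - real K)" using d x by simp
    have "(1 + 2 / (real l + 3 - real s - real K) * W) ^ K \<le> (1 + 4 / x * W) ^ K"
      using e e0 W by (intro power_mono) auto
    also have "\<dots> \<le> (2 * max 1 (4 / x * W)) ^ K" using x W by (intro power_mono) auto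
    also have "\<dots> = 2 ^ K * max 1 (4 / x * W) ^ K" by (simp add: power_mult_distrib)
    also have "max 1 (4 / x * W) ^ K \<le> 1 + (4 / x * W) ^ K"
      using x W by (cases "1 \<le> 4 / x * W") (auto simp: max_def)
    also have "(4 / x * W) ^ K = 4 ^ K * (W ^ K / x ^ K)" by (simp add: power_mult_distrib power_divide)
    also have "2 ^ K * (1 + 4 ^ K * (W ^ K / x ^ K)) \<le> 8 ^ K * (1 + W ^ K / x ^ K)"
    proof -
      have "(2::real) ^ K * 4 ^ K = 8 ^ K" "(2::real) ^ K \<le> 8 ^ K"
        by (auto simp: power_mult_distrib[symmetric] intro: power_mono)
      then show ?thesis using x W by (simp add: distrib_left mult.assoc[symmetric])
    qed
    finally have "(1 + 2 / (real l + 3 - real s - real K) * W) ^ K / W \<le> 8 ^ K * (1 + W ^ K / x ^ K) / W"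
      using W by (intro divide_right_mono) auto
    also have "\<dots> = 8 ^ K * (1 / W + W ^ K / W / x ^ K)" using W by (simp add: field_simps)
    also have "W ^ K / W / x ^ K = x powr (\<kappa> * (real K - 1) - real K)"
    proof -
      have "W ^ K = x powr (\<kappa> * real K)" unfolding W_def using x by (simp add: powr_power mult.commute)
      then show ?thesis unfolding W_def using x
        by (simp add: powr_realpow[symmetric] flip: powr_diff) (simp add: algebra_simps)
    qed
    also have "1 / W \<le> real l powr (- \<kappa>)"
    proof -
      have "1 / W = x powr (- \<kappa>)" by (simp add: W_def powr_minus_divide)
      also have "\<dots> \<le> real l powr (- \<kappa>)" using l assms(1) by (intro powr_mono2') (auto simp: x_def)
      finally show ?thesis .
    qed
    finally show "(1 + 2 / (real l + 3 - real s - real K) * (real (l + K) powr \<kappa>)) ^ K / (real (l + K) powr \<kappa>)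
      \<le> 8 ^ K * (real l powr (- \<kappa>) + real (l + K) powr (\<kappa> * (real K - 1) - real K))"
      by (simp add: W_def x_def)
  qed
  have f1: "filterlim (\<lambda>l. real (l + K)) at_top sequentially" by real_asymp
  have lim: "((\<lambda>l. 8 ^ K * (real l powr (- \<kappa>) + real (l + K) powr (\<kappa> * (real K - 1) - real K))) \<longlongrightarrow> 8 ^ K * (0 + 0)) sequentially"
    using assms f1 by (intro tendsto_intros tendsto_neg_powr filterlim_real_sequentially) auto
  have nn: "\<forall>\<^sub>F l in sequentially. 0 \<le> (1 + 2 / (real l + 3 - real s - real K) * (real (l + K) powr \<kappa>)) ^ K / (real (l + K) powr \<kappa>)"
    by (rule eventually_sequentiallyI[of "s + K"]) (auto intro!: divide_nonneg_nonneg zero_le_power add_nonneg_nonneg)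
  show ?thesis using tendsto_sandwich[OF nn bound tendsto_const] lim by simp
qed

section \<open>The upper tail of the number of unoccupied sites\<close>

lemma self_power_le_exp_fact: "real n ^ n \<le> exp (real n) * fact n"
proof -
  have "real n ^ n /\<^sub>R fact n \<le> (\<Sum>k. real n ^ k /\<^sub>R fact k)"
    using sum_le_suminf[OF summable_exp_generic[of "real n"], of "{n}"] by simp
  then have "real n ^ n / fact n \<le> exp (real n)"
    by (simp add: exp_def divide_inverse mult.commute)
  then show ?thesis by (simp add: pos_divide_le_eq)
qed

text \<open>By Stirling's formula the logarithm of \<open>fact l powr \<kappa>\<close> is asymptotic to \<open>\<kappa> * l * ln l\<close>, which for
  \<open>l = \<beta> * h N\<close> is asymptotic to \<open>\<kappa> * \<beta> * ln N\<close>.\<close>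

lemma growth_cap_asymp:
  assumes D: "D > 1" and "\<kappa> > 0" "\<beta> > 0" "1 + \<epsilon> < \<kappa> * \<beta>" "\<kappa> * \<beta> < 2"
  shows "\<forall>\<^sub>F N in sequentially. growth D \<kappa> (nat \<lceil>\<beta> * h N\<rceil>) (nat \<lceil>\<beta> * h N\<rceil>) \<le> real N ^ 2"
    and "\<forall>\<^sub>F N in sequentially. real N powr (1 + \<epsilon>) \<le> growth D \<kappa> (nat \<lceil>\<beta> * h N\<rceil>) (nat \<lceil>\<beta> * h N\<rceil>)"
proof -
  have up: "((\<lambda>N. (\<beta> * h N + 1) * (ln D + \<kappa> * ln (\<beta> * h N + 1)) / ln (real N)) \<longlongrightarrow> \<kappa> * \<beta>) sequentially"
    unfolding h_def using assms by real_asymp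
  have lo: "((\<lambda>N. \<kappa> * (\<beta> * h N * (ln (\<beta> * h N) - 1)) / ln (real N)) \<longlongrightarrow> \<kappa> * \<beta>) sequentially"
    unfolding h_def using assms by real_asymp
  have big: "\<forall>\<^sub>F N in sequentially. \<beta> * h N \<ge> 3" unfolding h_def using assms by real_asymp
  have N1: "\<forall>\<^sub>F N in sequentially. N > (1::nat)" by (rule eventually_gt_at_top)
  show "\<forall>\<^sub>F N in sequentially. growth D \<kappa> (nat \<lceil>\<beta> * h N\<rceil>) (nat \<lceil>\<beta> * h N\<rceil>) \<le> real N ^ 2"
    using order_tendstoD(2)[OF up assms(5)] big N1
  proof eventually_elim
    case (elim N)
    define x where "x = \<beta> * h N"
    define l where "l = nat \<lceil>x\<rceil>"
    have x: "x \<ge> 3" using elim by (simp add: x_def)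
    have l: "x \<le> real l" "real l \<le> x + 1" "l \<ge> 1" using x by (auto simp: l_def) linarith+
    have "growth D \<kappa> l l \<le> (D * real l powr \<kappa>) ^ l"
      by (rule growth_cap_le[OF assms(1,2)])
    also have "D * real l powr \<kappa> = exp (ln D + \<kappa> * ln (real l))"
      using D l by (simp add: exp_add powr_def)
    also have "\<dots> ^ l = exp (real l * (ln D + \<kappa> * ln (real l)))" by (simp only: exp_of_nat_mult)
    also have "\<dots> \<le> exp ((x + 1) * (ln D + \<kappa> * ln (x + 1)))"
    proof -
      have "0 \<le> ln D" "0 \<le> ln (real l)" "ln (real l) \<le> ln (x + 1)" using D l x by auto
      then have "real l * (ln D + \<kappa> * ln (real l)) \<le> (x + 1) * (ln D + \<kappa> * ln (x + 1))"
        using l x assms(2) by (intro mult_mono add_left_mono mult_left_mono) auto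
      then show ?thesis by simp
    qed
    also have "\<dots> \<le> exp (2 * ln (real N))"
      using elim by (simp add: x_def pos_divide_less_eq)
    also have "\<dots> = real N ^ 2" using elim by (simp add: exp_double power2_eq_square)
    finally show ?case by (simp add: l_def x_def)
  qed
  show "\<forall>\<^sub>F N in sequentially. real N powr (1 + \<epsilon>) \<le> growth D \<kappa> (nat \<lceil>\<beta> * h N\<rceil>) (nat \<lceil>\<beta> * h N\<rceil>)"
    using order_tendstoD(1)[OF lo assms(4)] big N1
  proof eventually_elim
    case (elim N)
    define x where "x = \<beta> * h N"
    define l where "l = nat \<lceil>x\<rceil>"
    have x: "x \<ge> 3" using elim by (simp add: x_def)
    have l: "x \<le> real l" "l \<ge> 1" using x by (auto simp: l_def) linarith+
    have "exp 1 \<le> (3::real)" by (rule exp_le)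
    then have "ln x \<ge> 1" using x by (metis exp_gt_zero exp_le_cancel_iff exp_ln order.trans order_less_le_trans)
    have "(1 + \<epsilon>) * ln (real N) \<le> \<kappa> * (x * (ln x - 1))"
      using elim by (simp add: x_def pos_less_divide_eq)
    also have "\<dots> \<le> \<kappa> * (real l * (ln (real l) - 1))"
      using x l assms(2) \<open>ln x \<ge> 1\<close> by (intro mult_left_mono mult_mono) auto
    also have "\<dots> \<le> \<kappa> * ln (fact l)"
    proof (rule mult_left_mono)
      have "exp (real l * (ln (real l) - 1)) * exp (real l) = real l ^ l"
        using l by (simp add: mult_exp_exp algebra_simps exp_of_nat_mult)
      also have "\<dots> \<le> fact l * exp (real l)" using self_power_le_exp_fact[of l] by (simp add: mult.commute)
      finally have "exp (real l * (ln (real l) - 1)) \<le> fact l" by simp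
      then show "real l * (ln (real l) - 1) \<le> ln (fact l)" by (subst ln_ge_iff) auto
    qed (use assms in auto)
    finally have "exp ((1 + \<epsilon>) * ln (real N)) \<le> exp (\<kappa> * ln (fact l))" by simp
    then have "real N powr (1 + \<epsilon>) \<le> fact l powr \<kappa>" using elim by (simp add: powr_def)
    also have "\<dots> \<le> growth D \<kappa> l l" by (rule growth_cap_ge[OF assms(1,2)])
    finally show ?case by (simp add: l_def x_def)
  qed
qed

text \<open>States with small core contract the potential. On the remaining states the potential is at most
  a constant times \<open>N\<^sup>2 * D ^ L\<close>; its expectation there is bounded because the square of \<open>D ^ L\<close> has
  bounded expectation and a core of size \<open>48\<close> has probability of order \<open>1 / N ^ 4\<close>.\<close>

lemma expectation_growth_bounded:
  fixes \<kappa> :: real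
  assumes K: "K \<ge> 1" and kappa: "\<kappa> > 0" "\<kappa> * (real K - 1) < real K"
  shows "\<exists>D C. D > 1 \<and> (\<forall>lim. (\<forall>\<^sub>F N in sequentially. growth D \<kappa> (lim N) (lim N) \<le> real N ^ 2) \<longrightarrow>
    (\<forall>\<^sub>F N in sequentially. expect (ac_law K N) (\<lambda>a. growth D \<kappa> (lim N) (L a)) \<le> C))"
proof -
  obtain \<theta> B where th: "\<theta> > 0" and B: "B > 0" and
    B0: "\<And>n. expect (ac_law K n) (\<lambda>a. exp (\<theta> * real (L a))) \<le> B"
    using exp_moment_bounded[OF K] by blast
  \<comment> \<open>Half the exponent, so that even \<open>(D ^ L)\<^sup>2\<close> has bounded expectation.\<close>
  define D where "D = exp (\<theta> / 2)"
  have D: "D > 1" using th by (simp add: D_def)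
  have DL: "(D ^ l)\<^sup>2 = exp (\<theta> * real l)" "D ^ l \<le> exp (\<theta> * real l)" for l
  proof -
    have e: "D ^ l = exp (\<theta> / 2 * real l)" by (simp add: D_def mult.commute flip: exp_of_nat_mult)
    show "(D ^ l)\<^sup>2 = exp (\<theta> * real l)" unfolding e by (simp add: power2_eq_square mult_exp_exp)
    show "D ^ l \<le> exp (\<theta> * real l)" unfolding e using th by simp
  qed
  \<comment> \<open>A contraction factor strictly between \<open>1 / D\<close>, its limit for large \<open>L\<close>, and \<open>1\<close>.\<close>
  define \<rho> where "\<rho> = (1 + 1 / D) / 2"
  have rho: "0 < \<rho>" "\<rho> < 1" "1 / D < \<rho>" using D by (auto simp: \<rho>_def field_simps)
  have fin: "finite (set_pmf (ac_law K n))" for n by (rule ac_law_support(1)[OF K])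
  let ?q = "\<lambda>l. (1 + 2 / (real l + 3 - real 48 - real K) * (real (l + K) powr \<kappa>)) ^ K / (real (l + K) powr \<kappa>)"
  have "\<forall>\<^sub>F l in sequentially. ?q l < \<rho> - 1 / D"
    using outside_factor_tendsto_0[OF kappa K, of 48] rho by (intro order_tendstoD(2)) auto
  moreover have "\<forall>\<^sub>F l in sequentially. D \<le> real (l + K) powr \<kappa>"
  proof -
    have "filterlim (\<lambda>l. real (l + K) powr \<kappa>) at_top sequentially" using kappa by real_asymp
    then show ?thesis by (auto simp: filterlim_at_top)
  qed
  moreover have "\<forall>\<^sub>F l in sequentially. l \<ge> 48 + K" by (rule eventually_ge_at_top)
  ultimately have "\<forall>\<^sub>F l in sequentially. ?q l < \<rho> - 1 / D \<and> D \<le> real (l + K) powr \<kappa> \<and> l \<ge> 48 + K"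
    by eventually_elim auto
  then obtain L0 where L0: "\<And>l. l \<ge> L0 \<Longrightarrow> ?q l < \<rho> - 1 / D \<and> D \<le> real (l + K) powr \<kappa> \<and> l \<ge> 48 + K"
    unfolding eventually_sequentially by blast
  define C0 where "C0 = (\<Prod>j\<in>{1..L0 + K}. max D (real j powr \<kappa>))"
  have C0: "C0 \<ge> 0" unfolding C0_def using D by (intro prod_nonneg) auto
  define e where "e = C0 + D ^ K * (B + 64) / 2"
  have e: "e \<ge> 0" using C0 D B by (simp add: e_def)
  obtain n0 where n0: "\<And>n. n \<ge> n0 \<Longrightarrow> prob_of (ac_law K n) {a. 48 \<le> card (core a)} \<le> 4 / real n ^ 4"
    using core_tail[OF K] unfolding eventually_sequentially by blast
  have "\<forall>\<^sub>F N in sequentially. expect (ac_law K N) (\<lambda>a. growth D \<kappa> (lim N) (L a)) \<le> 1 + e / (1 - \<rho>)"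
    if lim: "\<forall>\<^sub>F N in sequentially. growth D \<kappa> (lim N) (lim N) \<le> real N ^ 2" for lim
  proof -
    have "\<forall>\<^sub>F N in sequentially. exp (- ((1 - \<rho>) * (real N / 2 - 1))) * (real N ^ 2 * B) \<le> 1"
      using rho B by real_asymp
    moreover have "\<forall>\<^sub>F N in sequentially. N \<ge> 2 * n0 + 2" by (rule eventually_ge_at_top)
    ultimately show ?thesis using lim
    proof eventually_elim
      case (elim N)
      note e1 = elim(1) and N = elim(2) and cap = elim(3)
      let ?F = "growth D \<kappa> (lim N)"
      let ?x = "\<lambda>k. expect (ac_law K k) (\<lambda>a. ?F (L a))"
      let ?P = "\<lambda>a. if a \<in> {a. 48 \<le> card (core a)} then 1 else 0 :: real"
      note Fpos = growth_pos[OF D kappa(1), of "lim N"]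
      note Fmono = growth_mono[OF D kappa(1), of _ _ "lim N"]
      have Fub: "?F l \<le> real N ^ 2 * D ^ l" for l
        by (rule order_trans[OF growth_le[OF D kappa(1)] mult_right_mono[OF cap]]) (use D in auto)
      have step: "expect (ac_step K a) (\<lambda>a'. ?F (L a')) \<le>
          (\<rho> * ?F (L a) + C0) + D ^ K / 2 * (exp (\<theta> * real (L a)) + real N ^ 4 * ?P a)"
        if a: "a \<in> sized (Suc k)" for a k
      proof -
        have a1: "Suc k \<ge> 1" by simp
        have crude: "expect (ac_step K a) (\<lambda>a'. ?F (L a')) \<le> ?F (L a + K)"
        proof -
          have "expect (ac_step K a) (\<lambda>a'. ?F (L a')) \<le> expect (ac_step K a) (\<lambda>_. ?F (L a + K))"
            using ac_step_support[OF a a1 K] by (intro expectation_mono_finite Fmono) auto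
          then show ?thesis by simp
        qed
        have nn: "0 \<le> D ^ K / 2 * (exp (\<theta> * real (L a)) + real N ^ 4 * ?P a)" using D by simp
        have nn2: "0 \<le> \<rho> * ?F (L a)" using rho Fpos[of "L a"] by simp
        show ?thesis
        proof (cases "48 \<le> card (core a)")
          case True
          have "2 * (real N ^ 2 * D ^ L a) \<le> (D ^ L a)\<^sup>2 + (real N ^ 2)\<^sup>2"
            using sum_squares_bound[of "D ^ L a" "real N ^ 2"] by (simp add: mult_ac)
          then have am: "real N ^ 2 * D ^ L a \<le> (exp (\<theta> * real (L a)) + real N ^ 4) / 2"
            unfolding DL by simp
          have "?F (L a + K) \<le> D ^ K * (real N ^ 2 * D ^ L a)"
            using Fub[of "L a + K"] by (simp add: power_add mult_ac)
          also have "\<dots> \<le> D ^ K * ((exp (\<theta> * real (L a)) + real N ^ 4) / 2)" using am D by (intro mult_left_mono) auto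
          finally show ?thesis using crude nn2 C0 True by simp
        next
          case False
          show ?thesis
          proof (cases "L a \<ge> L0")
            case True
            note l = L0[OF True]
            have "expect (ac_step K a) (\<lambda>a'. ?F (L a')) \<le> (1 / D + ?q (L a)) * ?F (L a)"
              using l False K by (intro ac_step_growth[OF D kappa(1) a a1 K]) auto
            also have "\<dots> \<le> \<rho> * ?F (L a)" using l Fpos[of "L a"] by (intro mult_right_mono) auto
            finally show ?thesis using nn C0 by linarith
          next
            case False
            then have "?F (L a + K) \<le> ?F (L0 + K)" by (intro Fmono) auto
            also have "\<dots> \<le> C0" unfolding C0_def by (rule growth_le_independent[OF D kappa(1)])
            finally show ?thesis using crude nn nn2 by linarith
          qed
        qed
      qed
      have rec: "?x (Suc k) \<le> (1 - (1 - \<rho>)) * ?x k + e" if k: "N - N div 2 \<le> k" "k < N" for k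
      proof -
        have k0: "k \<ge> n0" "k > 0" using k N by linarith+
        have "real N / 2 \<le> real k" using k by linarith
        then have "(real N / 2) ^ 4 \<le> real k ^ 4" by (intro power_mono) auto
        then have "real N ^ 4 \<le> 16 * real k ^ 4" by (simp add: power_divide)
        then have "4 / real k ^ 4 \<le> 64 / real N ^ 4" using k0 N by (simp add: field_simps)
        then have P: "prob_of (ac_law K k) {a. 48 \<le> card (core a)} \<le> 64 / real N ^ 4"
          using n0[OF k0(1)] by linarith
        have "?x (Suc k) \<le> expect (ac_law K k) (\<lambda>a.
          (\<rho> * ?F (L a) + C0) + D ^ K / 2 * (exp (\<theta> * real (L a)) + real N ^ 4 * ?P a))"
          unfolding expectation_ac_law_Suc[OF K]
          using ac_law_support(2)[OF K] by (intro expectation_mono_finite[OF fin] step) auto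
        also have "\<dots> = \<rho> * ?x k + C0 + D ^ K / 2 * (expect (ac_law K k) (\<lambda>a. exp (\<theta> * real (L a))) +
            real N ^ 4 * prob_of (ac_law K k) {a. 48 \<le> card (core a)})"
          unfolding prob_eq_expectation
          by (simp only: expectation_add_finite[OF fin] integral_mult_right_zero expectation_const_pmf)
        also have "\<dots> \<le> \<rho> * ?x k + C0 + D ^ K / 2 * (B + real N ^ 4 * (64 / real N ^ 4))"
          using B0 P D by (intro add_left_mono mult_left_mono add_mono) auto
        also have "\<dots> = \<rho> * ?x k + e" using N by (simp add: e_def)
        finally show ?thesis by simp
      qed
      have x0: "?x k \<le> real N ^ 2 * B" for k
      proof -
        have "?x k \<le> expect (ac_law K k) (\<lambda>a. real N ^ 2 * exp (\<theta> * real (L a)))"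
        proof (rule expectation_mono_finite[OF fin])
          fix a
          have "real N ^ 2 * D ^ L a \<le> real N ^ 2 * exp (\<theta> * real (L a))" using DL(2) by (intro mult_left_mono) auto
          then show "?F (L a) \<le> real N ^ 2 * exp (\<theta> * real (L a))" using Fub[of "L a"] by linarith
        qed
        also have "\<dots> \<le> real N ^ 2 * B" using B0 by (auto intro!: mult_left_mono)
        finally show ?thesis .
      qed
      have "?x N \<le> exp (- ((1 - \<rho>) * (real N / 2 - 1))) * (real N ^ 2 * B) + e / (1 - \<rho>)"
        using rho rec e x0 B by (intro affine_recursion_decay) auto
      also have "\<dots> \<le> 1 + e / (1 - \<rho>)" using e1 by simp
      finally show ?case .
    qed
  qed
  then show ?thesis using D by blast
qed

text \<open>The exponents \<open>\<kappa> = 1 / (c * (1 + \<delta> / 2))\<close> and \<open>\<beta> = (1 + \<delta>) * c\<close>, where \<open>c = (K - 1) / K\<close>, satisfy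
  \<open>\<kappa> < K / (K - 1)\<close> and \<open>\<kappa> * \<beta> > 1\<close> at the same time.\<close>

lemma L_upper_tail:
  fixes \<delta> :: real
  assumes K: "K \<ge> 2" and delta: "\<delta> > 0"
  shows "\<exists>C \<epsilon>. \<epsilon> > 0 \<and> (\<forall>\<^sub>F N in sequentially.
    prob_of (ac_law K N) {a. (1 + \<delta>) * ((real K - 1) / real K) * h N \<le> real (L a)} \<le> C * real N powr (- 1 - \<epsilon>))"
proof -
  define c where "c = (real K - 1) / real K"
  have c: "c > 0" "c * real K = real K - 1" using K by (auto simp: c_def)
  define \<kappa> where "\<kappa> = 1 / (c * (1 + \<delta> / 2))"
  define \<beta> where "\<beta> = (1 + \<delta>) * c"
  define d where "d = (\<delta> / 2) / (1 + \<delta> / 2)"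
  define \<epsilon> where "\<epsilon> = d / 2"
  have d: "d > 0" "d < 1" using delta by (auto simp: d_def)
  then have eps: "\<epsilon> > 0" by (simp add: \<epsilon>_def)
  have kappa: "\<kappa> > 0" "\<beta> > 0" using c delta by (auto simp: \<kappa>_def \<beta>_def)
  have kb: "\<kappa> * \<beta> = 1 + 2 * \<epsilon>"
  proof -
    have "\<kappa> * \<beta> = (1 + \<delta>) / (1 + \<delta> / 2)" using c by (simp add: \<kappa>_def \<beta>_def)
    also have "\<dots> = ((1 + \<delta> / 2) + \<delta> / 2) / (1 + \<delta> / 2)" by simp
    also have "\<dots> = 1 + (\<delta> / 2) / (1 + \<delta> / 2)" using delta by (subst add_divide_distrib) simp
    finally have "\<kappa> * \<beta> = 1 + d" unfolding d_def .
    then show ?thesis by (simp add: \<epsilon>_def)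
  qed
  have "2 * \<epsilon> < 1" using d by (simp add: \<epsilon>_def)
  then have kb2: "1 + \<epsilon> < \<kappa> * \<beta>" "\<kappa> * \<beta> < 2" using eps kb by auto
  have "\<kappa> * (real K - 1) = real K / (1 + \<delta> / 2)"
    using c delta by (simp add: \<kappa>_def c(2)[symmetric])
  also have "\<dots> < real K" using K delta by (simp add: pos_divide_less_eq)
  finally have kK: "\<kappa> * (real K - 1) < real K" .
  have K1: "K \<ge> 1" using K by simp
  obtain D C where D: "D > 1" and
    C: "\<And>lim. (\<forall>\<^sub>F N in sequentially. growth D \<kappa> (lim N) (lim N) \<le> real N ^ 2) \<Longrightarrow>
    (\<forall>\<^sub>F N in sequentially. expect (ac_law K N) (\<lambda>a. growth D \<kappa> (lim N) (L a)) \<le> C)"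
    using expectation_growth_bounded[OF K1 kappa(1) kK] by blast
  note asy = growth_cap_asymp[OF D kappa kb2]
  have "\<forall>\<^sub>F N in sequentially. prob_of (ac_law K N) {a. \<beta> * h N \<le> real (L a)} \<le> C * real N powr (- 1 - \<epsilon>)"
    using C[OF asy(1)] asy(2) eventually_gt_at_top[of 0]
  proof eventually_elim
    case (elim N)
    define l where "l = nat \<lceil>\<beta> * h N\<rceil>"
    let ?F = "growth D \<kappa> l"
    note Fpos = growth_pos[OF D kappa(1), of l]
    have fin: "finite (set_pmf (ac_law K N))" by (rule ac_law_support(1)[OF K1])
    have "?F l * prob_of (ac_law K N) {a. \<beta> * h N \<le> real (L a)} =
      expect (ac_law K N) (\<lambda>a. ?F l * (if a \<in> {a. \<beta> * h N \<le> real (L a)} then 1 else 0))"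
      unfolding prob_eq_expectation by simp
    also have "\<dots> \<le> expect (ac_law K N) (\<lambda>a. ?F (L a))"
    proof (rule expectation_mono_finite[OF fin])
      fix a
      have "?F l \<le> ?F (L a)" if "\<beta> * h N \<le> real (L a)"
        using that by (intro growth_mono[OF D kappa(1)]) (simp add: l_def)
      then show "?F l * (if a \<in> {a. \<beta> * h N \<le> real (L a)} then 1 else 0) \<le> ?F (L a)"
        using Fpos[of "L a"] by auto
    qed
    also have "\<dots> \<le> C" using elim by (simp add: l_def)
    finally have 1: "?F l * prob_of (ac_law K N) {a. \<beta> * h N \<le> real (L a)} \<le> C" .
    have "real N powr (1 + \<epsilon>) * prob_of (ac_law K N) {a. \<beta> * h N \<le> real (L a)} \<le> C"
      by (rule order_trans[OF mult_right_mono 1]) (use elim in \<open>auto simp: l_def\<close>)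
    then have "real N powr (- 1 - \<epsilon>) * (real N powr (1 + \<epsilon>) * prob_of (ac_law K N) {a. \<beta> * h N \<le> real (L a)})
       \<le> real N powr (- 1 - \<epsilon>) * C" by (intro mult_left_mono) auto
    moreover have "real N powr (- 1 - \<epsilon>) * real N powr (1 + \<epsilon>) = 1"
      using elim by (simp add: powr_add[symmetric])
    ultimately show ?case by (simp add: mult.assoc[symmetric] mult.commute)
  qed
  then show ?thesis using eps unfolding \<beta>_def c_def by blast
qed

section \<open>Lower bounds for the probabilities of single steps\<close>

lemma prob_dels_Suc:
  assumes "a \<in> sized m" "Suc k < m"
  shows "prob_of (dels (Suc k) a) B =
    expect (delete_site a) (\<lambda>b. prob_of (dels k b) B)"
  unfolding prob_eq_expectation by (rule expectation_dels_Suc[OF assms])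

lemma prob_adds_Suc:
  assumes "a \<in> sized m" "m \<ge> 1"
  shows "prob_of (adds (Suc k) a) B =
    expect (add_site a) (\<lambda>b. prob_of (adds k b) B)"
  unfolding prob_eq_expectation by (rule expectation_adds_Suc[OF assms])

lemma prob_site_deleted_le:
  assumes "a \<in> sized m" "k < m" "x \<in> a"
  shows "prob_of (dels k a) {a'. x \<notin> a'} \<le> real k / real (m - k)"
  using assms
proof (induction k arbitrary: a m)
  case 0
  then show ?case by (simp add: prob_eq_expectation)
next
  case (Suc k)
  from Suc.prems obtain m' where m': "m = Suc m'" "k < m'" by (cases m) auto
  let ?M = "real (m' - k)"
  have M: "?M > 0" using m' by simp
  have "prob_of (dels (Suc k) a) {a'. x \<notin> a'} =
    expect (delete_site a) (\<lambda>b. prob_of (dels k b) {a'. x \<notin> a'})"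
    by (rule prob_dels_Suc[OF Suc.prems(1,2)])
  also have "\<dots> \<le> real k / ?M + (1 / ?M) * 1"
  proof (rule expectation_delete_site_le[OF Suc.prems(1), of "{x}"])
    have "?M \<le> real m" using m' by simp
    then show "real (card {x}) \<le> 1 / ?M * real m" using M by (simp add: pos_le_divide_eq)
    show "prob_of (dels k (a - {z})) {a'. x \<notin> a'} \<le> real k / ?M" if "z \<in> a - {x}" for z
      using delete_site_sized[of a m' z] Suc.prems m' that by (intro Suc.IH) auto
  qed (use Suc.prems M in auto)
  also have "\<dots> = real (Suc k) / real (m - Suc k)" using m' by (simp add: add_divide_distrib)
  finally show ?case .
qed

lemma prob_two_sites_deleted_le:
  assumes "a \<in> sized m" "k < m" "x \<in> a" "y \<in> a" "x \<noteq> y"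
  shows "prob_of (dels k a) {a'. x \<notin> a' \<and> y \<notin> a'} \<le> (real k / real (m - k))\<^sup>2"
  using assms
proof (induction k arbitrary: a m)
  case 0
  then show ?case by (simp add: prob_eq_expectation)
next
  case (Suc k)
  from Suc.prems obtain m' where m': "m = Suc m'" "k < m'" by (cases m) auto
  let ?M = "real (m' - k)"
  have M: "?M > 0" using m' by simp
  let ?B = "{a'. x \<notin> a' \<and> y \<notin> a'}"
  have "prob_of (dels (Suc k) a) ?B =
    expect (delete_site a) (\<lambda>b. prob_of (dels k b) ?B)"
    by (rule prob_dels_Suc[OF Suc.prems(1,2)])
  also have "\<dots> \<le> (real k / ?M)\<^sup>2 + (2 / ?M) * (real k / ?M)"
  proof (rule expectation_delete_site_le[OF Suc.prems(1), of "{x, y}"])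
    have "?M \<le> real m" using m' by simp
    then show "real (card {x, y}) \<le> 2 / ?M * real m" using M Suc.prems(5) by (simp add: pos_le_divide_eq)
    show "prob_of (dels k (a - {z})) ?B \<le> (real k / ?M)\<^sup>2" if "z \<in> a - {x, y}" for z
      using delete_site_sized[of a m' z] Suc.prems m' that by (intro Suc.IH) auto
    show "prob_of (dels k (a - {z})) ?B \<le> real k / ?M" if z: "z \<in> {x, y}" for z
    proof -
      obtain w where w: "w \<in> a - {z}" "?B \<subseteq> {a'. w \<notin> a'}" using z Suc.prems(3-5) by (cases "z = x") auto
      have "prob_of (dels k (a - {z})) ?B \<le>
        prob_of (dels k (a - {z})) {a'. w \<notin> a'}"
        using w(2) by (intro measure_pmf.finite_measure_mono) auto
      also have "\<dots> \<le> real k / ?M"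
        using delete_site_sized[of a m' z] Suc.prems m' z w(1) by (intro prob_site_deleted_le) auto
      finally show ?thesis .
    qed
  qed (use Suc.prems M in auto)
  also have "\<dots> \<le> (real k / ?M)\<^sup>2 + 2 * (1 / ?M) * (real k / ?M) + (1 / ?M)\<^sup>2" by simp
  also have "\<dots> = (real (Suc k) / ?M)\<^sup>2"
    by (simp add: add_divide_distrib power2_sum mult_ac)
  finally show ?case using m' by simp
qed

text \<open>Every deleted site inside the remaining hull counts for \<open>L\<close>. If no two of the extreme sites in
  question disappear together, the hull loses at most one endpoint and extends to the
  neighbouring occupied site.\<close>

lemma L_ge_deleted:
  assumes fin: "finite a" "a' \<subseteq> a" "a' \<noteq> {}"
    and "Min a \<in> a' \<or> Max a \<in> a'"
    and "Min a \<in> a' \<or> Min (a - {Min a}) \<in> a'"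
    and "Max a \<in> a' \<or> Max (a - {Max a}) \<in> a'"
  shows "card (a - a') \<le> L a' + 1"
proof -
  have fa': "finite a'" using fin finite_subset by auto
  have g: "Min a' \<le> z \<and> z \<le> Max a'" if "z \<in> a'" for z using that fa' by simp
  have ga: "Min a \<le> z \<and> z \<le> Max a" if "z \<in> a" for z using that fin(1) by simp
  \<comment> \<open>\<open>w\<close> is the lost endpoint, if there is one; otherwise any value will do.\<close>
  have "\<exists>w. (a - a') - {w} \<subseteq> {Min a'..Max a'} - a'"
  proof (cases "Min a \<in> a'")
    case True
    show ?thesis
    proof (cases "Max a \<in> a'")
      case T2: True
      show ?thesis using g[OF True] g[OF T2] ga by (intro exI[of _ 0]) force
    next
      case False
      have i: "Max (a - {Max a}) \<in> a'" using False assms(6) by blast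
      have "z \<le> Max (a - {Max a})" if "z \<in> a - {Max a}" for z
        using that fin(1) by (intro Max_ge) auto
      then show ?thesis using g[OF True] g[OF i] ga by (intro exI[of _ "Max a"]) force
    qed
  next
    case False
    have i: "Min (a - {Min a}) \<in> a'" "Max a \<in> a'" using False assms(4,5) by blast+
    have "Min (a - {Min a}) \<le> z" if "z \<in> a - {Min a}" for z
      using that fin(1) by (intro Min_le) auto
    then show ?thesis using g[OF i(1)] g[OF i(2)] ga by (intro exI[of _ "Min a"]) force
  qed
  then obtain w where w: "(a - a') - {w} \<subseteq> {Min a'..Max a'} - a'" by blast
  have "card (a - a') - 1 \<le> card ((a - a') - {w})" using diff_card_le_card_Diff[of "{w}" "a - a'"] by simp
  also have "\<dots> \<le> L a'" unfolding L_def using w by (intro card_mono) auto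
  finally show ?thesis by simp
qed

lemma prob_dels_L_small:
  assumes a: "a \<in> sized m" and k: "k + 2 \<le> m"
  shows "prob_of (dels k a) {a'. L a' + 1 < k} \<le> 3 * (real k / real (m - k))\<^sup>2"
proof -
  note fa = sizedD[OF a]
  have km: "k < m" using k by simp
  let ?p = "dels k a"
  define x1 x2 y1 y2 where "x1 = Min a" and "x2 = Min (a - {Min a})" and "y1 = Max a" and "y2 = Max (a - {Max a})"
  have ne: "a \<noteq> {}" "a - {Min a} \<noteq> {}" "a - {Max a} \<noteq> {}"
  proof -
    show "a \<noteq> {}" using fa k by auto
    have "\<not> a \<subseteq> {z}" for z using fa k card_mono[of "{z}" a] by auto
    then show "a - {Min a} \<noteq> {}" "a - {Max a} \<noteq> {}" by blast+
  qed
  have x2: "x2 \<in> a - {Min a}" and y2: "y2 \<in> a - {Max a}"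
    unfolding x2_def y2_def using fa ne by (auto intro!: Min_in Max_in simp del: Diff_iff)
  have mem: "x1 \<in> a" "y1 \<in> a" "x2 \<in> a" "y2 \<in> a" "x1 \<noteq> x2" "y1 \<noteq> y2"
    using fa ne x2 y2 by (auto simp: x1_def y1_def)
  have "x1 \<noteq> y1"
  proof
    assume "x1 = y1"
    moreover have "x1 \<le> z" "z \<le> y1" if "z \<in> a" for z using that fa by (auto simp: x1_def y1_def)
    ultimately have "z = x1" if "z \<in> a" for z using that by force
    then show False using mem by blast
  qed
  let ?B = "\<lambda>x y. {a'. x \<notin> a' \<and> y \<notin> a'}"
  have "prob_of ?p {a'. L a' + 1 < k} \<le> prob_of ?p ((?B x1 y1 \<union> ?B x1 x2) \<union> ?B y1 y2)"
  proof (rule measure_pmf.finite_measure_mono_AE)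
    show "AE a' in ?p. a' \<in> {a'. L a' + 1 < k} \<longrightarrow> a' \<in> (?B x1 y1 \<union> ?B x1 x2) \<union> ?B y1 y2"
    proof (subst AE_measure_pmf_iff, intro ballI impI)
      fix a' assume a': "a' \<in> set_pmf ?p" "a' \<in> {a'. L a' + 1 < k}"
      have s: "a' \<in> sized (m - k)" "a' \<subseteq> a" using dels_support(2)[OF a km a'(1)] by auto
      have "a' \<noteq> {}" using sized_nonempty[OF s(1)] k by simp
      have "card (a - a') = k" using s fa k sizedD[OF s(1)] by (simp add: card_Diff_subset)
      then show "a' \<in> (?B x1 y1 \<union> ?B x1 x2) \<union> ?B y1 y2"
        using L_ge_deleted[OF fa(1) s(2) \<open>a' \<noteq> {}\<close>] a'(2) unfolding x1_def x2_def y1_def y2_def by auto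
    qed
  qed auto
  also have "\<dots> \<le> prob_of ?p (?B x1 y1) + prob_of ?p (?B x1 x2) + prob_of ?p (?B y1 y2)"
    by (intro order_trans[OF measure_Un_le] add_right_mono
        measure_Un_le) auto
  also have "\<dots> \<le> (real k / real (m - k))\<^sup>2 + (real k / real (m - k))\<^sup>2 + (real k / real (m - k))\<^sup>2"
    using mem \<open>x1 \<noteq> y1\<close> by (intro add_mono prob_two_sites_deleted_le[OF a km]) auto
  finally show ?thesis by simp
qed

lemma ac_step_prob_L_small:
  assumes a: "a \<in> sized m" "m \<ge> 1" and K: "K \<ge> 1"
  shows "prob_of (ac_step K a) {a'. L a' + 2 < K} \<le> 3 * (real K / real (m + 1))\<^sup>2"
proof -
  have "prob_of (ac_step K a) {a'. L a' + 2 < K} = expect (adds K a)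
     (\<lambda>b. prob_of (dels (K - 1) b) {a'. L a' + 2 < K})"
    unfolding prob_eq_expectation by (rule expectation_ac_step[OF a])
  also have "\<dots> \<le> expect (adds K a) (\<lambda>_. 3 * (real K / real (m + 1))\<^sup>2)"
  proof (rule expectation_mono_finite[OF adds_support(1)[OF a]])
    fix b assume "b \<in> set_pmf (adds K a)"
    then have b: "b \<in> sized (m + K)" using adds_support(2)[OF a] by blast
    have e: "{a'. L a' + 2 < K} = {a'. L a' + 1 < K - 1}" "m + K - (K - 1) = m + 1" using K by auto
    have "prob_of (dels (K - 1) b) {a'. L a' + 1 < K - 1} \<le> 3 * (real (K - 1) / real (m + 1))\<^sup>2"
      using prob_dels_L_small[OF b, of "K - 1"] K a unfolding e(2) by simp
    also have "\<dots> \<le> 3 * (real K / real (m + 1))\<^sup>2"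
      by (intro mult_left_mono power_mono divide_right_mono) auto
    finally show "prob_of (dels (K - 1) b) {a'. L a' + 2 < K} \<le> 3 * (real K / real (m + 1))\<^sup>2"
      unfolding e(1) .
  qed
  finally show ?thesis by simp
qed

lemma prob_dels_interior_ge:
  assumes "a \<in> sized m" "k + 2 \<le> m"
  shows "prob_of (dels k a) {a'. L a' = L a + k} \<ge> (1 / 3) ^ k"
  using assms
proof (induction k arbitrary: a m)
  case 0
  then show ?case by (simp add: prob_eq_expectation)
next
  case (Suc k)
  from Suc.prems obtain m' where m': "m = Suc m'" "k + 2 \<le> m'" by (cases m) auto
  note fa = sizedD(1)[OF Suc.prems(1)]
  have "(1 / 3) ^ k / 3 \<le> expect (delete_site a)
      (\<lambda>b. prob_of (dels k b) {a'. L a' = L a + Suc k})"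
  proof (rule expectation_delete_site_interior_ge[OF Suc.prems(1)])
    fix x assume x: "x \<in> a" "Min a < x" "x < Max a"
    have s: "a - {x} \<in> sized m'" using delete_site_sized[of a m' x] Suc.prems m' x by auto
    have e: "L a + Suc k = L (a - {x}) + k" using L_delete_interior[OF fa x] by simp
    show "(1 / 3) ^ k \<le> prob_of (dels k (a - {x})) {a'. L a' = L a + Suc k}"
      unfolding e by (rule Suc.IH[OF s m'(2)])
  qed (use m' in auto)
  also have "\<dots> = prob_of (dels (Suc k) a) {a'. L a' = L a + Suc k}"
    using prob_dels_Suc[OF Suc.prems(1)] Suc.prems(2) by simp
  finally show ?case by simp
qed

text \<open>If there is a gap, then \<open>f \<ge> 1\<close> and an addition falls inside with probability at least \<open>1 / 3\<close>; without gaps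
  every addition keeps \<open>L = 0\<close>.\<close>

lemma prob_adds_inside_ge:
  assumes "a \<in> sized m" "m \<ge> 1"
  shows "prob_of (adds k a) {a'. L a' \<le> L a - k} \<ge> (1 / 3) ^ k"
  using assms
proof (induction k arbitrary: a m)
  case 0
  then show ?case by (simp add: prob_eq_expectation)
next
  case (Suc k)
  note a = sizedD(1)[OF Suc.prems(1)] sized_nonempty[OF Suc.prems]
  let ?b = "real (card (fringe a))"
  let ?B = "{a'. L a' \<le> L a - Suc k}"
  let ?v = "if L a = 0 then (1 / 3) ^ k else 0 :: real"
  have bd: "y \<in> boundary a" if "y \<in> fringe a \<or> y = Min a - 1 \<or> y = Max a + 1" for y
    using boundary_eq_fringe[OF a] that by auto
  have "(?b * (1 / 3) ^ k + 2 * ?v) / (?b + 2) \<le>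
     expect (add_site a) (\<lambda>b. prob_of (adds k b) ?B)"
  proof (rule expectation_add_site_ge[OF Suc.prems])
    fix y assume y: "y \<in> fringe a"
    have e: "L a - Suc k = L (insert y a) - k" using L_insert_fringe[OF a y] by simp
    show "(1 / 3) ^ k \<le> prob_of (adds k (insert y a)) ?B"
      unfolding e using add_site_sized[OF Suc.prems(1) bd] y by (intro Suc.IH) auto
  next
    fix y assume y: "y = Min a - 1 \<or> y = Max a + 1"
    show "?v \<le> prob_of (adds k (insert y a)) ?B"
    proof (cases "L a = 0")
      case True
      have e: "L a - Suc k = L (insert y a) - k" using insert_outer[OF a y] True by simp
      have "(1 / 3) ^ k \<le> prob_of (adds k (insert y a)) ?B"
        unfolding e using add_site_sized[OF Suc.prems(1) bd] y by (intro Suc.IH) auto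
      then show ?thesis using True by simp
    qed simp
  qed
  moreover have "(1 / 3) ^ Suc k \<le> (?b * (1 / 3) ^ k + 2 * ?v) / (?b + 2)"
  proof (cases "L a = 0")
    case True
    have "?b + 2 \<noteq> 0" by linarith
    moreover have "?b * (1 / 3) ^ k + 2 * ?v = (1 / 3) ^ k * (?b + 2)" using True by (simp add: algebra_simps)
    ultimately have "(?b * (1 / 3) ^ k + 2 * ?v) / (?b + 2) = (1 / 3) ^ k" by (metis nonzero_mult_div_cancel_right)
    then show ?thesis by simp
  next
    case False
    then have "?b \<ge> 1" using fringe_nonempty[OF a] by simp
    then have "(1 / 3) * (1 / 3) ^ k \<le> (?b / (?b + 2)) * (1 / 3 :: real) ^ k"
      by (intro mult_right_mono) (auto simp: pos_le_divide_eq)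
    then show ?thesis using False by simp
  qed
  ultimately show ?case unfolding prob_adds_Suc[OF Suc.prems] by linarith
qed

lemma prob_adds_outside_ge:
  assumes "a \<in> sized m" "m \<ge> 1"
  shows "prob_of (adds k a) {a'. L a' = L a} \<ge> (1 / (real (L a) + 1)) ^ k"
  using assms
proof (induction k arbitrary: a m)
  case 0
  then show ?case by (simp add: prob_eq_expectation)
next
  case (Suc k)
  note a = sizedD(1)[OF Suc.prems(1)] sized_nonempty[OF Suc.prems]
  let ?b = "real (card (fringe a))"
  let ?B = "{a'. L a' = L a}"
  have bd: "y \<in> boundary a" if "y = Min a - 1 \<or> y = Max a + 1" for y
    using boundary_eq_fringe[OF a] that by auto
  have "(?b * 0 + 2 * (1 / (real (L a) + 1)) ^ k) / (?b + 2) \<le>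
     expect (add_site a) (\<lambda>b. prob_of (adds k b) ?B)"
  proof (rule expectation_add_site_ge[OF Suc.prems])
    fix y assume y: "y = Min a - 1 \<or> y = Max a + 1"
    have e: "L a = L (insert y a)" using insert_outer[OF a y] by simp
    show "(1 / (real (L a) + 1)) ^ k \<le> prob_of (adds k (insert y a)) ?B"
      unfolding e using add_site_sized[OF Suc.prems(1) bd[OF y]] by (intro Suc.IH) auto
  qed auto
  moreover have "(1 / (real (L a) + 1)) ^ Suc k \<le> (?b * 0 + 2 * (1 / (real (L a) + 1)) ^ k) / (?b + 2)"
  proof -
    have "?b \<le> real (L a)" using L_eq_fringe_core[of a] by simp
    then have "1 / (real (L a) + 1) \<le> 2 / (?b + 2)" by (simp add: field_simps)
    then have "1 / (real (L a) + 1) * (1 / (real (L a) + 1)) ^ k \<le> 2 / (?b + 2) * (1 / (real (L a) + 1)) ^ k"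
      by (intro mult_right_mono) auto
    then show ?thesis by simp
  qed
  ultimately show ?case unfolding prob_adds_Suc[OF Suc.prems] by linarith
qed

lemma ac_step_prob_ge:
  assumes a: "a \<in> sized m" "m \<ge> 1" and "\<beta> \<ge> 0"
    and P: "\<alpha> \<le> prob_of (adds K a) P"
    and B: "\<And>b. b \<in> sized (m + K) \<Longrightarrow> b \<in> P \<Longrightarrow> \<beta> \<le> prob_of (dels (K - 1) b) B"
  shows "\<alpha> * \<beta> \<le> prob_of (ac_step K a) B"
proof -
  have "\<alpha> * \<beta> \<le> prob_of (adds K a) P * \<beta>" using P assms(3) by (rule mult_right_mono)
  also have "\<dots> = expect (adds K a) (\<lambda>b. (if b \<in> P then 1 else 0) * \<beta>)"
    unfolding prob_eq_expectation by simp
  also have "\<dots> \<le> expect (adds K a)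
      (\<lambda>b. prob_of (dels (K - 1) b) B)"
    using adds_support[OF a] B by (intro expectation_mono_finite) auto
  also have "\<dots> = prob_of (ac_step K a) B"
    unfolding prob_eq_expectation by (rule expectation_ac_step[OF a, symmetric])
  finally show ?thesis .
qed

lemma ac_step_prob_decrease:
  assumes a: "a \<in> sized m" "m \<ge> 1" and K: "K \<ge> 1"
  shows "(1 / 3) ^ K \<le> prob_of (ac_step K a) {a'. L a' \<le> (L a - K) + (K - 1)}"
proof -
  have "(1 / 3) ^ K * 1 \<le> prob_of (ac_step K a) {a'. L a' \<le> (L a - K) + (K - 1)}"
  proof (rule ac_step_prob_ge[OF a _ prob_adds_inside_ge[OF a]])
    fix b assume b: "b \<in> sized (m + K)" "b \<in> {a'. L a' \<le> L a - K}"
    have t: "K - 1 < m + K" using a by simp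
    have "expect (dels (K - 1) b) (\<lambda>_. 1 :: real) \<le>
        prob_of (dels (K - 1) b) {a'. L a' \<le> (L a - K) + (K - 1)}"
      unfolding prob_eq_expectation
      using dels_support[OF b(1) t] b(2) by (intro expectation_mono_finite) fastforce+
    then show "1 \<le> prob_of (dels (K - 1) b) {a'. L a' \<le> (L a - K) + (K - 1)}" by simp
  qed simp
  then show ?thesis by simp
qed

text \<open>All gaps are filled first. Then the left endpoint is deleted, with probability \<open>1 / (m + K)\<close>, and the other
  \<open>K - 2\<close> deletions hit interior sites.\<close>

lemma ac_step_prob_minimal:
  assumes a: "a \<in> sized m" "m \<ge> 1" and K: "K \<ge> 2" and l: "L a \<le> K"
  shows "(1 / 3) ^ (2 * K) / real (m + K) \<le> prob_of (ac_step K a) {a'. L a' = K - 2}"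
proof -
  have "(1 / 3) ^ K * ((1 / 3) ^ K / real (m + K)) \<le> prob_of (ac_step K a) {a'. L a' = K - 2}"
  proof (rule ac_step_prob_ge[OF a _ prob_adds_inside_ge[OF a]])
    fix b assume b: "b \<in> sized (m + K)" "b \<in> {a'. L a' \<le> L a - K}"
    then have Lb: "L b = 0" using l by simp
    have K1: "K - 1 = Suc (K - 2)" using K by simp
    obtain m' where m': "m + K = Suc m'" "m' \<ge> K" using a K by (cases "m + K") auto
    note fb = sizedD[OF b(1)]
    have ne: "b \<noteq> {}" using b(1) m' by (auto simp: sized_def)
    then have mi: "Min b \<in> b" using fb by simp
    let ?c = "b - {Min b}"
    have c: "?c \<in> sized m'" using delete_site_sized[of b m' "Min b"] b m' mi by simp
    have "?c \<noteq> {}" using sized_nonempty[OF c] m' K by simp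
    then have Lc: "L ?c = 0" using L_delete_end[of b "Min b"] fb Lb by simp
    have "(1 / 3) ^ K / real (m + K) \<le> (1 / 3) ^ (K - 2) / real (m + K)"
      by (intro divide_right_mono power_decreasing) auto
    also have "\<dots> \<le> prob_of (dels (K - 2) ?c) {a'. L a' = K - 2} / real (m + K)"
      using prob_dels_interior_ge[OF c, of "K - 2"] m' K Lc by (intro divide_right_mono) auto
    also have "\<dots> \<le> (\<Sum>x\<in>b. prob_of (dels (K - 2) (b - {x})) {a'. L a' = K - 2}) / real (m + K)"
      using fb mi by (intro divide_right_mono member_le_sum) auto
    also have "\<dots> = expect (delete_site b)
        (\<lambda>b. prob_of (dels (K - 2) b) {a'. L a' = K - 2})"
      using b(1) a by (subst expectation_delete_site[of b "m + K"]) auto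
    also have "\<dots> = prob_of (dels (K - 1) b) {a'. L a' = K - 2}"
      unfolding K1 using prob_dels_Suc[OF b(1), of "K - 2"] K a by simp
    finally show "(1 / 3) ^ K / real (m + K) \<le> prob_of (dels (K - 1) b) {a'. L a' = K - 2}" .
  qed simp
  then show ?thesis by (simp add: power_add[symmetric] mult_2)
qed

lemma ac_step_prob_increase:
  assumes a: "a \<in> sized m" "m \<ge> 1" and K: "K \<ge> 1"
  shows "(1 / (3 * (real (L a) + 1))) ^ K \<le> prob_of (ac_step K a) {a'. L a' = L a + (K - 1)}"
proof -
  have "(1 / (real (L a) + 1)) ^ K * (1 / 3) ^ K \<le> prob_of (ac_step K a) {a'. L a' = L a + (K - 1)}"
  proof (rule ac_step_prob_ge[OF a _ prob_adds_outside_ge[OF a]])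
    fix b assume b: "b \<in> sized (m + K)" "b \<in> {a'. L a' = L a}"
    have "(1 / 3) ^ K \<le> (1 / 3 :: real) ^ (K - 1)" by (intro power_decreasing) auto
    also have "\<dots> \<le> prob_of (dels (K - 1) b) {a'. L a' = L b + (K - 1)}"
      using a K by (intro prob_dels_interior_ge[OF b(1)]) auto
    finally show "(1 / 3) ^ K \<le> prob_of (dels (K - 1) b) {a'. L a' = L a + (K - 1)}"
      using b(2) by simp
  qed simp
  then show ?thesis by (simp add: power_mult_distrib[symmetric] mult.commute)
qed

section \<open>The Markov property on path events\<close>

(* Measurability of path events always comes from the explicit lemmas below. *)
declare [[simproc del: measurable]]

context annihilation_creation_process
begin

abbreviation states :: "int set set" where
  "states \<equiv> {a. finite a \<and> a \<noteq> {}}"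

lemma countable_states: "countable states"
  by (rule countable_subset[OF _ countable_Collect_finite]) auto

lemma A_in_states: "\<omega> \<in> space M \<Longrightarrow> A n \<omega> \<in> states"
  using measurable_space[OF measurable_A, of \<omega> n] by simp

lemma measurable_A_Collect: "{\<omega> \<in> space M. A n \<omega> \<in> B} \<in> sets M"
proof -
  have "A n -` (B \<inter> states) \<inter> space M \<in> sets M" by (rule measurable_sets[OF measurable_A]) auto
  moreover have "A n -` (B \<inter> states) \<inter> space M = {\<omega> \<in> space M. A n \<omega> \<in> B}" using A_in_states by auto
  ultimately show ?thesis by simp
qed

lemma cylinder_sets: "{\<omega> \<in> space M. \<forall>i\<le>n. A i \<omega> \<in> C i} \<in> sets M"
proof -
  have "{\<omega> \<in> space M. \<forall>i\<in>{..n}. A i \<omega> \<in> C i} \<in> sets M"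
    by (rule sets.sets_Collect_finite_All[OF measurable_A_Collect]) simp
  then show ?thesis by (simp only: Ball_def atMost_iff)
qed

lemma cylinder_step_sets: "{\<omega> \<in> space M. (\<forall>i\<le>n. A i \<omega> \<in> C i) \<and> A (Suc n) \<omega> \<in> B} \<in> sets M"
  using sets.Int[OF cylinder_sets[of n C] measurable_A_Collect[of "Suc n" B]]
  by (rule back_subst[of "\<lambda>X. X \<in> sets M"]) auto

text \<open>The defining property concerns a single history and a single successor; histories of probability
  zero satisfy the equation trivially.\<close>

lemma history_step:
  "emeasure M {\<omega> \<in> space M. (\<forall>i\<le>n. A i \<omega> = a i) \<and> A (Suc n) \<omega> \<in> B} =
    emeasure M {\<omega> \<in> space M. \<forall>i\<le>n. A i \<omega> = a i} * emeasure (ac_step K (a n)) (B \<inter> states)"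
proof -
  let ?h = "{\<omega> \<in> space M. \<forall>i\<le>n. A i \<omega> = a i}"
  let ?X = "\<lambda>b. {\<omega> \<in> space M. (\<forall>i\<le>n. A i \<omega> = a i) \<and> A (Suc n) \<omega> = b}"
  have Xs: "?X b \<in> sets M" for b using cylinder_step_sets[of n "\<lambda>i. {a i}" "{b}"] by simp
  have X: "emeasure M (?X b) = emeasure M ?h * ennreal (pmf (ac_step K (a n)) b)" for b
  proof (cases "prob ?h > 0")
    case True
    have c: "prob ({\<omega> \<in> space M. A (Suc n) \<omega> = b \<and> (\<forall>i\<le>n. A i \<omega> = a i)}) / prob ?h = pmf (ac_step K (a n)) b"
      using markov[OF True, of b] unfolding cond_prob_def .
    have "{\<omega> \<in> space M. A (Suc n) \<omega> = b \<and> (\<forall>i\<le>n. A i \<omega> = a i)} = ?X b" by auto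
    then have "prob (?X b) = prob ?h * pmf (ac_step K (a n)) b" using c True by (simp add: field_simps)
    then show ?thesis by (simp add: emeasure_eq_measure ennreal_mult)
  next
    case False
    then have h0: "prob ?h = 0" using measure_nonneg[of M ?h] by linarith
    have hs: "?h \<in> sets M" using cylinder_sets[of n "\<lambda>i. {a i}"] by simp
    have "prob (?X b) \<le> prob ?h" using hs by (intro finite_measure_mono) auto
    then have "prob (?X b) = 0" using h0 measure_nonneg[of M "?X b"] by linarith
    then show ?thesis using h0 by (simp add: emeasure_eq_measure)
  qed
  have "{\<omega> \<in> space M. (\<forall>i\<le>n. A i \<omega> = a i) \<and> A (Suc n) \<omega> \<in> B} = (\<Union>b\<in>B \<inter> states. ?X b)"
    using A_in_states by auto
  then have "emeasure M {\<omega> \<in> space M. (\<forall>i\<le>n. A i \<omega> = a i) \<and> A (Suc n) \<omega> \<in> B} = emeasure M (\<Union>b\<in>B \<inter> states. ?X b)"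
    by simp
  also have "\<dots> = (\<integral>\<^sup>+b. emeasure M (?X b) \<partial>count_space (B \<inter> states))"
    using Xs countable_states
    by (intro emeasure_UN_countable) (auto simp: disjoint_family_on_def intro: countable_subset)
  also have "\<dots> = (\<integral>\<^sup>+b. emeasure M ?h * ennreal (pmf (ac_step K (a n)) b) \<partial>count_space (B \<inter> states))"
    by (simp only: X)
  also have "\<dots> = emeasure M ?h * emeasure (ac_step K (a n)) (B \<inter> states)"
    by (simp add: nn_integral_cmult nn_integral_pmf)
  finally show ?thesis .
qed

lemma cylinder_step_ge:
  assumes "p \<ge> 0" "\<And>a. a \<in> C n \<Longrightarrow> a \<in> states \<Longrightarrow> p \<le> prob_of (ac_step K a) (B \<inter> states)"
  shows "p * prob {\<omega> \<in> space M. \<forall>i\<le>n. A i \<omega> \<in> C i} \<le> prob {\<omega> \<in> space M. (\<forall>i\<le>n. A i \<omega> \<in> C i) \<and> A (Suc n) \<omega> \<in> B}"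
proof -
  define I where "I = PiE {..n} (\<lambda>i. C i \<inter> states)"
  have cI: "countable I" unfolding I_def using countable_states by (intro countable_PiE) auto
  let ?h = "\<lambda>a. {\<omega> \<in> space M. \<forall>i\<le>n. A i \<omega> = a i}"
  let ?g = "\<lambda>a. {\<omega> \<in> space M. (\<forall>i\<le>n. A i \<omega> = a i) \<and> A (Suc n) \<omega> \<in> B}"
  have hs: "?h a \<in> sets M" for a using cylinder_sets[of n "\<lambda>i. {a i}"] by simp
  have gs: "?g a \<in> sets M" for a using cylinder_step_sets[of n "\<lambda>i. {a i}" B] by simp
  have mem: "\<exists>a\<in>I. \<omega> \<in> ?h a" if "\<omega> \<in> space M" "\<forall>i\<le>n. A i \<omega> \<in> C i" for \<omega>
    using that A_in_states by (intro bexI[of _ "restrict (\<lambda>i. A i \<omega>) {..n}"]) (auto simp: I_def)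
  have disj: "a = b" if "a \<in> I" "b \<in> I" "\<omega> \<in> ?h a" "\<omega> \<in> ?h b" for a b \<omega>
    using that unfolding I_def by (intro PiE_ext[OF that(1,2)[unfolded I_def]]) auto
  have dh: "disjoint_family_on ?h I" and dg: "disjoint_family_on ?g I"
    unfolding disjoint_family_on_def using disj by blast+
  have Uh: "{\<omega> \<in> space M. \<forall>i\<le>n. A i \<omega> \<in> C i} = (\<Union>a\<in>I. ?h a)"
    using mem by (auto simp: I_def PiE_iff)
  have Ug: "{\<omega> \<in> space M. (\<forall>i\<le>n. A i \<omega> \<in> C i) \<and> A (Suc n) \<omega> \<in> B} = (\<Union>a\<in>I. ?g a)"
    using mem by (auto simp: I_def PiE_iff)
  have "ennreal p * emeasure M {\<omega> \<in> space M. \<forall>i\<le>n. A i \<omega> \<in> C i} = ennreal p * (\<integral>\<^sup>+a. emeasure M (?h a) \<partial>count_space I)"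
    unfolding Uh by (simp only: emeasure_UN_countable[OF hs cI dh])
  also have "\<dots> = (\<integral>\<^sup>+a. ennreal p * emeasure M (?h a) \<partial>count_space I)"
    by (simp add: nn_integral_cmult)
  also have "\<dots> \<le> (\<integral>\<^sup>+a. emeasure M (?g a) \<partial>count_space I)"
  proof (intro nn_integral_mono)
    fix a assume "a \<in> space (count_space I)"
    then have "a n \<in> C n" "a n \<in> states" by (auto simp: I_def PiE_iff)
    then have "ennreal p \<le> emeasure (ac_step K (a n)) (B \<inter> states)"
      using assms(2) by (simp add: measure_pmf.emeasure_eq_measure)
    then show "ennreal p * emeasure M (?h a) \<le> emeasure M (?g a)"
      unfolding history_step by (subst mult.commute, intro mult_left_mono) auto
  qed
  also have "\<dots> = emeasure M {\<omega> \<in> space M. (\<forall>i\<le>n. A i \<omega> \<in> C i) \<and> A (Suc n) \<omega> \<in> B}"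
    unfolding Ug by (simp only: emeasure_UN_countable[OF gs cI dg])
  finally show ?thesis using assms(1) by (simp add: emeasure_eq_measure flip: ennreal_mult)
qed

end

locale started_process = annihilation_creation_process +
  assumes K2: "K \<ge> 2" and start: "AE \<omega> in M. A 0 \<omega> = {0}"
begin

lemma K1: "K \<ge> 1" using K2 by simp

lemma states_ac_step:
  assumes "a \<in> states"
  shows "prob_of (ac_step K a) (B \<inter> states) = prob_of (ac_step K a) B"
proof -
  have a: "a \<in> sized (card a)" "card a \<ge> 1" using assms by (auto simp: sized_def Suc_le_eq card_gt_0_iff)
  have "set_pmf (ac_step K a) \<subseteq> states"
    using ac_step_support(2)[OF a K1] sized_nonempty by (fastforce simp: sized_def)
  then show ?thesis
    by (intro measure_pmf.finite_measure_eq_AE) (auto simp: AE_measure_pmf_iff)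
qed

text \<open>One inequality, for all sets, suffices: applied to the complement it yields the other one.\<close>

lemma prob_A_eq: "prob {\<omega> \<in> space M. A n \<omega> \<in> B} = prob_of (ac_law K n) B"
proof (induction n arbitrary: B)
  case 0
  have "prob {\<omega> \<in> space M. A 0 \<omega> \<in> B} = prob (if {0} \<in> B then space M else {})"
    using start measurable_A_Collect[of 0 B] by (intro finite_measure_eq_AE) auto
  also have "\<dots> = prob_of (ac_law K 0) B"
    by (cases "{0} \<in> B") (auto simp: prob_space prob_eq_expectation)
  finally show ?case .
next
  case (Suc n)
  have ge: "prob_of (ac_law K (Suc n)) B \<le> prob {\<omega> \<in> space M. A (Suc n) \<omega> \<in> B}" for B
  proof -
    define S where "S = set_pmf (ac_law K n)"
    have S: "finite S" "S \<subseteq> states"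
      unfolding S_def using ac_law_support[OF K1] sized_nonempty by (fastforce simp: sized_def)+
    let ?X = "\<lambda>a. {\<omega> \<in> space M. (\<forall>i\<le>n. A i \<omega> \<in> (if i = n then {a} else UNIV)) \<and> A (Suc n) \<omega> \<in> B}"
    have "prob_of (ac_law K (Suc n)) B =
        expect (ac_law K n) (\<lambda>a. prob_of (ac_step K a) B)"
      unfolding prob_eq_expectation by (rule expectation_ac_law_Suc[OF K1])
    also have "\<dots> = (\<Sum>a\<in>S. pmf (ac_law K n) a * prob_of (ac_step K a) B)"
      unfolding S_def using S(1)[unfolded S_def] by (subst integral_measure_pmf[of S]) (auto simp: S_def)
    also have "\<dots> \<le> (\<Sum>a\<in>S. prob (?X a))"
    proof (intro sum_mono)
      fix a assume a: "a \<in> S"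
      have e: "{\<omega> \<in> space M. \<forall>i\<le>n. A i \<omega> \<in> (if i = n then {a} else UNIV)} = {\<omega> \<in> space M. A n \<omega> \<in> {a}}" by auto
      have "prob_of (ac_step K a) B * prob {\<omega> \<in> space M. \<forall>i\<le>n. A i \<omega> \<in> (if i = n then {a} else UNIV)} \<le> prob (?X a)"
        using a S by (intro cylinder_step_ge) (auto simp: states_ac_step)
      then show "pmf (ac_law K n) a * prob_of (ac_step K a) B \<le> prob (?X a)"
        unfolding e Suc by (simp add: measure_pmf_single mult.commute)
    qed
    also have "\<dots> = prob (\<Union>a\<in>S. ?X a)"
    proof (rule finite_measure_finite_Union[OF S(1), symmetric])
      show "?X ` S \<subseteq> sets M" by (intro image_subsetI cylinder_step_sets)
      show "disjoint_family_on ?X S" unfolding disjoint_family_on_def by (auto split: if_splits)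
    qed
    also have "\<dots> \<le> prob {\<omega> \<in> space M. A (Suc n) \<omega> \<in> B}"
      by (intro finite_measure_mono measurable_A_Collect) auto
    finally show ?thesis .
  qed
  have c: "prob {\<omega> \<in> space M. A (Suc n) \<omega> \<in> - B} = 1 - prob {\<omega> \<in> space M. A (Suc n) \<omega> \<in> B}"
  proof -
    have "{\<omega> \<in> space M. A (Suc n) \<omega> \<in> - B} = space M - {\<omega> \<in> space M. A (Suc n) \<omega> \<in> B}" by auto
    then show ?thesis using prob_compl[OF measurable_A_Collect[of "Suc n" B]] by simp
  qed
  have "prob_of (ac_law K (Suc n)) (- B) = 1 - prob_of (ac_law K (Suc n)) B"
    using measure_pmf.prob_compl[of B "ac_law K (Suc n)"] by (simp add: Compl_eq_Diff_UNIV)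
  then show ?case using ge[of B] ge[of "- B"] c by linarith
qed

lemma AE_sized: "AE \<omega> in M. A n \<omega> \<in> sized (Suc n)"
proof -
  have "prob {\<omega> \<in> space M. A n \<omega> \<in> sized (Suc n)} = 1"
    unfolding prob_A_eq using ac_law_support(2)[OF K1] by (intro measure_pmf.prob_eq_1[THEN iffD2]) (auto simp: AE_measure_pmf_iff)
  then have "AE \<omega> in M. \<omega> \<in> {\<omega> \<in> space M. A n \<omega> \<in> sized (Suc n)}"
    using prob_eq_1[OF measurable_A_Collect] by blast
  then show ?thesis by eventually_elim auto
qed

lemma cylinder_step_sized_ge:
  assumes "p \<ge> 0" "\<And>a. a \<in> C n \<Longrightarrow> a \<in> sized (Suc n) \<Longrightarrow> p \<le> prob_of (ac_step K a) B"
  shows "p * prob {\<omega> \<in> space M. \<forall>i\<le>n. A i \<omega> \<in> C i} \<le> prob {\<omega> \<in> space M. (\<forall>i\<le>n. A i \<omega> \<in> C i) \<and> A (Suc n) \<omega> \<in> B}"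
proof -
  define C' where "C' = C(n := C n \<inter> sized (Suc n))"
  have e1: "prob {\<omega> \<in> space M. \<forall>i\<le>n. A i \<omega> \<in> C i} = prob {\<omega> \<in> space M. \<forall>i\<le>n. A i \<omega> \<in> C' i}"
    using AE_sized[of n] by (intro finite_measure_eq_AE cylinder_sets) (auto simp: C'_def)
  have e2: "prob {\<omega> \<in> space M. (\<forall>i\<le>n. A i \<omega> \<in> C i) \<and> A (Suc n) \<omega> \<in> B} =
      prob {\<omega> \<in> space M. (\<forall>i\<le>n. A i \<omega> \<in> C' i) \<and> A (Suc n) \<omega> \<in> B}"
    using AE_sized[of n] by (intro finite_measure_eq_AE cylinder_step_sets) (auto simp: C'_def)
  show ?thesis unfolding e1 e2
    using assms by (intro cylinder_step_ge) (auto simp: C'_def states_ac_step)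
qed

definition avoids :: "nat \<Rightarrow> int set set \<Rightarrow> nat \<Rightarrow> 'a set" where
  "avoids m H k = {\<omega> \<in> space M. \<forall>i\<le>k. m \<le> i \<longrightarrow> A i \<omega> \<notin> H}"

lemma avoids_alt: "avoids m H k = {\<omega> \<in> space M. \<forall>i\<le>k. A i \<omega> \<in> (if m \<le> i then - H else UNIV)}"
  unfolding avoids_def by auto

lemma avoids_sets: "avoids m H k \<in> sets M"
  unfolding avoids_alt by (rule cylinder_sets)

lemma avoids_Int_sets: "{\<omega> \<in> avoids m H k. A j \<omega> \<in> G} \<in> sets M"
  using sets.Int[OF avoids_sets[of m H k] measurable_A_Collect[of j G]]
  by (rule back_subst[of "\<lambda>X. X \<in> sets M"]) (auto simp: avoids_def)

lemma avoids_step_ge: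
  assumes "p \<ge> 0" "m \<le> k"
    "\<And>a. a \<in> G \<Longrightarrow> a \<notin> H \<Longrightarrow> a \<in> sized (Suc k) \<Longrightarrow> p \<le> prob_of (ac_step K a) B"
  shows "p * prob {\<omega> \<in> avoids m H k. A k \<omega> \<in> G} \<le> prob {\<omega> \<in> avoids m H k. A (Suc k) \<omega> \<in> B}"
proof -
  let ?C = "\<lambda>i. if i = k then G - H else if m \<le> i then - H else UNIV"
  have e: "{\<omega> \<in> avoids m H k. A k \<omega> \<in> G} = {\<omega> \<in> space M. \<forall>i\<le>k. A i \<omega> \<in> ?C i}"
    using assms(2) by (auto simp: avoids_def split: if_splits)
  have "p * prob {\<omega> \<in> avoids m H k. A k \<omega> \<in> G} \<le>
      prob {\<omega> \<in> space M. (\<forall>i\<le>k. A i \<omega> \<in> ?C i) \<and> A (Suc k) \<omega> \<in> B}"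
    unfolding e using assms by (intro cylinder_step_sized_ge) auto
  also have "\<dots> \<le> prob {\<omega> \<in> avoids m H k. A (Suc k) \<omega> \<in> B}"
    using assms(2) by (intro finite_measure_mono avoids_Int_sets) (auto simp: avoids_def split: if_splits)
  finally show ?thesis .
qed

text \<open>Consider paths that start in \<open>G 0\<close> at time \<open>k\<close> and stay in \<open>G i\<close> at time \<open>k + i\<close> until they hit \<open>H\<close>. By induction on \<open>i\<close>, the event
  that \<open>H\<close> was hit after time \<open>k\<close>, or was avoided with the path in \<open>G i\<close> at time \<open>k + i\<close>, has
  probability at least the product of the \<open>p\<close>s times that of the start; at time \<open>k + j\<close> the second alternative is
  impossible.\<close>

lemma avoids_block:
  assumes mk: "m \<le> k" and p: "\<And>i. i < j \<Longrightarrow> 0 \<le> p i \<and> p i \<le> 1" and G: "G j \<subseteq> H"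
    and step: "\<And>i a. i < j \<Longrightarrow> a \<in> G i \<Longrightarrow> a \<notin> H \<Longrightarrow> a \<in> sized (Suc (k + i)) \<Longrightarrow>
      p i \<le> prob_of (ac_step K a) (G (Suc i))"
  shows "(\<Prod>i<j. p i) * prob {\<omega> \<in> avoids m H k. A k \<omega> \<in> G 0} \<le> prob (avoids m H k) - prob (avoids m H (k + j))"
proof -
  let ?N = "\<lambda>i. prob (avoids m H (k + i))"
  let ?v = "\<lambda>i. prob {\<omega> \<in> avoids m H (k + i). A (k + i) \<omega> \<in> G i}"
  have mono: "?N i \<le> ?N 0" for i
    by (intro finite_measure_mono avoids_sets) (auto simp: avoids_def)
  have "i \<le> j \<Longrightarrow> (\<Prod>i<i. p i) * ?v 0 \<le> ?N 0 - ?N i + ?v i" for i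
  proof (induction i)
    case (Suc i)
    let ?q = "prob {\<omega> \<in> avoids m H (k + i). A (Suc (k + i)) \<omega> \<in> G (Suc i)}"
    have pi: "0 \<le> p i" "p i \<le> 1" using p[of i] Suc.prems by auto
    have q: "p i * ?v i \<le> ?q"
      using pi mk step[of i] Suc.prems by (intro avoids_step_ge) auto
    have sub: "?q \<le> ?v (Suc i) + (?N i - ?N (Suc i))"
    proof -
      have "?q \<le> prob ({\<omega> \<in> avoids m H (k + Suc i). A (k + Suc i) \<omega> \<in> G (Suc i)} \<union> (avoids m H (k + i) - avoids m H (k + Suc i)))"
        by (intro finite_measure_mono sets.Un sets.Diff avoids_sets avoids_Int_sets) (auto simp: avoids_def)
      also have "\<dots> \<le> ?v (Suc i) + prob (avoids m H (k + i) - avoids m H (k + Suc i))"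
        by (intro measure_Un_le sets.Diff avoids_sets avoids_Int_sets)
      also have "prob (avoids m H (k + i) - avoids m H (k + Suc i)) = ?N i - ?N (Suc i)"
        by (intro finite_measure_Diff avoids_sets) (auto simp: avoids_def)
      finally show ?thesis .
    qed
    have "(\<Prod>i<Suc i. p i) * ?v 0 = p i * ((\<Prod>i<i. p i) * ?v 0)" by (simp add: mult_ac)
    also have "\<dots> \<le> p i * (?N 0 - ?N i + ?v i)" using Suc pi by (intro mult_left_mono) auto
    also have "\<dots> = p i * (?N 0 - ?N i) + p i * ?v i" by (simp add: distrib_left)
    also have "\<dots> \<le> 1 * (?N 0 - ?N i) + p i * ?v i" using pi mono[of i] by (intro add_right_mono mult_right_mono) auto
    also have "\<dots> \<le> ?N 0 - ?N (Suc i) + ?v (Suc i)"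
    proof -
      have "1 * (n0 - ni) + s \<le> n0 - n1 + w" if "s \<le> r" "r \<le> w + (ni - n1)" for n0 ni n1 s r w :: real
        using order_trans[OF that] by (simp add: algebra_simps)
      from this[OF q sub] show ?thesis .
    qed
    finally show ?case .
  qed simp
  from this[of j] have "(\<Prod>i<j. p i) * ?v 0 \<le> ?N 0 - ?N j + ?v j" by simp
  moreover have "{\<omega> \<in> avoids m H (k + j). A (k + j) \<omega> \<in> G j} = {}" using G mk by (auto simp: avoids_def)
  ultimately show ?thesis by simp
qed

end

section \<open>Almost sure limits\<close>

lemma h_mono:
  assumes "exp 1 \<le> ln (real n)" "n \<le> m"
  shows "h n \<le> h m"
proof -
  define s t where "s = ln (real n)" and "t = ln (real m)"
  have n: "real n > 0"
  proof (rule ccontr)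
    assume "\<not> real n > 0"
    then have "n = 0" by simp
    then have "ln (real n) = 0" by simp
    then show False using assms(1) exp_gt_zero[of "1::real"] by linarith
  qed
  have s: "exp 1 \<le> s" "s \<le> t" using assms n by (auto simp: s_def t_def)
  have s0: "s > 0" "t > 0" using s exp_gt_zero[of "1::real"] by linarith+
  have ls: "ln s \<ge> 1" using s s0 by (subst ln_ge_iff) auto
  have lt: "ln s \<le> ln t" using s s0 by simp
  have "ln t - ln s = ln (t / s)" using s0 by (simp add: ln_div)
  also have "\<dots> \<le> t / s - 1" using s0 by (intro ln_le_minus_one) auto
  finally have "s * (ln t - ln s) \<le> s * (t / s - 1)" using s0 by (intro mult_left_mono) auto
  then have 1: "s * ln t - s * ln s \<le> t - s" using s0 by (simp add: right_diff_distrib)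
  have "(t - s) * 1 \<le> (t - s) * ln s" using ls s by (intro mult_left_mono) auto
  then have "s * ln t \<le> t * ln s" using 1 by (simp add: algebra_simps)
  then have "s / ln s \<le> t / ln t" using ls lt by (simp add: divide_le_eq pos_le_divide_eq field_simps)
  then show ?thesis by (simp add: h_def s_def t_def)
qed

lemma L_tight:
  assumes K: "K \<ge> 1" and "\<epsilon> > 0"
  shows "\<exists>v. \<forall>n. prob_of (ac_law K n) {a. v < L a} \<le> \<epsilon>"
proof -
  obtain \<theta> B where th: "\<theta> > 0" and
    B: "\<And>n. expect (ac_law K n) (\<lambda>a. exp (\<theta> * real (L a))) \<le> B"
    using exp_moment_bounded[OF K] by blast
  have "((\<lambda>v. B * exp (- \<theta> * real v)) \<longlongrightarrow> 0) sequentially"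
    using th by real_asymp
  then have "\<forall>\<^sub>F v in sequentially. B * exp (- \<theta> * real v) < \<epsilon>"
    using assms(2) by (rule order_tendstoD(2))
  then obtain v where v: "B * exp (- \<theta> * real v) < \<epsilon>" by (auto simp: eventually_sequentially)
  have "prob_of (ac_law K n) {a. v < L a} \<le> \<epsilon>" for n
  proof -
    have "exp (\<theta> * real v) * prob_of (ac_law K n) {a. v < L a} =
      expect (ac_law K n) (\<lambda>a. exp (\<theta> * real v) * (if a \<in> {a. v < L a} then 1 else 0))"
      unfolding prob_eq_expectation by simp
    also have "\<dots> \<le> expect (ac_law K n) (\<lambda>a. exp (\<theta> * real (L a)))"
      using th by (intro expectation_mono_finite[OF ac_law_support(1)[OF K]]) auto
    also have "\<dots> \<le> B" by (rule B)
    finally have "exp (- \<theta> * real v) * (exp (\<theta> * real v) * prob_of (ac_law K n) {a. v < L a}) \<le> exp (- \<theta> * real v) * B"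
      by (intro mult_left_mono) auto
    then have "prob_of (ac_law K n) {a. v < L a} \<le> B * exp (- \<theta> * real v)"
      by (simp add: mult.assoc[symmetric] mult_exp_exp mult.commute)
    then show ?thesis using v by linarith
  qed
  then show ?thesis by blast
qed

context started_process
begin

lemma AE_L_ge: "AE \<omega> in M. \<forall>\<^sub>F n in sequentially. K \<le> L (A n \<omega>) + 2"
proof -
  let ?B = "{a. L a + 2 < K}"
  let ?X = "\<lambda>n. {\<omega> \<in> space M. A n \<omega> \<in> ?B}"
  have "summable (\<lambda>n. prob (?X (Suc n)))"
  proof (rule summable_comparison_test)
    show "summable (\<lambda>n. 3 * (real K)\<^sup>2 * inverse (real (n + 2) ^ 2))"
      using summable_ignore_initial_segment[OF inverse_power_summable[of 2, where 'a = real], of 2]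
      by (intro summable_mult) simp
    have "prob (?X (Suc n)) \<le> 3 * (real K)\<^sup>2 * inverse (real (n + 2) ^ 2)" for n
    proof -
      have "prob (?X (Suc n)) = expect (ac_law K n) (\<lambda>a. prob_of (ac_step K a) ?B)"
        unfolding prob_A_eq unfolding prob_eq_expectation by (rule expectation_ac_law_Suc[OF K1])
      also have "\<dots> \<le> expect (ac_law K n) (\<lambda>_. 3 * (real K / real (Suc n + 1))\<^sup>2)"
        by (intro expectation_mono_finite ac_law_support(1)[OF K1] ac_step_prob_L_small[OF _ _ K1] ac_law_support(2)[OF K1]) auto
      finally show ?thesis by (simp add: divide_inverse power_mult_distrib power_inverse mult.assoc)
    qed
    then show "\<exists>N. \<forall>n\<ge>N. norm (prob (?X (Suc n))) \<le> 3 * (real K)\<^sup>2 * inverse (real (n + 2) ^ 2)" by simp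
  qed
  then have "summable (\<lambda>n. prob (?X n))" by (subst (asm) summable_Suc_iff)
  then have "AE \<omega> in M. \<forall>\<^sub>F n in sequentially. \<omega> \<in> space M - ?X n"
    by (intro borel_cantelli_AE1 measurable_A_Collect) (auto simp: emeasure_eq_measure)
  then show ?thesis
    by eventually_elim (auto elim!: eventually_mono)
qed

lemma AE_L_upper:
  assumes "\<delta> > 0"
  shows "AE \<omega> in M. \<forall>\<^sub>F n in sequentially. real (L (A n \<omega>)) < (1 + \<delta>) * ((real K - 1) / real K) * h n"
proof -
  let ?B = "\<lambda>n. {a. (1 + \<delta>) * ((real K - 1) / real K) * h n \<le> real (L a)}"
  let ?X = "\<lambda>n. {\<omega> \<in> space M. A n \<omega> \<in> ?B n}"
  obtain C \<epsilon> where eps: "\<epsilon> > 0" and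
    C: "\<forall>\<^sub>F n in sequentially. prob_of (ac_law K n) (?B n) \<le> C * real n powr (- 1 - \<epsilon>)"
    using L_upper_tail[OF K2 assms] by blast
  have "summable (\<lambda>n. prob (?X n))"
  proof (rule summable_comparison_test_ev)
    show "summable (\<lambda>n. C * real n powr (- 1 - \<epsilon>))"
      using eps by (intro summable_mult) (simp add: summable_real_powr_iff)
    show "\<forall>\<^sub>F n in sequentially. norm (prob (?X n)) \<le> C * real n powr (- 1 - \<epsilon>)"
      using C unfolding prob_A_eq by simp
  qed
  then have "AE \<omega> in M. \<forall>\<^sub>F n in sequentially. \<omega> \<in> space M - ?X n"
    by (intro borel_cantelli_AE1 measurable_A_Collect) (auto simp: emeasure_eq_measure)
  then show ?thesis
    by eventually_elim (auto elim!: eventually_mono)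
qed

text \<open>Passing to measurable supersets avoids proving that the tail events themselves are
  measurable.\<close>

lemma AE_not_in_small:
  assumes "\<And>\<epsilon>. \<epsilon> > 0 \<Longrightarrow> \<exists>S \<in> sets M. X \<subseteq> S \<and> prob S \<le> \<epsilon>"
  shows "AE \<omega> in M. \<omega> \<notin> X"
proof -
  have "\<forall>n. \<exists>S. S \<in> sets M \<and> X \<subseteq> S \<and> prob S \<le> 1 / real (Suc n)"
  proof (rule allI)
    fix n
    have "1 / real (Suc n) > 0" by simp
    from assms[OF this] show "\<exists>S. S \<in> sets M \<and> X \<subseteq> S \<and> prob S \<le> 1 / real (Suc n)" by blast
  qed
  then obtain S where S: "\<And>n. S n \<in> sets M" "\<And>n. X \<subseteq> S n" "\<And>n. prob (S n) \<le> 1 / real (Suc n)" by metis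
  let ?T = "\<Inter>n. S n"
  have T: "?T \<in> sets M" using S(1) by (intro sets.countable_INT) auto
  have "prob ?T \<le> 1 / real (Suc n)" for n
    by (rule order_trans[OF finite_measure_mono S(3)]) (auto simp: S(1))
  then have "prob ?T \<le> 0"
    by (intro LIMSEQ_le_const[OF LIMSEQ_inverse_real_of_nat]) (auto simp: inverse_eq_divide)
  then have "prob ?T = 0" by (rule antisym) (rule measure_nonneg)
  then have "emeasure M ?T = 0" by (simp add: emeasure_eq_measure)
  then have "?T \<in> null_sets M" using T by auto
  then show ?thesis using S(2) by (intro AE_I') auto
qed

text \<open>If the probability of avoiding \<open>L = K - 2\<close> stayed above \<open>\<epsilon>\<close>, then by tightness \<open>L \<le> v\<close> would hold
  with probability at least \<open>\<epsilon> / 2\<close> on the avoiding paths at each time. From such a state \<open>v\<close> steps bring \<open>L\<close>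
  below \<open>K\<close> and one more step reaches \<open>K - 2\<close>, so each block of \<open>v + 1\<close> steps lowers the avoidance probability
  by at least a multiple of the reciprocal of the time, which cannot go on forever.\<close>

lemma AE_frequently_L_minimal: "AE \<omega> in M. \<exists>\<^sub>F n in sequentially. L (A n \<omega>) = K - 2"
proof -
  define H where "H = {a. L a = K - 2}"
  have "AE \<omega> in M. \<omega> \<notin> {\<omega> \<in> space M. \<forall>i\<ge>m. A i \<omega> \<notin> H}" for m
  proof (rule AE_not_in_small)
    fix \<epsilon> :: real assume eps: "\<epsilon> > 0"
    have "\<exists>k. prob (avoids m H k) \<le> \<epsilon>"
    proof (rule ccontr)
      assume "\<not> ?thesis"
      then have big: "prob (avoids m H k) > \<epsilon>" for k by (simp add: not_le)
      obtain v where v: "\<And>n. prob_of (ac_law K n) {a. v < L a} \<le> \<epsilon> / 2"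
        using L_tight[OF K1, of "\<epsilon> / 2"] eps by auto
      \<comment> \<open>A favourable step lowers \<open>L\<close> by one, until it is at most \<open>K - 1\<close>; the last step produces \<open>K - 2\<close>.\<close>
      define G where "G = (\<lambda>i. if i \<le> v then {a. L a \<le> max (K - 1) (v - i)} else H)"
      define c where "c = ((1 / 3) ^ K) ^ v * (1 / 3) ^ (2 * K) * (\<epsilon> / 2)"
      have c: "c > 0" using eps by (simp add: c_def)
      have drop: "c / real (k + v + 1 + K) \<le> prob (avoids m H k) - prob (avoids m H (k + Suc v))" if k: "m \<le> k" for k
      proof -
        define p where "p = (\<lambda>i. if i < v then (1 / 3) ^ K else (1 / 3) ^ (2 * K) / real (k + v + 1 + K))"
        have "(\<Prod>i<Suc v. p i) * prob {\<omega> \<in> avoids m H k. A k \<omega> \<in> G 0} \<le> prob (avoids m H k) - prob (avoids m H (k + Suc v))"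
        proof (rule avoids_block[OF k])
          fix i assume "i < Suc v"
          have "(1 / 3 :: real) ^ (2 * K) \<le> 1" by (intro power_le_one) auto
          then have "(1 / 3 :: real) ^ (2 * K) / real (k + v + 1 + K) \<le> 1 / 1"
            by (intro frac_le) auto
          then show "0 \<le> p i \<and> p i \<le> 1" by (auto simp: p_def power_le_one)
        next
          show "G (Suc v) \<subseteq> H" by (simp add: G_def)
        next
          fix i a assume i: "i < Suc v" and a: "a \<in> G i" "a \<in> sized (Suc (k + i))"
          have La: "L a \<le> max (K - 1) (v - i)" using a(1) i by (simp add: G_def)
          show "p i \<le> prob_of (ac_step K a) (G (Suc i))"
          proof (cases "i < v")
            case True
            have sub: "{a'. L a' \<le> (L a - K) + (K - 1)} \<subseteq> G (Suc i)"
              using La True K2 by (auto simp: G_def)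
            have "p i \<le> prob_of (ac_step K a) {a'. L a' \<le> (L a - K) + (K - 1)}"
              using ac_step_prob_decrease[OF a(2) _ K1] True by (simp add: p_def)
            also have "\<dots> \<le> prob_of (ac_step K a) (G (Suc i))"
              using sub by (intro measure_pmf.finite_measure_mono) auto
            finally show ?thesis .
          next
            case False
            then have iv: "i = v" using i by simp
            have "L a \<le> K" using La iv by simp
            then have "(1 / 3) ^ (2 * K) / real (Suc (k + i) + K) \<le> prob_of (ac_step K a) {a'. L a' = K - 2}"
              by (intro ac_step_prob_minimal[OF a(2) _ K2]) auto
            then show ?thesis using iv by (simp add: p_def G_def H_def add_ac)
          qed
        qed
        moreover have "\<epsilon> / 2 \<le> prob {\<omega> \<in> avoids m H k. A k \<omega> \<in> G 0}"
        proof -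
          have "prob (avoids m H k) \<le> prob ({\<omega> \<in> avoids m H k. A k \<omega> \<in> G 0} \<union> {\<omega> \<in> space M. A k \<omega> \<in> {a. v < L a}})"
            by (intro finite_measure_mono sets.Un avoids_Int_sets measurable_A_Collect) (auto simp: avoids_def G_def)
          also have "\<dots> \<le> prob {\<omega> \<in> avoids m H k. A k \<omega> \<in> G 0} + prob {\<omega> \<in> space M. A k \<omega> \<in> {a. v < L a}}"
            by (intro measure_Un_le avoids_Int_sets measurable_A_Collect)
          also have "prob {\<omega> \<in> space M. A k \<omega> \<in> {a. v < L a}} \<le> \<epsilon> / 2" unfolding prob_A_eq by (rule v)
          finally show ?thesis using big[of k] by simp
        qed
        moreover have "(\<Prod>i<Suc v. p i) = ((1 / 3) ^ K) ^ v * ((1 / 3) ^ (2 * K) / real (k + v + 1 + K))"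
          by (simp add: p_def)
        ultimately have "((1 / 3) ^ K) ^ v * ((1 / 3) ^ (2 * K) / real (k + v + 1 + K)) * (\<epsilon> / 2) \<le>
            prob (avoids m H k) - prob (avoids m H (k + Suc v))"
          by (smt (verit) divide_nonneg_nonneg mult_left_mono mult_nonneg_nonneg of_nat_0_le_iff zero_le_power zero_le_divide_1_iff)
        moreover have "r * (s / x) * e = r * s * e / x" for r s x e :: real by simp
        ultimately show ?thesis by (simp only: c_def)
      qed
      define d where "d = (\<lambda>t. prob (avoids m H (m + t * Suc v)))"
      define D where "D = real (m + v + 1 + K + Suc v)"
      have D: "D > 0" by (simp add: D_def)
      have dd: "c / D * inverse (real (Suc t)) \<le> d t - d (Suc t)" for t
      proof -
        have e: "m + Suc t * Suc v = m + t * Suc v + Suc v" by simp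
        have "real (m + t * Suc v + v + 1 + K) \<le> D * real (Suc t)"
        proof -
          have "m + t * Suc v + v + 1 + K \<le> (m + v + 1 + K + Suc v) * Suc t" by (simp add: algebra_simps)
          then show ?thesis unfolding D_def of_nat_mult[symmetric] by (simp only: of_nat_le_iff)
        qed
        moreover have "0 < real (m + t * Suc v + v + 1 + K)" by (simp only: of_nat_0_less_iff)
        moreover have "0 < D * real (Suc t)" using D by simp
        ultimately have "c / (D * real (Suc t)) \<le> c / real (m + t * Suc v + v + 1 + K)"
          using c D by (intro divide_left_mono mult_pos_pos) simp_all
        also have "\<dots> \<le> d t - d (Suc t)" unfolding d_def e by (rule drop) simp
        finally show ?thesis by (simp add: divide_inverse)
      qed
      have "decseq d"
      proof (rule decseq_SucI)
        fix t
        have "0 \<le> c / D * inverse (real (Suc t))" using c D by simp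
        then show "d (Suc t) \<le> d t" using dd[of t] by linarith
      qed
      then obtain l where "d \<longlonglongrightarrow> l" using decseq_convergent[of d 0] by (auto simp: d_def)
      then have "summable (\<lambda>t. d t - d (Suc t))" by (rule telescope_summable')
      then have "summable (\<lambda>t. c / D * inverse (real (Suc t)))"
      proof (rule summable_comparison_test[rotated], intro exI allI impI)
        fix t
        have "0 \<le> c / D * inverse (real (Suc t))" using c D by simp
        then show "norm (c / D * inverse (real (Suc t))) \<le> d t - d (Suc t)" using dd[of t] by simp
      qed
      then have "summable (\<lambda>t. inverse (real (Suc t)))" using c D by (subst (asm) summable_cmult_iff) auto
      then have "summable (\<lambda>t. inverse (real t))" by (subst (asm) summable_Suc_iff)
      then show False using not_summable_harmonic[where 'a = real] by simp
    qed
    then obtain k where "prob (avoids m H k) \<le> \<epsilon>" by blast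
    then show "\<exists>S \<in> sets M. {\<omega> \<in> space M. \<forall>i\<ge>m. A i \<omega> \<notin> H} \<subseteq> S \<and> prob S \<le> \<epsilon>"
      by (intro bexI[of _ "avoids m H k"] conjI avoids_sets) (auto simp: avoids_def)
  qed
  then have "AE \<omega> in M. \<forall>m. \<omega> \<notin> {\<omega> \<in> space M. \<forall>i\<ge>m. A i \<omega> \<notin> H}" by (subst AE_all_countable) blast
  with AE_space show ?thesis
  proof eventually_elim
    case (elim \<omega>)
    then have "\<exists>i\<ge>m. L (A i \<omega>) = K - 2" for m by (auto simp: H_def)
    then show ?case by (auto simp: frequently_sequentially)
  qed
qed

text \<open>Below level \<open>x\<close> each step raises \<open>L\<close> by \<open>K - 1\<close> with probability at least
  \<open>(1 / (3 * (x + 1))) ^ K\<close>, and \<open>j\<close> such steps in a row lead to level \<open>x\<close> from any state.\<close>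

lemma prob_avoids_high_level_le:
  fixes x :: real
  assumes x: "x > 0" and j: "x \<le> real (j * (K - 1))"
  shows "prob (avoids N {a. x \<le> real (L a)} (N + t * j)) \<le> (1 - (1 / (3 * (x + 1))) ^ (K * j)) ^ t"
proof (induction t)
  case 0
  then show ?case by simp
next
  case (Suc t)
  let ?H = "{a. x \<le> real (L a)}"
  let ?p = "(1 / (3 * (x + 1))) ^ K"
  let ?k = "N + t * j"
  have q1: "1 / (3 * (x + 1)) \<le> 1" using x by simp
  have p: "0 \<le> ?p" "?p \<le> 1" using x q1 by (auto intro!: power_le_one)
  have "(\<Prod>i<j. ?p) * prob {\<omega> \<in> avoids N ?H ?k. A ?k \<omega> \<in> {a. 0 * (K - 1) \<le> L a}} \<le>
      prob (avoids N ?H ?k) - prob (avoids N ?H (?k + j))"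
  proof (rule avoids_block[where G = "\<lambda>i. {a. i * (K - 1) \<le> L a}"])
    show "{a. j * (K - 1) \<le> L a} \<subseteq> ?H"
    proof
      fix a assume "a \<in> {a. j * (K - 1) \<le> L a}"
      then have "real (j * (K - 1)) \<le> real (L a)" by (simp only: mem_Collect_eq of_nat_le_iff)
      then show "a \<in> ?H" using j by simp
    qed
    fix i a assume a: "a \<in> {a. i * (K - 1) \<le> L a}" "a \<notin> ?H" "a \<in> sized (Suc (?k + i))"
    have "?p \<le> (1 / (3 * (real (L a) + 1))) ^ K"
      using a(2) x by (intro power_mono divide_left_mono) auto
    also have "\<dots> \<le> prob_of (ac_step K a) {a'. L a' = L a + (K - 1)}"
      by (rule ac_step_prob_increase[OF a(3) _ K1]) simp
    also have "\<dots> \<le> prob_of (ac_step K a) {a. Suc i * (K - 1) \<le> L a}"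
      using a(1) by (intro measure_pmf.finite_measure_mono) auto
    finally show "?p \<le> prob_of (ac_step K a) {a. Suc i * (K - 1) \<le> L a}" .
  qed (use p in auto)
  moreover have "{\<omega> \<in> avoids N ?H ?k. A ?k \<omega> \<in> {a. 0 * (K - 1) \<le> L a}} = avoids N ?H ?k" by auto
  moreover have "(\<Prod>i<j. ?p) = (1 / (3 * (x + 1))) ^ (K * j)" by (simp add: power_mult)
  ultimately have 1: "(1 / (3 * (x + 1))) ^ (K * j) * prob (avoids N ?H ?k) \<le> prob (avoids N ?H ?k) - prob (avoids N ?H (?k + j))"
    by simp
  have le1: "(1 / (3 * (x + 1))) ^ (K * j) \<le> 1" using x q1 by (intro power_le_one) auto
  have e: "N + Suc t * j = ?k + j" by simp
  have "prob (avoids N ?H (?k + j)) \<le> (1 - (1 / (3 * (x + 1))) ^ (K * j)) * prob (avoids N ?H ?k)"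
    using 1 by (simp add: left_diff_distrib)
  also have "\<dots> \<le> (1 - (1 / (3 * (x + 1))) ^ (K * j)) * (1 - (1 / (3 * (x + 1))) ^ (K * j)) ^ t"
    using Suc le1 by (intro mult_left_mono) auto
  finally show ?case unfolding e by simp
qed

text \<open>The level is taken at time \<open>2 * N\<close>, where \<open>h\<close> is largest on the interval from \<open>N\<close> to \<open>2 * N\<close>. A block of \<open>j\<close> steps
  succeeds with probability \<open>?P \<ge> N powr (- (1 - \<epsilon> / 2))\<close>, because \<open>K * j\<close> times the logarithm of the level is about
  \<open>(1 - \<epsilon>) * ln N\<close>; there are about \<open>N / j\<close> blocks.\<close>

lemma AE_frequently_L_ge:
  assumes eps: "0 < \<epsilon>" "\<epsilon> < 1"
  defines "\<beta> \<equiv> (1 - \<epsilon>) * ((real K - 1) / real K)"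
  shows "AE \<omega> in M. \<exists>\<^sub>F n in sequentially. \<beta> * h n \<le> real (L (A n \<omega>))"
proof -
  have KK: "real K - 1 > 0" "real (K - 1) = real K - 1" using K2 by auto
  have beta: "\<beta> > 0" using eps KK by (simp add: \<beta>_def)
  define \<kappa> where "\<kappa> = real K / (real K - 1)"
  have kappa: "\<kappa> > 0" "\<kappa> * \<beta> = 1 - \<epsilon>" using KK by (auto simp: \<kappa>_def \<beta>_def)
  have lim: "((\<lambda>N. (\<kappa> * (\<beta> * h (2 * N)) + real K) * ln (3 * (\<beta> * h (2 * N) + 1)) / ln (real N)) \<longlongrightarrow> \<kappa> * \<beta>) sequentially"
    unfolding h_def using beta kappa(1) by real_asymp
  have "\<kappa> * \<beta> < 1 - \<epsilon> / 2" using kappa eps by simp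
  note ev1 = order_tendstoD(2)[OF lim this]
  have ev2: "filterlim (\<lambda>N. real N powr (- (1 - \<epsilon> / 2)) * (real N / (\<beta> * h (2 * N) / (real K - 1) + 1) - 1)) at_top sequentially"
    unfolding h_def using beta KK(1) eps by real_asymp
  have ev3: "\<forall>\<^sub>F N in sequentially. exp 1 \<le> ln (real N)" by real_asymp
  have ev4: "\<forall>\<^sub>F N in sequentially. \<beta> * h (2 * N) \<ge> 1" unfolding h_def using beta by real_asymp
  have "AE \<omega> in M. \<omega> \<notin> {\<omega> \<in> space M. \<forall>i\<ge>m. real (L (A i \<omega>)) < \<beta> * h i}" for m
  proof (rule AE_not_in_small)
    fix \<eta> :: real assume eta: "\<eta> > 0"
    have "\<forall>\<^sub>F N in sequentially. - ln \<eta> \<le> real N powr (- (1 - \<epsilon> / 2)) * (real N / (\<beta> * h (2 * N) / (real K - 1) + 1) - 1)"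
      using ev2 by (simp add: filterlim_at_top)
    then have "\<forall>\<^sub>F N in sequentially. N \<ge> m \<and> N > 1 \<and> exp 1 \<le> ln (real N) \<and> \<beta> * h (2 * N) \<ge> 1 \<and>
       - ln \<eta> \<le> real N powr (- (1 - \<epsilon> / 2)) * (real N / (\<beta> * h (2 * N) / (real K - 1) + 1) - 1) \<and>
       (\<kappa> * (\<beta> * h (2 * N)) + real K) * ln (3 * (\<beta> * h (2 * N) + 1)) / ln (real N) < 1 - \<epsilon> / 2"
      using ev1 ev3 ev4 eventually_ge_at_top[of m] eventually_gt_at_top[of 1] by eventually_elim auto
    then obtain N where N: "N \<ge> m" "N > 1" "exp 1 \<le> ln (real N)" "\<beta> * h (2 * N) \<ge> 1"
       "- ln \<eta> \<le> real N powr (- (1 - \<epsilon> / 2)) * (real N / (\<beta> * h (2 * N) / (real K - 1) + 1) - 1)"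
       "(\<kappa> * (\<beta> * h (2 * N)) + real K) * ln (3 * (\<beta> * h (2 * N) + 1)) / ln (real N) < 1 - \<epsilon> / 2"
      unfolding eventually_sequentially by blast
    define x where "x = \<beta> * h (2 * N)"
    define y where "y = x / (real K - 1) + 1"
    define j where "j = nat \<lceil>x / (real K - 1)\<rceil>"
    define t where "t = N div j"
    let ?H = "{a. x \<le> real (L a)}"
    have x: "x \<ge> 1" using N by (simp add: x_def)
    have xk: "x / (real K - 1) > 0" using x KK by simp
    have j: "x / (real K - 1) \<le> real j" "real j \<le> y" "j > 0" using xk by (auto simp: j_def y_def)
    have y: "y > 0" using j by linarith
    have jx: "x \<le> real (j * (K - 1))" using j(1) KK by (simp add: pos_divide_le_eq)
    have tN: "t * j \<le> N" by (simp add: t_def)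
    have "real N / real j - 1 \<le> real t"
    proof -
      have "N < j + t * j" unfolding t_def by (rule dividend_less_div_times[OF j(3)])
      then have "real N < real (j + t * j)" by (simp only: of_nat_less_iff)
      then have "real N < (1 + real t) * real j" by (simp add: algebra_simps)
      then have "real N / real j < 1 + real t" using j(3) by (simp add: pos_divide_less_eq)
      then show ?thesis by linarith
    qed
    moreover have "real N / y \<le> real N / real j" using j y by (intro divide_left_mono) auto
    ultimately have t: "real N / y - 1 \<le> real t" by linarith
    let ?P = "(1 / (3 * (x + 1))) ^ (K * j)"
    have P: "real N powr (- (1 - \<epsilon> / 2)) \<le> ?P"
    proof -
      have ln3: "ln (3 * (x + 1)) \<ge> 0" using x by simp
      have "real (K * j) \<le> \<kappa> * x + real K"
      proof -
        have "real K * real j \<le> real K * y" using j by (intro mult_left_mono) auto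
        also have "\<dots> = \<kappa> * x + real K" by (simp add: y_def \<kappa>_def algebra_simps)
        finally show ?thesis by simp
      qed
      then have "real (K * j) * ln (3 * (x + 1)) \<le> (\<kappa> * x + real K) * ln (3 * (x + 1))" using ln3 by (intro mult_right_mono) auto
      also have "\<dots> \<le> (1 - \<epsilon> / 2) * ln (real N)" using N(2,6) by (simp add: x_def pos_divide_less_eq)
      finally have "- (1 - \<epsilon> / 2) * ln (real N) \<le> - (real (K * j) * ln (3 * (x + 1)))"
        by (simp only: mult_minus_left neg_le_iff_le)
      moreover have "real N powr (- (1 - \<epsilon> / 2)) = exp (- (1 - \<epsilon> / 2) * ln (real N))"
        using N(2) by (simp only: powr_def) simp
      ultimately have "real N powr (- (1 - \<epsilon> / 2)) \<le> exp (- (real (K * j) * ln (3 * (x + 1))))"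
        by (simp only: exp_le_cancel_iff)
      also have "\<dots> = ?P"
      proof -
        have "exp (- (real (K * j) * ln (3 * (x + 1)))) = exp (real (K * j) * (- ln (3 * (x + 1))))" by simp
        also have "\<dots> = exp (- ln (3 * (x + 1))) ^ (K * j)" by (rule exp_of_nat_mult)
        also have "exp (- ln (3 * (x + 1))) = 1 / (3 * (x + 1))" using x by (simp add: exp_minus inverse_eq_divide)
        finally show ?thesis .
      qed
      finally show ?thesis .
    qed
    have P1: "?P \<le> 1" and P0: "0 \<le> ?P" using x by (intro power_le_one zero_le_power; simp)+
    have "- ln \<eta> \<le> ?P * real t"
    proof (cases "real N / y - 1 \<ge> 0")
      case True
      have "- ln \<eta> \<le> real N powr (- (1 - \<epsilon> / 2)) * (real N / y - 1)" using N(5) by (simp add: x_def y_def)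
      also have "\<dots> \<le> ?P * real t" by (rule mult_mono[OF P t P0 True])
      finally show ?thesis .
    next
      case False
      have "- ln \<eta> \<le> real N powr (- (1 - \<epsilon> / 2)) * (real N / y - 1)" using N(5) by (simp add: x_def y_def)
      also have "\<dots> \<le> 0" using False by (intro mult_nonneg_nonpos) auto
      also have "0 \<le> ?P * real t" using x by (intro mult_nonneg_nonneg zero_le_power) auto
      finally show ?thesis .
    qed
    then have "exp (- (?P * real t)) \<le> \<eta>" using eta by (metis exp_le_cancel_iff exp_ln minus_le_iff)
    moreover have "(1 - ?P) ^ t \<le> exp (- (?P * real t))"
    proof -
      have "(1 - ?P) ^ t \<le> exp (- ?P) ^ t" using P1 exp_ge_add_one_self[of "- ?P"] by (intro power_mono) auto
      also have "\<dots> = exp (real t * - ?P)" by (simp only: exp_of_nat_mult)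
      finally show ?thesis by (simp add: mult.commute)
    qed
    moreover have "prob (avoids N ?H (N + t * j)) \<le> (1 - ?P) ^ t"
      using x by (intro prob_avoids_high_level_le[OF _ jx]) auto
    ultimately have small: "prob (avoids N ?H (N + t * j)) \<le> \<eta>" by linarith
    have sub: "{\<omega> \<in> space M. \<forall>i\<ge>m. real (L (A i \<omega>)) < \<beta> * h i} \<subseteq> avoids N ?H (N + t * j)"
    proof
      fix \<omega> assume w: "\<omega> \<in> {\<omega> \<in> space M. \<forall>i\<ge>m. real (L (A i \<omega>)) < \<beta> * h i}"
      have "\<not> x \<le> real (L (A i \<omega>))" if i: "i \<le> N + t * j" "N \<le> i" for i
      proof -
        have "ln (real N) \<le> ln (real i)" using i N(2) by simp
        then have "h i \<le> h (2 * N)" using i tN N(3) by (intro h_mono) auto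
        then have "\<beta> * h i \<le> x" using beta by (simp add: x_def)
        moreover have "real (L (A i \<omega>)) < \<beta> * h i" using w i N(1) by auto
        ultimately show ?thesis by linarith
      qed
      then show "\<omega> \<in> avoids N ?H (N + t * j)" using w by (auto simp: avoids_def)
    qed
    show "\<exists>S \<in> sets M. {\<omega> \<in> space M. \<forall>i\<ge>m. real (L (A i \<omega>)) < \<beta> * h i} \<subseteq> S \<and> prob S \<le> \<eta>"
      using sub small avoids_sets by blast
  qed
  then have "AE \<omega> in M. \<forall>m. \<omega> \<notin> {\<omega> \<in> space M. \<forall>i\<ge>m. real (L (A i \<omega>)) < \<beta> * h i}" by (subst AE_all_countable) blast
  with AE_space show ?thesis
  proof eventually_elim
    case (elim \<omega>)
    then have "\<exists>i\<ge>m. \<beta> * h i \<le> real (L (A i \<omega>))" for m by (auto simp: not_less)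
    then show ?case by (auto simp: frequently_sequentially)
  qed
qed

end

theorem theorem2p1p1:
  fixes M :: "'w measure" and K :: nat and A :: "nat \<Rightarrow> 'w \<Rightarrow> int set"
  assumes "K \<ge> 2"
    and "annihilation_creation_process M K A"
    and "AE \<omega> in M. A 0 \<omega> = {0}"
  shows "AE \<omega> in M.
      limsup (\<lambda>n. ereal (real (L (A n \<omega>)) / h n)) = ereal ((real K - 1) / real K) \<and>
      liminf (\<lambda>n. ereal (real (L (A n \<omega>)))) = ereal (real K - 2)"
proof -
  interpret started_process M K A
    by (intro started_process.intro started_process_axioms.intro assms)
  define c where "c = (real K - 1) / real K"
  define u where "u = (\<lambda>j. (1 + 1 / real (Suc j)) * c)"
  define l where "l = (\<lambda>j. (1 - 1 / real (Suc (Suc j))) * c)"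
  have u: "(\<lambda>j. ereal (u j)) \<longlonglongrightarrow> ereal c" unfolding u_def by (intro tendsto_ereal) real_asymp
  have l: "(\<lambda>j. ereal (l j)) \<longlonglongrightarrow> ereal c" unfolding l_def by (intro tendsto_ereal) real_asymp
  have hpos: "\<forall>\<^sub>F n in sequentially. h n > 0" unfolding h_def by real_asymp
  have "AE \<omega> in M. \<forall>j. \<forall>\<^sub>F n in sequentially. real (L (A n \<omega>)) < u j * h n"
    unfolding u_def c_def AE_all_countable by (intro allI AE_L_upper) simp
  moreover have "AE \<omega> in M. \<forall>j. \<exists>\<^sub>F n in sequentially. l j * h n \<le> real (L (A n \<omega>))"
    unfolding l_def c_def AE_all_countable by (intro allI AE_frequently_L_ge) auto
  ultimately show ?thesis using AE_L_ge AE_frequently_L_minimal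
  proof eventually_elim
    case (elim \<omega>)
    let ?f = "\<lambda>n. ereal (real (L (A n \<omega>)) / h n)"
    let ?g = "\<lambda>n. ereal (real (L (A n \<omega>)))"
    have "limsup ?f \<le> ereal (u j)" for j
    proof (rule Limsup_bounded)
      show "\<forall>\<^sub>F n in sequentially. ?f n \<le> ereal (u j)"
        using elim(1)[rule_format, of j] hpos by eventually_elim (simp add: pos_divide_le_eq)
    qed
    then have up: "limsup ?f \<le> ereal c" by (intro LIMSEQ_le_const[OF u]) auto
    have "ereal (l j) \<le> limsup ?f" for j
    proof (rule ccontr)
      assume "\<not> ereal (l j) \<le> limsup ?f"
      then have "\<forall>\<^sub>F n in sequentially. ?f n < ereal (l j)" by (intro Limsup_lessD) simp
      with hpos have "\<forall>\<^sub>F n in sequentially. \<not> l j * h n \<le> real (L (A n \<omega>))"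
        by eventually_elim (simp add: pos_divide_less_eq not_le)
      then show False using elim(2)[rule_format, of j] by (simp add: frequently_def)
    qed
    then have lo: "ereal c \<le> limsup ?f" by (intro LIMSEQ_le_const2[OF l]) auto
    have "ereal (real K - 2) \<le> liminf ?g"
    proof (rule Liminf_bounded)
      show "\<forall>\<^sub>F n in sequentially. ereal (real K - 2) \<le> ?g n"
        using elim(3) by eventually_elim simp
    qed
    moreover have "liminf ?g \<le> ereal (real K - 2)"
    proof (rule ccontr)
      assume "\<not> liminf ?g \<le> ereal (real K - 2)"
      then have "\<forall>\<^sub>F n in sequentially. ereal (real K - 2) < ?g n" by (intro less_LiminfD) simp
      then have "\<forall>\<^sub>F n in sequentially. L (A n \<omega>) \<noteq> K - 2"
        by eventually_elim (use K2 in \<open>auto simp: of_nat_diff\<close>)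
      then show False using elim(4) by (simp add: frequently_def)
    qed
    ultimately show ?case using up lo by (simp add: c_def antisym)
  qed
qed

end
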